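(* Let $d$ be the left-invariant sub-Riemannian metric on $SO_0(2,1)$ described in the context, and let $C(g)$, $S(g)$, $S_1(g)$ denote respectively the cut locus, the conjugate set and the first conjugate set of $g$ in $(SO_0(2,1),d)$. For every $g\in SO_0(2,1)$, $C(g)=gC(e)$ and $S(g)=gS(e)$. Moreover, $$C(e)=K(e)\cup S_1(e),$$ where $$K(e)=\{C=(c_{ij})\in SO_0(2,1)\mid c_{21}=-c_{12},\ c_{31}=-c_{13},\ c_{23}=c_{32},\ c_{22}+c_{33}<0\},$$ $$S_1(e)=SO(2)\setminus\{e\}.$$
   Context: $SO_0(2,1)$ is the connected component of the unit $e$ in the group of linear transformations of $\mathbb{R}^3$ preserving the form $-ts+x_1y_1+x_2y_2$; it consists of real $3\times3$ matrices $C=(c_{ij})$ with $C^{-1}=IC^TI$, $I=\operatorname{diag}(-1,1,1)$, $c_{11}\ge1$, $\det C=1$. $SO(2)$ is identified with the subgroup $1\otimes SO(2)$ of block-diagonal matrices with blocks $1$ and $A\in SO(2)$. The Lie algebra $\mathfrak{so}(2,1)$ has the basis $$a=\begin{pmatrix}0&1&0\\1&0&0\\0&0&0\end{pmatrix},\quad b=\begin{pmatrix}0&0&1\\0&0&0\\1&0&0\end{pmatrix},\quad c=\begin{pmatrix}0&0&0\\0&0&-1\\0&1&0\end{pmatrix}.$$ $D$ is the left-invariant distribution on $SO_0(2,1)$ with $D(e)=\operatorname{span}(a,b)$, with the left-invariant scalar product for which $a,b$ is an orthonormal basis of $D(e)$; $d$ is the corresponding left-invariant sub-Riemannian (Carnot–Carathéodory)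 metric. It has no abnormal geodesics. Every arclength-parametrized geodesic of $d$ with $\gamma(0)=e$ has the form $\gamma(\beta,\phi;t)=\exp\big(t(\cos\phi\, a+\sin\phi\, b-\beta c)\big)\exp(t\beta c)$, $t\in\mathbb{R}$, with constants $\phi,\beta\in\mathbb{R}$. The exponential map $\operatorname{Exp}_x$ is the sub-Riemannian exponential map, defined on $D(x)\times\operatorname{Ann}(D(x))$, where, with $M=SO_0(2,1)$, $\operatorname{Ann}(D(x))=\{\psi\in T_x^*M:\langle\psi,D(x)\rangle=0\}$; for $x=e$, up to the choice of sign of the linear coordinate on the one-dimensional space $\operatorname{Ann}(D(e))$, it sends the pair with first component $t(\cos\phi\,a+\sin\phi\,b)$, $t>0$, and second component with coordinate $t\beta$ to $\gamma(\beta,\phi;t)$. The cut locus $C(x)$ is the set of ends of all shortest arcs starting at $x$ and noncontinuable (as shortest arcs) beyond their ends. The conjugate set $S(x)$ (respectively, first conjugate set $S_1(x)$) is the image under $\operatorname{Exp}_x$ of the set of critical points (respectively, first critical points) of $\operatorname{Exp}_x$ along geodesics with origin $x$.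
   Formalization: The first conjugate set S_1(x) is taken with x itself removed, since by the literal definition e lies in S_1(e) (for example β = 2/√3, t = 2π√3 gives a first critical point with γ = e), which would contradict S_1(e) = SO(2)∖{e}. *)

theory Defs
  imports "HOL-Analysis.Analysis"
begin

type_synonym mat3 = "real^3^3"

definition I21 :: mat3 where
  "I21 = vector [vector [-1, 0, 0], vector [0, 1, 0], vector [0, 0, 1]]"

definition SO21 :: "mat3 set" where
  "SO21 = {C. matrix_inv C = I21 ** transpose C ** I21 \<and> C $ 1 $ 1 \<ge> 1 \<and> det C = 1}"

definition SO2 :: "mat3 set" where
  "SO2 = {vector [vector [1, 0, 0],
                  vector [0, A $ 1 $ 1, A $ 1 $ 2],
                  vector [0, A $ 2 $ 1, A $ 2 $ 2]] | A :: real^2^2. rotation_matrix A}"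

definition mat_a :: mat3 where
  "mat_a = vector [vector [0, 1, 0], vector [1, 0, 0], vector [0, 0, 0]]"

definition mat_b :: mat3 where
  "mat_b = vector [vector [0, 0, 1], vector [0, 0, 0], vector [1, 0, 0]]"

definition mat_c :: mat3 where
  "mat_c = vector [vector [0, 0, 0], vector [0, 0, -1], vector [0, 1, 0]]"

definition tangent :: "mat3 \<Rightarrow> mat3 set" where
  "tangent x = (\<lambda>A. x ** A) ` span {mat_a, mat_b, mat_c}"

definition distr :: "mat3 \<Rightarrow> mat3 set" where
  "distr x = (\<lambda>A. x ** A) ` span {mat_a, mat_b}"

text \<open>The factor 2: for the entrywise inner product \<open>\<bullet>\<close> of matrices, \<open>mat_a\<close>, \<open>mat_b\<close>, \<open>mat_c\<close> are
  pairwise orthogonal with squared norm 2. Hence this is the left-invariant scalar product on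
  \<open>distr x\<close> with orthonormal basis \<open>x ** mat_a\<close>, \<open>x ** mat_b\<close>.\<close>

definition sr_inner :: "mat3 \<Rightarrow> mat3 \<Rightarrow> mat3 \<Rightarrow> real" where
  "sr_inner x v w = ((matrix_inv x ** v) \<bullet> (matrix_inv x ** w)) / 2"

definition sr_norm :: "mat3 \<Rightarrow> mat3 \<Rightarrow> real" where
  "sr_norm x v = sqrt (sr_inner x v v)"

definition speed :: "(real \<Rightarrow> mat3) \<Rightarrow> real \<Rightarrow> real" where
  "speed \<gamma> t = sr_norm (\<gamma> t) (vector_derivative \<gamma> (at t))"

text \<open>\<open>piecewise_C1_differentiable_on\<close> does not bound the derivative near the exceptional points,
  so integrability of the speed is required separately.\<close>

definition horizontal_path :: "real \<Rightarrow> (real \<Rightarrow> mat3) \<Rightarrow> bool" where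
  "horizontal_path T \<gamma> \<longleftrightarrow>
     \<gamma> piecewise_C1_differentiable_on {0..T} \<and> \<gamma> ` {0..T} \<subseteq> SO21 \<and>
     (\<exists>S. finite S \<and> (\<forall>t\<in>{0..T} - S. vector_derivative \<gamma> (at t) \<in> distr (\<gamma> t))) \<and>
     speed \<gamma> integrable_on {0..T}"

definition sr_length :: "real \<Rightarrow> (real \<Rightarrow> mat3) \<Rightarrow> real" where
  "sr_length T \<gamma> = integral {0..T} (speed \<gamma>)"

definition sr_dist :: "mat3 \<Rightarrow> mat3 \<Rightarrow> real" where
  "sr_dist x y = Inf {sr_length T \<gamma> | T \<gamma>. 0 \<le> T \<and> horizontal_path T \<gamma> \<and> \<gamma> 0 = x \<and> \<gamma> T = y}"

text \<open>Shortest arcs are parametrized by arclength; otherwise a path that stays at its end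
  for some time would count as a continuation.\<close>

definition shortest_arc :: "real \<Rightarrow> (real \<Rightarrow> mat3) \<Rightarrow> bool" where
  "shortest_arc T \<gamma> \<longleftrightarrow>
     0 < T \<and> horizontal_path T \<gamma> \<and>
     (\<exists>S. finite S \<and> (\<forall>t\<in>{0..T} - S. speed \<gamma> t = 1)) \<and>
     sr_length T \<gamma> = sr_dist (\<gamma> 0) (\<gamma> T)"

definition cut_locus :: "mat3 \<Rightarrow> mat3 set" where
  "cut_locus x = {\<gamma> T | T \<gamma>. shortest_arc T \<gamma> \<and> \<gamma> 0 = x \<and>
     \<not> (\<exists>T' \<gamma>'. T < T' \<and> shortest_arc T' \<gamma>' \<and> (\<forall>t\<in>{0..T}. \<gamma>' t = \<gamma> t))}"

text \<open>The sub-Riemannian Hamiltonian, half the squared norm of a covector restricted to the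
  distribution. Covectors are represented by matrices acting through \<open>\<bullet>\<close>. Since the fields
  \<open>x ** mat_a\<close>, \<open>x ** mat_b\<close> are tangent to \<open>SO21\<close>, Hamilton's equations in the space of all
  matrices, with covectors restricted to \<open>tangent x\<close>, give the Hamiltonian flow on the cotangent
  bundle of \<open>SO21\<close>.\<close>

definition hamiltonian :: "mat3 \<Rightarrow> mat3 \<Rightarrow> real" where
  "hamiltonian x p = ((p \<bullet> (x ** mat_a))\<^sup>2 + (p \<bullet> (x ** mat_b))\<^sup>2) / 2"

definition normal_extremal :: "(real \<Rightarrow> mat3) \<Rightarrow> (real \<Rightarrow> mat3) \<Rightarrow> bool" where
  "normal_extremal X P \<longleftrightarrow>
     (\<forall>t. \<exists>X' P'. (X has_vector_derivative X') (at t) \<and> (P has_vector_derivative P') (at t) \<and>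
        (GDERIV (\<lambda>p. hamiltonian (X t) p) (P t) :> X') \<and>
        (GDERIV (\<lambda>x. hamiltonian x (P t)) (X t) :> - P'))"

text \<open>The annihilator of \<open>distr x\<close> in the cotangent space, whose elements are represented by
  their Riesz representatives in \<open>tangent x\<close> with respect to \<open>\<bullet>\<close>.\<close>

definition Ann :: "mat3 \<Rightarrow> mat3 set" where
  "Ann x = {\<psi> \<in> tangent x. \<forall>v\<in>distr x. \<psi> \<bullet> v = 0}"

text \<open>A pair \<open>(u, \<psi>)\<close> determines the initial covector \<open>\<langle>u, _\<rangle> + \<psi>\<close>, where \<open>\<langle>u, _\<rangle>\<close> is extended from
  \<open>distr x\<close> to \<open>tangent x\<close> by zero on \<open>x ** mat_c\<close>.\<close>

definition sr_exp :: "mat3 \<Rightarrow> mat3 \<times> mat3 \<Rightarrow> mat3" where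
  "sr_exp x = (\<lambda>(u, \<psi>). THE y. \<exists>X P. normal_extremal X P \<and> X 0 = x \<and>
     (\<forall>v\<in>tangent x. P 0 \<bullet> v = sr_inner x u v + \<psi> \<bullet> v) \<and> X 1 = y)"

definition critical_point :: "mat3 \<Rightarrow> mat3 \<times> mat3 \<Rightarrow> bool" where
  "critical_point x p \<longleftrightarrow> p \<in> distr x \<times> Ann x \<and>
     (\<exists>F. (sr_exp x has_derivative F) (at p within distr x \<times> Ann x) \<and>
          F ` (distr x \<times> Ann x) \<noteq> tangent (sr_exp x p))"

text \<open>The points \<open>(0, \<psi>)\<close> do not lie on rays that are mapped to geodesics: \<open>sr_exp x\<close> maps them
  to \<open>x\<close>.\<close>

definition conjugate_set :: "mat3 \<Rightarrow> mat3 set" where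
  "conjugate_set x = {sr_exp x (u, \<psi>) | u \<psi>. u \<noteq> 0 \<and> critical_point x (u, \<psi>)}"

text \<open>By convention \<open>x\<close> is not a first conjugate point of itself. This is needed because some
  geodesics return to their origin exactly at their first critical point (for instance those with
  \<open>\<beta> = 2 / sqrt 3\<close>, where \<open>\<beta>\<close> is the ratio of the \<open>mat_c\<close>-component of the initial covector
  to the norm of its restriction to the distribution).\<close>

definition first_conjugate_set :: "mat3 \<Rightarrow> mat3 set" where
  "first_conjugate_set x = {sr_exp x (u, \<psi>) | u \<psi>. u \<noteq> 0 \<and> critical_point x (u, \<psi>) \<and>
     (\<forall>s. 0 < s \<and> s < 1 \<longrightarrow> \<not> critical_point x (s *\<^sub>R u, s *\<^sub>R \<psi>))} - {x}"

end

theory Submission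
  imports Defs
begin

text \<open>A horizontal path is the horizontal lift of a curve in the hyperbolic plane of the same length; its
  rotational part is the holonomy, i.e. the area \<open>\<theta>\<close> swept out from the base point. So a shortest arc
  solves a Dido problem. In polar coordinates with \<open>s = sinh (r / 2)\<close> the function \<open>W b s + b \<theta>\<close> with
  \<open>dW/dr = sqrt (1 - b\<^sup>2 tanh\<^sup>2 (r / 2))\<close> has horizontal gradient of norm one wherever \<open>b tanh (r / 2) \<le> 1\<close>,
  which bounds lengths from below as long as the arc recedes from the base point. An arbitrary
  competitor whose maximal distance from the base point is \<open>r\<close> is bounded with the special value
  \<open>b = coth (r / 2)\<close>: it may switch to the second sheet \<open>- W b s + b \<theta>\<close> at that distance. The resulting
  bound is minimized over \<open>b\<close>, and equality forces the curve to be an arc of constant curvature. Hence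
  geodesics are shortest exactly until the holonomy reaches \<open>\<pi>\<close> in absolute value or the projected
  circle closes up.

  The conjugate points follow from the explicit exponential map: it degenerates for \<open>4 q = B\<^sup>2 - \<bar>u\<bar>\<^sup>2\<close>
  first at \<open>q = \<pi>\<^sup>2\<close>, where \<open>sin (sqrt q) = 0\<close>.\<close>

section \<open>The functions cos (sqrt q) and sin (sqrt q) / sqrt q\<close>

text \<open>Minimality is proved against arbitrary competitors. Every point other than the identity
  is reached by an explicit geodesic with holonomy at most pi whose projected circle is traversed at
  most once (\<open>admissible\<close>); calibration shows that nothing is shorter, and its equality
  case that nothing else is equally short. The endpoint fixes the holonomy only modulo 2 pi, so the
  bound pi is what guarantees that a competitor has holonomy at least as large in absolute value.

  A single sheet lives on the disc \<open>b tanh (r / 2) \<le> 1\<close>, whose rim is where an arc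
  of curvature b turns back, and a competitor may leave this disc. Taking b from the competitor's
  own maximal distance puts its whole track inside. The price is that b is then no longer the
  curvature of the target geodesic; comparing the arcs over one chord makes up for the difference.

  Curvatures below, at and above 1 lead to hyperbolic, parabolic and elliptic formulas. The entire
  functions cos (sqrt q) and sin (sqrt q) / sqrt q of a signed square q cover all three and are
  smooth across the border.\<close>

definition cosq :: "real \<Rightarrow> real" where
  "cosq q = (\<Sum>n. (-1) ^ n / fact (2 * n) * q ^ n)"

definition sinq :: "real \<Rightarrow> real" where
  "sinq q = (\<Sum>n. (-1) ^ n / fact (2 * n + 1) * q ^ n)"

definition sinq' :: "real \<Rightarrow> real" where
  "sinq' q = (\<Sum>n. diffs (\<lambda>n. (-1) ^ n / fact (2 * n + 1)) n * q ^ n)"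

lemma summable_entire:
  fixes c :: "nat \<Rightarrow> real"
  assumes "\<And>n. \<bar>c n\<bar> \<le> 1 / fact n"
  shows "summable (\<lambda>n. c n * q ^ n)"
proof (rule summable_comparison_test)
  show "\<exists>N. \<forall>n\<ge>N. norm (c n * q ^ n) \<le> \<bar>q\<bar> ^ n /\<^sub>R fact n"
  proof (intro exI[of _ 0] allI impI)
    fix n
    have "\<bar>c n\<bar> * \<bar>q\<bar> ^ n \<le> (1 / fact n) * \<bar>q\<bar> ^ n"
      by (rule mult_right_mono[OF assms]) auto
    then show "norm (c n * q ^ n) \<le> \<bar>q\<bar> ^ n /\<^sub>R fact n"
      by (simp add: abs_mult power_abs divide_inverse mult.commute)
  qed
  show "summable (\<lambda>n. \<bar>q\<bar> ^ n /\<^sub>R fact n)"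
    by (rule summable_exp_generic)
qed

lemma summable_cosq: "summable (\<lambda>n. (-1) ^ n / fact (2 * n) * q ^ n :: real)"
  by (rule summable_entire) (auto simp: abs_mult power_abs intro!: divide_left_mono fact_mono)

lemma summable_sinq: "summable (\<lambda>n. (-1) ^ n / fact (2 * n + 1) * q ^ n :: real)"
  by (rule summable_entire)
    (auto simp: abs_mult power_abs simp del: fact_Suc intro!: divide_left_mono fact_mono)

lemma summable_sinq': "summable (\<lambda>n. diffs (\<lambda>n. (-1) ^ n / fact (2 * n + 1)) n * q ^ n :: real)"
  by (rule termdiff_converges_all) (rule summable_sinq)

lemma DERIV_cosq: "(cosq has_real_derivative - sinq q / 2) (at q)"
proof -
  have "diffs (\<lambda>n. (-1) ^ n / fact (2 * n)) n = - (1/2) * ((-1) ^ n / fact (2 * n + 1) :: real)" for n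
  proof -
    have "fact (2 * Suc n) = 2 * (real (Suc n) * fact (2 * n + 1))"
      by (simp add: algebra_simps)
    then show ?thesis by (simp add: diffs_def del: fact_Suc of_nat_Suc)
  qed
  then have "(\<Sum>n. diffs (\<lambda>n. (-1) ^ n / fact (2 * n)) n * q ^ n)
      = (\<Sum>n. - (1/2) * ((-1) ^ n / fact (2 * n + 1) * q ^ n :: real))"
    by (simp only: mult.assoc)
  also have "\<dots> = - (1/2) * sinq q"
    unfolding sinq_def by (rule suminf_mult[OF summable_sinq])
  finally show ?thesis
    using termdiffs_strong_converges_everywhere[OF summable_cosq, of q]
    unfolding cosq_def[abs_def] by simp
qed

lemma DERIV_sinq: "(sinq has_real_derivative sinq' q) (at q)"
  using termdiffs_strong_converges_everywhere[OF summable_sinq, of q]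
  unfolding sinq_def[abs_def] sinq'_def .

text \<open>Differentiating \<open>y * sinq (y\<^sup>2) = sin y\<close> suggests the identity;
  comparing power series proves it for every sign of \<open>q\<close>. Wherever a value of
  \<open>sinq'\<close> is wanted, this identity supplies it.\<close>

lemma sinq'_eq: "2 * q * sinq' q = cosq q - sinq q"
proof -
  let ?c = "\<lambda>n. (-1) ^ n / fact (2 * n + 1) :: real"
  have "(\<lambda>n. of_nat n * ?c n * q ^ (n - Suc 0)) sums sinq' q"
    unfolding sinq'_def by (rule diffs_equiv[OF summable_sinq'])
  then have 1: "(\<lambda>n. 2 * q * (of_nat n * ?c n * q ^ (n - Suc 0))) sums (2 * q * sinq' q)"
    by (rule sums_mult)
  have "2 * q * (of_nat n * ?c n * q ^ (n - Suc 0)) = (-1) ^ n / fact (2 * n) * q ^ n - ?c n * q ^ n" for n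
  proof -
    define F :: real where "F = fact (2 * n)"
    have F: "F \<noteq> 0" "fact (2 * n + 1) = (2 * real n + 1) * F" "2 * real n + 1 \<noteq> 0"
      by (simp_all add: F_def)
    \<comment> \<open>At \<open>n = 0\<close> the truncated exponent \<open>n - Suc 0\<close> is 0,
      and the factor \<open>of_nat n\<close> makes both sides vanish.\<close>
    have "q * (of_nat n * q ^ (n - Suc 0)) = of_nat n * q ^ n"
      by (cases n) auto
    then have "2 * q * (of_nat n * ?c n * q ^ (n - Suc 0)) = 2 * real n * ?c n * q ^ n"
      by (simp add: mult_ac)
    also have "2 * real n * ?c n = (-1) ^ n / F - ?c n"
      using F(1,3) unfolding F(2) by (simp add: divide_simps) (simp add: algebra_simps)
    finally show ?thesis by (simp add: F_def left_diff_distrib)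
  qed
  moreover have "(\<lambda>n. (-1) ^ n / fact (2 * n) * q ^ n - ?c n * q ^ n) sums (cosq q - sinq q)"
    unfolding cosq_def sinq_def
    by (intro sums_diff summable_sums summable_cosq summable_sinq)
  ultimately show ?thesis
    using 1 sums_unique2 by (simp only:)
qed

lemma cosq_0 [simp]: "cosq 0 = 1" and sinq_0 [simp]: "sinq 0 = 1"
  using powser_zero[of "\<lambda>n. (-1) ^ n / fact (2 * n) :: real"]
    powser_zero[of "\<lambda>n. (-1) ^ n / fact (2 * n + 1) :: real"]
  by (simp_all add: cosq_def sinq_def)

text \<open>The derivative of the left-hand side vanishes by \<open>sinq'_eq\<close>, and its value
  at 0 is 1. This unites cos^2 + sin^2 = 1 and cosh^2 - sinh^2 = 1.\<close>

lemma cosq_sinq: "(cosq q)\<^sup>2 + q * (sinq q)\<^sup>2 = 1"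
proof -
  have "((\<lambda>q. (cosq q)\<^sup>2 + q * (sinq q)\<^sup>2) has_real_derivative 0) (at x)" for x
  proof -
    have "2 * cosq x * (- sinq x / 2) + ((sinq x)\<^sup>2 + sinq x * (2 * x * sinq' x)) = 0"
      unfolding sinq'_eq by (simp add: algebra_simps power2_eq_square)
    then show ?thesis
      by (auto intro!: derivative_eq_intros DERIV_cosq DERIV_sinq
          simp: algebra_simps power2_eq_square)
  qed
  then have "(cosq q)\<^sup>2 + q * (sinq q)\<^sup>2 = (cosq 0)\<^sup>2 + 0 * (sinq 0)\<^sup>2"
    using DERIV_isconst_all by blast
  then show ?thesis by simp
qed

lemma cosq_square: "cosq (y\<^sup>2) = cos y"
  unfolding cosq_def using cos_paired[of y, THEN sums_unique]
  by (simp add: power_mult)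

lemma sinq_square: "y * sinq (y\<^sup>2) = sin y"
proof -
  have "y * sinq (y\<^sup>2) = (\<Sum>n. y * ((-1) ^ n / fact (2 * n + 1) * (y\<^sup>2) ^ n))"
    unfolding sinq_def by (rule suminf_mult[OF summable_sinq, symmetric])
  also have "\<dots> = sin y"
    unfolding sin_paired[of y, THEN sums_unique]
    by (intro suminf_cong) (simp add: power_mult del: fact_Suc)
  finally show ?thesis .
qed

declare DERIV_cosq [THEN DERIV_chain2, derivative_intros]
  and DERIV_sinq [THEN DERIV_chain2, derivative_intros]

lemma continuous_on_cosq [continuous_intros]:
  "continuous_on S f \<Longrightarrow> continuous_on S (\<lambda>x. cosq (f x))"
  by (rule continuous_on_compose2[of UNIV cosq])
    (auto intro!: continuous_at_imp_continuous_on DERIV_isCont[OF DERIV_cosq])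

lemma continuous_on_sinq [continuous_intros]:
  "continuous_on S f \<Longrightarrow> continuous_on S (\<lambda>x. sinq (f x))"
  by (rule continuous_on_compose2[of UNIV sinq])
    (auto intro!: continuous_at_imp_continuous_on DERIV_isCont[OF DERIV_sinq])

lemma cosq_ge_1: assumes "q \<le> 0" shows "cosq q \<ge> 1"
proof -
  have "(-1) ^ n * q ^ n = (-q) ^ n" for n by (simp add: power_mult_distrib[symmetric])
  then have nn: "(-1) ^ n / fact (2 * n) * q ^ n \<ge> 0" for n
    using assms by (simp add: field_simps)
  have "(\<Sum>n\<in>{0}. (-1) ^ n / fact (2 * n) * q ^ n) \<le> cosq q"
    unfolding cosq_def by (rule sum_le_suminf[OF summable_cosq]) (use nn in auto)
  then show ?thesis by simp
qed

lemma sinq_ge_1: assumes "q \<le> 0" shows "sinq q \<ge> 1"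
proof -
  have "(-1) ^ n * q ^ n = (-q) ^ n" for n by (simp add: power_mult_distrib[symmetric])
  then have nn: "(-1) ^ n / fact (2 * n + 1) * q ^ n \<ge> 0" for n
    using assms by (simp add: field_simps)
  have "(\<Sum>n\<in>{0}. (-1) ^ n / fact (2 * n + 1) * q ^ n) \<le> sinq q"
    unfolding sinq_def by (rule sum_le_suminf[OF summable_sinq]) (use nn in auto)
  then show ?thesis by simp
qed

text \<open>The difference of the two sides vanishes at 0 and has derivative y sin y. The inequality
  drives two monotonicity facts: \<open>sinq'\<close> is negative up to pi^2, and the length of an
  arc over a fixed chord grows with its phase.\<close>

lemma mult_cos_less_sin:
  assumes "0 < y" "y \<le> pi" shows "y * cos y < sin y"
proof -
  have "sin 0 - 0 * cos 0 < sin y - y * cos y"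
  proof (rule DERIV_pos_imp_increasing_open[OF assms(1)])
    fix x :: real assume x: "0 < x" "x < y"
    have "((\<lambda>y. sin y - y * cos y) has_real_derivative x * sin x) (at x)"
      by (auto intro!: derivative_eq_intros)
    moreover have "x * sin x > 0" using x assms by (simp add: sin_gt_zero)
    ultimately show "\<exists>z. ((\<lambda>y. sin y - y * cos y) has_real_derivative z) (at x) \<and> z > 0" by blast
  qed (auto intro!: continuous_intros)
  then show ?thesis by simp
qed

text \<open>For \<open>q \<le> 0\<close> all terms of the derived series are nonpositive and the
  constant one, -1/6, is negative. For q = y^2 > 0 the identity \<open>sinq'_eq\<close> turns the
  claim into y cos y < sin y. The range includes pi^2, the first zero of
  \<open>sinq\<close>.\<close>

lemma sinq'_neg: assumes "q \<le> pi\<^sup>2" shows "sinq' q < 0"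
proof (cases "q \<le> 0")
  case True
  let ?f = "\<lambda>n. diffs (\<lambda>n. (-1) ^ n / fact (2 * n + 1)) n * q ^ n :: real"
  have "(-1) ^ n * q ^ n = (-q) ^ n" for n by (simp add: power_mult_distrib[symmetric])
  then have "?f n = - (Suc n / fact (2 * n + 3) * (-q) ^ n)" for n
    by (simp add: diffs_def field_simps del: of_nat_Suc fact_Suc) 
      (simp add: eval_nat_numeral)
  then have f: "?f n \<le> 0" for n
    using True by (simp del: of_nat_Suc fact_Suc)
  have f0: "?f 0 < 0"
    by (simp add: diffs_def)
  have "0 < (\<Sum>n. - ?f n)"
    by (rule suminf_pos2[of _ 0]) (use f f0 summable_minus[OF summable_sinq'] in auto)
  then show ?thesis
    unfolding sinq'_def using suminf_minus[OF summable_sinq'] by simp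
next
  case False
  define y where "y = sqrt q"
  have y: "y > 0" "q = y\<^sup>2" "y \<le> pi"
    using False assms real_sqrt_le_mono[OF assms] by (auto simp: y_def)
  have "2 * y ^ 3 * sinq' q = y * (2 * q * sinq' q)"
    by (simp add: y power2_eq_square power3_eq_cube)
  also have "\<dots> = y * cos y - sin y"
    unfolding sinq'_eq using sinq_square[of y] by (simp add: y cosq_square algebra_simps)
  also have "\<dots> < 0" using mult_cos_less_sin y by simp
  finally show ?thesis using y by (simp add: mult_less_0_iff)
qed

lemma sinq_pos: assumes "q < pi\<^sup>2" shows "sinq q > 0"
proof (cases "q \<le> 0")
  case True
  then show ?thesis using sinq_ge_1[of q] by simp
next
  case False
  define y where "y = sqrt q"
  have y: "y > 0" "q = y\<^sup>2" "y < pi"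
    using False assms real_sqrt_less_mono[OF assms] by (auto simp: y_def)
  then have "y * sinq q > 0" using sinq_square[of y] sin_gt_zero by simp
  then show ?thesis using y by (simp add: zero_less_mult_iff)
qed

lemma sinq_pi [simp]: "sinq (pi\<^sup>2) = 0" and cosq_pi [simp]: "cosq (pi\<^sup>2) = - 1"
  using sinq_square[of pi] cosq_square[of pi] by auto

section \<open>Half-phase sine and cosine for curvature of either sign\<close>

definition cs :: "real \<Rightarrow> real \<Rightarrow> real" where "cs k t = cosq (k * t\<^sup>2 / 4)"
text \<open>For \<open>k = \<sigma>\<^sup>2\<close> this is sin (\<sigma> t / 2) / \<sigma>. With
  \<open>k = b\<^sup>2 - 1\<close> it is sinh (r / 2) along an arc of curvature \<open>b\<close>,
  which explains the halves.\<close>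

definition sn :: "real \<Rightarrow> real \<Rightarrow> real" where "sn k t = t / 2 * sinq (k * t\<^sup>2 / 4)"

lemma cs_0 [simp]: "cs k 0 = 1" and sn_0 [simp]: "sn k 0 = 0"
  by (simp_all add: cs_def sn_def)

lemma cs_sn: "(cs k t)\<^sup>2 + k * (sn k t)\<^sup>2 = 1"
  using cosq_sinq[of "k * t\<^sup>2 / 4"] by (simp add: cs_def sn_def power_mult_distrib power_divide algebra_simps)

lemma DERIV_cs: "(cs k has_real_derivative - k * sn k t / 2) (at t)"
  unfolding cs_def[abs_def] sn_def
  by (auto intro!: derivative_eq_intros)

lemma DERIV_sn: "(sn k has_real_derivative cs k t / 2) (at t)"
proof -
  have "sinq (k * t\<^sup>2 / 4) / 2 + t / 2 * (sinq' (k * t\<^sup>2 / 4) * (k * (2 * t) / 4)) 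
     = (sinq (k * t\<^sup>2 / 4) + 2 * (k * t\<^sup>2 / 4) * sinq' (k * t\<^sup>2 / 4)) / 2"
    by (simp add: algebra_simps power2_eq_square)
  also have "\<dots> = cs k t / 2" unfolding sinq'_eq cs_def by simp
  finally show ?thesis
    unfolding sn_def[abs_def]
    by (auto intro!: derivative_eq_intros simp: algebra_simps power2_eq_square)
qed

declare DERIV_cs [THEN DERIV_chain2, derivative_intros]
  and DERIV_sn [THEN DERIV_chain2, derivative_intros]

lemma continuous_on_cs [continuous_intros]:
  "continuous_on S f \<Longrightarrow> continuous_on S (\<lambda>x. cs k (f x))"
  and continuous_on_sn [continuous_intros]:
  "continuous_on S f \<Longrightarrow> continuous_on S (\<lambda>x. sn k (f x))"
  unfolding cs_def sn_def by (auto intro!: continuous_intros)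

lemma sn_pos: "0 < t \<Longrightarrow> k * t\<^sup>2 < 4 * pi\<^sup>2 \<Longrightarrow> 0 < sn k t"
  unfolding sn_def by (intro mult_pos_pos sinq_pos) auto

lemma sn_nonneg: "0 \<le> t \<Longrightarrow> k * t\<^sup>2 \<le> 4 * pi\<^sup>2 \<Longrightarrow> 0 \<le> sn k t"
  using sinq_pos[of "k * t\<^sup>2 / 4"] unfolding sn_def
  by (cases "k * t\<^sup>2 = 4 * pi\<^sup>2") (auto intro!: mult_nonneg_nonneg)

lemma cs_elliptic: "0 \<le> \<sigma> \<Longrightarrow> cs (\<sigma>\<^sup>2) t = cos (\<sigma> * t / 2)"
  and sn_elliptic: "\<sigma> > 0 \<Longrightarrow> sn (\<sigma>\<^sup>2) t = sin (\<sigma> * t / 2) / \<sigma>"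
  using cosq_square[of "\<sigma> * t / 2"] sinq_square[of "\<sigma> * t / 2"]
  by (auto simp: cs_def sn_def power_divide power_mult_distrib field_simps)

section \<open>Calibrations\<close>

text \<open>In the variable x = sinh (r / 2) one has dr = 2 dx / sqrt (1 + x^2), which turns sqrt (1
  - b^2 tanh^2 (r / 2)) dr into \<open>slope b x\<close> dx. The truncation by \<open>max 0\<close>
  keeps it continuous beyond the rim (b^2 - 1) x^2 = 1.\<close>

definition slope :: "real \<Rightarrow> real \<Rightarrow> real" where
  "slope b x = 2 * sqrt (max 0 (1 - (b\<^sup>2 - 1) * x\<^sup>2)) / (1 + x\<^sup>2)"

definition W :: "real \<Rightarrow> real \<Rightarrow> real" where
  "W b s = integral {0..s} (slope b)"

lemma one_plus_square_pos [simp]: "1 + x\<^sup>2 > (0::real)" "1 + x\<^sup>2 \<noteq> (0::real)"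
  by (auto simp: add_pos_nonneg add_nonneg_eq_0_iff)

lemma continuous_on_slope: "continuous_on X (slope b)"
  unfolding slope_def by (intro continuous_intros) auto

lemma W_0 [simp]: "W b 0 = 0"
  by (simp add: W_def)

lemma DERIV_W: assumes "x > 0" shows "(W b has_real_derivative slope b x) (at x)"
proof -
  have "((\<lambda>u. integral {0..u} (slope b)) has_real_derivative slope b x) (at x within {0..x+1})"
    by (rule integral_has_real_derivative[OF continuous_on_slope]) (use assms in auto)
  moreover have "at x within {0..x+1} = at x"
    by (rule at_within_interior) (use assms in auto)
  ultimately show ?thesis by (simp add: W_def[abs_def])
qed

lemma continuous_on_W: assumes "X \<subseteq> {0..}" "continuous_on Y f" "f ` Y \<subseteq> X"
  shows "continuous_on Y (\<lambda>x. W b (f x))"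
proof (rule continuous_on_compose2[OF _ assms(2)])
  show "continuous_on {0..} (W b)"
  proof (clarsimp simp: continuous_on_eq_continuous_within)
    fix x :: real assume x: "x \<ge> 0"
    have "continuous_on {0..x+1} (W b)"
      unfolding W_def[abs_def]
      by (intro indefinite_integral_continuous_1 integrable_continuous_real continuous_on_slope)
    then have "continuous (at x within {0..x+1}) (W b)"
      using x by (auto simp: continuous_on_eq_continuous_within)
    moreover have "at x within {0..x+1} = at x within {0..}"
      by (rule at_within_nhd[of _ "{x-1<..<x+1}"]) auto
    ultimately show "continuous (at x within {0..}) (W b)" by simp
  qed
  show "f ` Y \<subseteq> {0..}" using assms by auto
qed

lemma slope_pos: "(b\<^sup>2 - 1) * x\<^sup>2 < 1 \<Longrightarrow> slope b x > 0"
  unfolding slope_def by (intro divide_pos_pos) auto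

lemma scaled_square_less:
  assumes "0 \<le> x" "x < (t::real)" "k * t\<^sup>2 \<le> c" "0 < c" shows "k * x\<^sup>2 < c"
proof (cases "k \<le> 0")
  case True
  then have "k * x\<^sup>2 \<le> 0" by (simp add: mult_nonpos_nonneg)
  then show ?thesis using assms by linarith
next
  case False
  have "x\<^sup>2 < t\<^sup>2" using assms by (intro power_strict_mono) auto
  then have "k * x\<^sup>2 < k * t\<^sup>2" using False by (intro mult_strict_left_mono) auto
  then show ?thesis using assms by simp
qed

lemma W_strict_mono:
  assumes "0 \<le> s" "s < t" "(b\<^sup>2 - 1) * t\<^sup>2 \<le> 1" shows "W b s < W b t"
proof (rule DERIV_pos_imp_increasing_open[OF assms(2)])
  fix x assume x: "s < x" "x < t"
  have "(b\<^sup>2 - 1) * x\<^sup>2 < 1"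
    by (rule scaled_square_less[OF _ x(2) assms(3)]) (use assms x in simp_all)
  then show "\<exists>y. (W b has_real_derivative y) (at x) \<and> 0 < y"
    using DERIV_W[of x b] slope_pos x assms(1) by force
qed (intro continuous_on_W[of "{0..}"] continuous_intros, use assms in auto)

lemma W_le_iff:
  assumes "0 \<le> s" "0 \<le> t" "(b\<^sup>2 - 1) * t\<^sup>2 \<le> 1" "(b\<^sup>2 - 1) * s\<^sup>2 \<le> 1"
  shows "W b s \<le> W b t \<longleftrightarrow> s \<le> t"
  using W_strict_mono[of s t b] W_strict_mono[of t s b] assms by (cases s t rule: linorder_cases) auto

text \<open>What remains of a path in the group: \<open>m = sinh\<^sup>2 (r / 2)\<close> for the distance \<open>r\<close> of the projected curve
  from the base point, the holonomy \<open>\<theta>\<close> and the speed \<open>v\<close>. The equation is the hyperbolic metric,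
  as \<open>\<theta>' = tanh (r / 2)\<close> times the angular part of the speed.\<close>

definition profile ::
  "real set \<Rightarrow> real \<Rightarrow> real \<Rightarrow> (real \<Rightarrow> real) \<Rightarrow> (real \<Rightarrow> real) \<Rightarrow> (real \<Rightarrow> real) \<Rightarrow> bool" where
  "profile S a b m \<theta> v \<longleftrightarrow> finite S \<and> continuous_on {a..b} m \<and> continuous_on {a..b} \<theta> \<and>
     v integrable_on {a..b} \<and> (\<forall>t\<in>{a..b}. 0 \<le> m t) \<and>
     (\<forall>t\<in>{a<..<b} - S. 0 \<le> v t \<and>
       (\<exists>m' \<theta>'. (m has_real_derivative m') (at t) \<and> (\<theta> has_real_derivative \<theta>') (at t) \<and>
          m'\<^sup>2 + ((1 + m t) * \<theta>')\<^sup>2 = (v t)\<^sup>2 * (m t * (1 + m t))))"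

lemma profile_deriv:
  assumes "profile S a b m \<theta> v" "t \<in> {a<..<b} - S"
  obtains m' \<theta>' where "(m has_real_derivative m') (at t)" "(\<theta> has_real_derivative \<theta>') (at t)"
    "m'\<^sup>2 + ((1 + m t) * \<theta>')\<^sup>2 = (v t)\<^sup>2 * (m t * (1 + m t))" "0 \<le> v t"
proof -
  have "\<forall>t\<in>{a<..<b} - S. 0 \<le> v t \<and>
       (\<exists>m' \<theta>'. (m has_real_derivative m') (at t) \<and> (\<theta> has_real_derivative \<theta>') (at t) \<and>
          m'\<^sup>2 + ((1 + m t) * \<theta>')\<^sup>2 = (v t)\<^sup>2 * (m t * (1 + m t)))"
    using assms(1) unfolding profile_def by (elim conjE)
  from bspec[OF this assms(2)] that show ?thesis by (elim conjE exE)
qed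

lemma profile_subinterval:
  assumes "profile S a b m \<theta> v" "a \<le> c" "d \<le> b"
  shows "profile S c d m \<theta> v"
proof -
  have "{c..d} \<subseteq> {a..b}" "{c<..<d} \<subseteq> {a<..<b}" using assms by auto
  then show ?thesis
    using assms unfolding profile_def
    by (blast intro: continuous_on_subset integrable_on_subinterval)
qed

lemma profile_cong:
  assumes "profile S a b m \<theta> v" "\<And>t. t \<in> {a..b} - S \<Longrightarrow> v t = w t"
  shows "profile S a b m \<theta> w"
proof -
  have "w integrable_on {a..b}"
    by (rule integrable_spike_finite[of S _ _ v]) (use assms in \<open>auto simp: profile_def\<close>)
  moreover have "v t = w t" if "t \<in> {a<..<b} - S" for t
    using that by (intro assms(2)) auto
  ultimately show ?thesis using assms(1) unfolding profile_def by simp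
qed

text \<open>With e = -1 this is a reflection of the hyperbolic plane, which reverses the holonomy.
  It allows the final holonomy to be taken nonnegative.\<close>

lemma profile_uminus:
  assumes "profile S a b m \<theta> v" "e\<^sup>2 = 1"
  shows "profile S a b m (\<lambda>t. e * \<theta> t) v"
proof -
  have "\<exists>m' \<theta>'. (m has_real_derivative m') (at t) \<and> ((\<lambda>t. e * \<theta> t) has_real_derivative \<theta>') (at t) \<and>
          m'\<^sup>2 + ((1 + m t) * \<theta>')\<^sup>2 = (v t)\<^sup>2 * (m t * (1 + m t))" if t: "t \<in> {a<..<b} - S" for t
  proof -
    obtain m' \<theta>' where "(m has_real_derivative m') (at t)" "(\<theta> has_real_derivative \<theta>') (at t)"
      "m'\<^sup>2 + ((1 + m t) * \<theta>')\<^sup>2 = (v t)\<^sup>2 * (m t * (1 + m t))"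
      by (rule profile_deriv[OF assms(1) t])
    then show ?thesis using assms(2)
      by (intro exI[of _ m'] exI[of _ "e * \<theta>'"])
        (auto intro!: derivative_eq_intros simp: power_mult_distrib)
  qed
  then show ?thesis using assms(1) unfolding profile_def by (auto intro!: continuous_intros)
qed

text \<open>Reversing time also negates \<theta>, so that the increment of \<theta> over the whole
  interval is kept. A descent on the sheet \<open>- W\<close> thereby becomes an ascent on the sheet
  \<open>W\<close>.\<close>

lemma profile_reverse:
  assumes P: "profile S a b m \<theta> v"
  shows "profile ((\<lambda>t. a + b - t) ` S) a b (\<lambda>t. m (a + b - t)) (\<lambda>t. - \<theta> (a + b - t)) (\<lambda>t. v (a + b - t))"
  unfolding profile_def
proof (intro conjI ballI)
  have P': "finite S" "continuous_on {a..b} m" "continuous_on {a..b} \<theta>" "v integrable_on {a..b}"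
      "\<And>t. t \<in> {a..b} \<Longrightarrow> 0 \<le> m t"
    using P unfolding profile_def by blast+
  show "finite ((\<lambda>t. a + b - t) ` S)" using P'(1) by simp
  have r: "continuous_on {a..b} (\<lambda>t. a + b - t)" "(\<lambda>t. a + b - t) ` {a..b} \<subseteq> {a..b}"
    by (auto intro!: continuous_intros)
  show "continuous_on {a..b} (\<lambda>t. m (a + b - t))" "continuous_on {a..b} (\<lambda>t. - \<theta> (a + b - t))"
    using continuous_on_compose2[OF P'(2) r] continuous_on_compose2[OF P'(3) r]
    by (auto intro: continuous_on_minus)
  have "(\<lambda>t. v (- t)) integrable_on {-b..-a}"
    using P'(4) by simp
  then show "(\<lambda>t. v (a + b - t)) integrable_on {a..b}"
    using integrable_shift_real_ivl_iff[of "\<lambda>t. v (a + b - t)" "a + b" a b] by simp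
  show "0 \<le> m (a + b - t)" if "t \<in> {a..b}" for t
    using that by (intro P'(5)) auto
  fix t assume "t \<in> {a<..<b} - (\<lambda>t. a + b - t) ` S"
  then have t: "a + b - t \<in> {a<..<b} - S" by (auto simp: image_iff)
  obtain m' \<theta>' where *: "(m has_real_derivative m') (at (a + b - t))" "(\<theta> has_real_derivative \<theta>') (at (a + b - t))"
    "m'\<^sup>2 + ((1 + m (a + b - t)) * \<theta>')\<^sup>2 = (v (a + b - t))\<^sup>2 * (m (a + b - t) * (1 + m (a + b - t)))"
    and v: "0 \<le> v (a + b - t)"
    by (rule profile_deriv[OF P t])
  show "0 \<le> v (a + b - t)" by (rule v)
  have r: "((\<lambda>t. a + b - t) has_real_derivative -1) (at t)"
    by (auto intro!: derivative_eq_intros)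
  have "((\<lambda>t. m (a + b - t)) has_real_derivative m' * (-1)) (at t)"
    "((\<lambda>t. \<theta> (a + b - t)) has_real_derivative \<theta>' * (-1)) (at t)"
    using DERIV_chain2[where f=m and g="\<lambda>t. a + b - t", OF *(1) r]
      DERIV_chain2[where f=\<theta> and g="\<lambda>t. a + b - t", OF *(2) r] .
  from this(1) DERIV_minus[OF this(2)] *(3)
  show "\<exists>m' \<theta>'. ((\<lambda>t. m (a + b - t)) has_real_derivative m') (at t) \<and>
          ((\<lambda>t. - \<theta> (a + b - t)) has_real_derivative \<theta>') (at t) \<and>
          m'\<^sup>2 + ((1 + m (a + b - t)) * \<theta>')\<^sup>2 = (v (a + b - t))\<^sup>2 * (m (a + b - t) * (1 + m (a + b - t)))"
    by (intro exI[of _ "- m'"] exI[of _ "\<theta>'"]) simp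
qed

lemma increment_le_integral:
  fixes F v :: "real \<Rightarrow> real"
  assumes "finite S" "a \<le> b" "continuous_on {a..b} F" "v integrable_on {a..b}"
    and D: "\<And>t. t \<in> {a<..<b} - S \<Longrightarrow> \<exists>D. (F has_real_derivative D) (at t) \<and> D \<le> v t"
  shows "F b - F a \<le> integral {a..b} v"
proof -
  \<comment> \<open>Where no derivative is known, \<open>F'\<close> gets the default value
    \<open>v\<close>, so that \<open>F' \<le> v\<close> holds everywhere and the integrals can be
    compared.\<close>
  define F' where "F' t = (if t \<in> {a<..<b} - S then SOME D. (F has_real_derivative D) (at t) \<and> D \<le> v t else v t)" for t
  have F': "(F has_real_derivative F' t) (at t) \<and> F' t \<le> v t" if "t \<in> {a<..<b} - S" for t
    using someI_ex[OF D[OF that]] that by (simp add: F'_def)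
  have "(F' has_integral (F b - F a)) {a..b}"
    by (rule fundamental_theorem_of_calculus_interior_strong[OF assms(1,2) _ assms(3)])
      (use F' in \<open>auto simp: has_real_derivative_iff_has_vector_derivative\<close>)
  moreover have "F' t \<le> v t" for t using F'[of t] by (cases "t \<in> {a<..<b} - S") (auto simp: F'_def)
  ultimately show ?thesis
    using has_integral_le[OF _ integrable_integral[OF assms(4)]] by blast
qed

lemma constant_if_deriv_0:
  fixes F :: "real \<Rightarrow> 'a::banach"
  assumes "finite S" "a \<le> b" "continuous_on {a..b} F"
    and "\<And>t. t \<in> {a<..<b} - S \<Longrightarrow> (F has_vector_derivative 0) (at t)"
  shows "F b = F a"
proof -
  have "((\<lambda>_. 0) has_integral (F b - F a)) {a..b}"
    by (rule fundamental_theorem_of_calculus_interior_strong[OF assms(1,2) _ assms(3)]) (use assms(4) in auto)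
  then show ?thesis
    using has_integral_unique[OF _ has_integral_0] by fastforce
qed

text \<open>The regularized radius uses X = m + \<delta>^2 in place of \<open>m\<close>. Each factor
  on the left only decreases when \<open>m\<close> is replaced by \<open>X\<close> in it, so the
  radial part of the gradient leaves room for the angular part b^2 m / (1 + m).\<close>

lemma slope_bound:
  fixes b :: real
  assumes "0 < m" "m \<le> X" "(b\<^sup>2 - 1) * m \<le> 1"
  shows "max 0 (1 - (b\<^sup>2 - 1) * X) / ((1 + X)\<^sup>2 * X) * (m * (1 + m)) \<le> (1 - (b\<^sup>2 - 1) * m) / (1 + m)"
proof -
  have b: "b\<^sup>2 \<ge> 0" by simp
  have "(1 - (b\<^sup>2 - 1) * m) * (1 + X) - (1 - (b\<^sup>2 - 1) * X) * (1 + m) = b\<^sup>2 * (X - m)"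
    by (simp add: algebra_simps)
  moreover have "b\<^sup>2 * (X - m) \<ge> 0" "(1 - (b\<^sup>2 - 1) * m) * (1 + X) \<ge> 0" using assms by auto
  ultimately have "max 0 (1 - (b\<^sup>2 - 1) * X) * (1 + m) \<le> (1 - (b\<^sup>2 - 1) * m) * (1 + X)"
    by (auto simp: max_def)
  then have 1: "max 0 (1 - (b\<^sup>2 - 1) * X) / (1 + X) \<le> (1 - (b\<^sup>2 - 1) * m) / (1 + m)"
    using assms by (simp add: divide_simps)
  have 2: "(1 + m) / (1 + X) \<le> 1" "m / X \<le> 1" using assms by auto
  have "max 0 (1 - (b\<^sup>2 - 1) * X) / ((1 + X)\<^sup>2 * X) * (m * (1 + m))
     = max 0 (1 - (b\<^sup>2 - 1) * X) / (1 + X) * (((1 + m) / (1 + X)) * (m / X))"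
    by (simp add: power2_eq_square mult_ac)
  also have "\<dots> \<le> max 0 (1 - (b\<^sup>2 - 1) * X) / (1 + X) * (1 * 1)"
    using 2 assms by (intro mult_left_mono mult_mono) auto
  finally show ?thesis using 1 by simp
qed

text \<open>Cauchy-Schwarz for the pairs (A, b / (1 + m)) and (m', (1 + m) \<theta>'): the squared
  norm of the first is at most 1 / (m (1 + m)), that of the second is v^2 m (1 + m).\<close>

lemma calibration_pointwise:
  assumes "0 \<le> m" "(b\<^sup>2 - 1) * m \<le> 1" "\<delta> > 0" "e\<^sup>2 = 1" "0 \<le> v"
    and sp: "m'\<^sup>2 + ((1 + m) * \<theta>')\<^sup>2 = v\<^sup>2 * (m * (1 + m))"
  shows "e * (slope b (sqrt (m + \<delta>\<^sup>2)) * (m' / (2 * sqrt (m + \<delta>\<^sup>2)))) + b * \<theta>' \<le> v"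
proof (cases "m = 0")
  case True
  then show ?thesis using sp assms by (simp add: add_nonneg_eq_0_iff)
next
  case False
  define X where "X = m + \<delta>\<^sup>2"
  define A where "A = e * slope b (sqrt X) / (2 * sqrt X)"
  have X: "X > 0" "m \<le> X" and m: "m > 0" using False assms by (auto simp: X_def add_nonneg_pos)
  have "A\<^sup>2 = max 0 (1 - (b\<^sup>2 - 1) * X) / ((1 + X)\<^sup>2 * X)"
    using X assms(4) by (simp add: A_def slope_def power_divide power_mult_distrib)
  then have A: "A\<^sup>2 * (m * (1 + m)) \<le> (1 - (b\<^sup>2 - 1) * m) / (1 + m)"
    using slope_bound[OF m X(2) assms(2)] by simp
  have B: "(b / (1 + m))\<^sup>2 * (m * (1 + m)) = b\<^sup>2 * m / (1 + m)"
    using m by (simp add: power_divide power2_eq_square)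
  have C: "(A\<^sup>2 + (b / (1 + m))\<^sup>2) * (m * (1 + m)) \<le> 1"
  proof -
    have "(A\<^sup>2 + (b / (1 + m))\<^sup>2) * (m * (1 + m)) \<le> (1 - (b\<^sup>2 - 1) * m) / (1 + m) + b\<^sup>2 * m / (1 + m)"
      using A B by (simp add: distrib_right)
    also have "\<dots> = 1" using m by (simp add: add_divide_distrib[symmetric]) (simp add: algebra_simps)
    finally show ?thesis .
  qed
  have "(A * m' + b * \<theta>')\<^sup>2 = (A * m' + b / (1 + m) * ((1 + m) * \<theta>'))\<^sup>2" using m by simp
  also have "\<dots> \<le> (A\<^sup>2 + (b / (1 + m))\<^sup>2) * (m'\<^sup>2 + ((1 + m) * \<theta>')\<^sup>2)"
  proof -
    have "(p * x + q * y)\<^sup>2 \<le> (p\<^sup>2 + q\<^sup>2) * (x\<^sup>2 + y\<^sup>2)" for p q x y :: real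
    proof -
      have "(p\<^sup>2 + q\<^sup>2) * (x\<^sup>2 + y\<^sup>2) - (p * x + q * y)\<^sup>2 = (p * y - q * x)\<^sup>2"
        by (simp add: algebra_simps power2_eq_square)
      then show ?thesis by (metis diff_ge_0_iff_ge zero_le_power2)
    qed
    then show ?thesis .
  qed
  also have "\<dots> = v\<^sup>2 * ((A\<^sup>2 + (b / (1 + m))\<^sup>2) * (m * (1 + m)))" unfolding sp by simp
  also have "\<dots> \<le> v\<^sup>2 * 1" by (intro mult_left_mono C) auto
  finally have "A * m' + b * \<theta>' \<le> v" using assms(5) by (auto intro: power2_le_imp_le)
  then show ?thesis by (simp add: A_def X_def mult_ac)
qed

text \<open>\<open>W b (sqrt m)\<close> has a conical singularity at \<open>m = 0\<close>, hence the detour through \<open>sqrt (m + \<delta>\<^sup>2)\<close>.\<close>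

lemma calibration:
  assumes P: "profile S a c m \<theta> v" and ac: "a \<le> c" and e: "e\<^sup>2 = 1"
    and k: "\<And>t. t \<in> {a..c} \<Longrightarrow> (b\<^sup>2 - 1) * m t \<le> 1"
  shows "e * (W b (sqrt (m c)) - W b (sqrt (m a))) + b * (\<theta> c - \<theta> a) \<le> integral {a..c} v"
proof -
  have P': "finite S" "continuous_on {a..c} m" "continuous_on {a..c} \<theta>" "v integrable_on {a..c}"
      "\<And>t. t \<in> {a..c} \<Longrightarrow> 0 \<le> m t"
    using P unfolding profile_def by blast+
  define F where "F \<delta> t = e * W b (sqrt (m t + \<delta>\<^sup>2)) + b * \<theta> t" for \<delta> t
  have le: "F \<delta> c - F \<delta> a \<le> integral {a..c} v" if \<delta>: "\<delta> > 0" for \<delta>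
  proof (rule increment_le_integral[of S])
    show "continuous_on {a..c} (F \<delta>)" unfolding F_def
      using P' by (intro continuous_intros continuous_on_W[of "{0..}"]) auto
    fix t assume t: "t \<in> {a<..<c} - S"
    obtain m' \<theta>' where D: "(m has_real_derivative m') (at t)" "(\<theta> has_real_derivative \<theta>') (at t)"
      and sp: "m'\<^sup>2 + ((1 + m t) * \<theta>')\<^sup>2 = (v t)\<^sup>2 * (m t * (1 + m t))" and "0 \<le> v t"
      by (rule profile_deriv[OF P t])
    then have m: "m t \<ge> 0" "v t \<ge> 0" "(b\<^sup>2 - 1) * m t \<le> 1" using P' t k by auto
    have X: "m t + \<delta>\<^sup>2 > 0" using m \<delta> by (simp add: add_nonneg_pos)
    have "((\<lambda>t. sqrt (m t + \<delta>\<^sup>2)) has_real_derivative m' / (2 * sqrt (m t + \<delta>\<^sup>2))) (at t)"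
      using DERIV_chain2[OF DERIV_real_sqrt[OF X] DERIV_add[OF D(1) DERIV_const[of "\<delta>\<^sup>2"]]]
      by (simp add: field_simps)
    then have "((\<lambda>t. W b (sqrt (m t + \<delta>\<^sup>2))) has_real_derivative
       slope b (sqrt (m t + \<delta>\<^sup>2)) * (m' / (2 * sqrt (m t + \<delta>\<^sup>2)))) (at t)"
      by (rule DERIV_chain2[OF DERIV_W, rotated]) (use X in simp)
    then have "(F \<delta> has_real_derivative 
       e * (slope b (sqrt (m t + \<delta>\<^sup>2)) * (m' / (2 * sqrt (m t + \<delta>\<^sup>2)))) + b * \<theta>') (at t)"
      unfolding F_def by (intro DERIV_add DERIV_cmult D)
    with calibration_pointwise[OF m(1) m(3) \<delta> e m(2) sp]
    show "\<exists>D. (F \<delta> has_real_derivative D) (at t) \<and> D \<le> v t" by blast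
  qed (use P' ac in auto)
  have lim: "((\<lambda>\<delta>. F \<delta> t) \<longlongrightarrow> F 0 t) (at_right 0)" if "t \<in> {a..c}" for t
  proof -
    have "continuous_on UNIV (\<lambda>\<delta>. F \<delta> t)" unfolding F_def
      using P' that by (intro continuous_intros continuous_on_W[of "{0..}"]) auto
    then have "isCont (\<lambda>\<delta>. F \<delta> t) 0" by (simp add: continuous_on_eq_continuous_at)
    then show ?thesis by (simp add: isCont_def filterlim_at_split)
  qed
  have "((\<lambda>\<delta>. F \<delta> c - F \<delta> a) \<longlongrightarrow> F 0 c - F 0 a) (at_right 0)"
    using ac by (intro tendsto_diff lim) auto
  then have "F 0 c - F 0 a \<le> integral {a..c} v"
    by (rule tendsto_upperbound) (auto simp: eventually_at_filter le)
  then show ?thesis by (simp add: F_def algebra_simps)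
qed

section \<open>Equality in the calibration inequality\<close>

lemma profileD:
  assumes "profile S a b m \<theta> v"
  shows "finite S" "continuous_on {a..b} m" "continuous_on {a..b} \<theta>" "v integrable_on {a..b}"
    and "\<And>t. t \<in> {a..b} \<Longrightarrow> 0 \<le> m t"
  using assms unfolding profile_def by blast+

text \<open>Carrying the state at time \<open>t\<close> forward to time \<open>b\<close> by the
  explicit flow gives quantities \<open>P\<close> and \<open>Q\<close> with vanishing derivative.
  Comparing their values at both ends yields the formulas.\<close>

lemma cs_sn_ode:
  assumes S: "finite S" and ab: "a \<le> b" and cont: "continuous_on {a..b} s" "continuous_on {a..b} c"
    and D: "\<And>t. t \<in> {a<..<b} - S \<Longrightarrow> (s has_real_derivative c t / 2) (at t)"
      "\<And>t. t \<in> {a<..<b} - S \<Longrightarrow> (c has_real_derivative - k * s t / 2) (at t)"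
  shows "s b = s a * cs k (b - a) + c a * sn k (b - a)"
    and "c b = c a * cs k (b - a) - k * s a * sn k (b - a)"
proof -
  define P where "P t = s t * cs k (b - t) + c t * sn k (b - t)" for t
  define Q where "Q t = c t * cs k (b - t) - k * s t * sn k (b - t)" for t
  have r: "((\<lambda>t. b - t) has_real_derivative -1) (at t)" for t
    by (auto intro!: derivative_eq_intros)
  note d = DERIV_chain2[OF DERIV_cs r] DERIV_chain2[OF DERIV_sn r]
  have "P b = P a"
  proof (rule constant_if_deriv_0[OF S ab])
    show "continuous_on {a..b} P" unfolding P_def by (intro continuous_intros cont)
    fix t assume t: "t \<in> {a<..<b} - S"
    show "(P has_vector_derivative 0) (at t)"
      unfolding P_def has_real_derivative_iff_has_vector_derivative[symmetric]
      by (rule DERIV_cong[OF DERIV_add[OF DERIV_mult[OF D(1)[OF t] d(1)] DERIV_mult[OF D(2)[OF t] d(2)]]])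
        (simp add: algebra_simps)
  qed
  then show "s b = s a * cs k (b - a) + c a * sn k (b - a)" by (simp add: P_def)
  have "Q b = Q a"
  proof (rule constant_if_deriv_0[OF S ab])
    show "continuous_on {a..b} Q" unfolding Q_def by (intro continuous_intros cont)
    fix t assume t: "t \<in> {a<..<b} - S"
    show "(Q has_vector_derivative 0) (at t)"
      unfolding Q_def has_real_derivative_iff_has_vector_derivative[symmetric]
      by (rule DERIV_cong[OF DERIV_diff[OF DERIV_mult[OF D(2)[OF t] d(1)]
              DERIV_mult[OF DERIV_cmult[OF D(1)[OF t]] d(2)]]])
        (simp add: algebra_simps)
  qed
  then show "c b = c a * cs k (b - a) - k * s a * sn k (b - a)" by (simp add: Q_def)
qed

text \<open>Unit-speed arcs that are calibrated at every moment. They follow the gradient of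
  \<open>W b s + b \<theta>\<close>, so their shape can be integrated explicitly.\<close>

definition tight where
  "tight S a c m \<theta> b \<longleftrightarrow> profile S a c m \<theta> (\<lambda>_. 1) \<and> a \<le> c \<and> (\<forall>t\<in>{a..c}. (b\<^sup>2 - 1) * m t \<le> 1) \<and>
     (\<forall>t\<in>{a..c}. W b (sqrt (m t)) - W b (sqrt (m a)) + b * (\<theta> t - \<theta> a) = t - a)"

text \<open>The calibration inequality holds on [a, t] and on [t, c] separately, and a loss on one
  piece cannot be recovered on the other. Equality over the whole interval therefore passes to every
  initial piece.\<close>

lemma tightI:
  assumes P: "profile S a c m \<theta> (\<lambda>_. 1)" and ac: "a \<le> c"
    and k: "\<And>t. t \<in> {a..c} \<Longrightarrow> (b\<^sup>2 - 1) * m t \<le> 1"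
    and eq: "W b (sqrt (m c)) - W b (sqrt (m a)) + b * (\<theta> c - \<theta> a) \<ge> c - a"
  shows "tight S a c m \<theta> b"
proof -
  have "W b (sqrt (m t)) - W b (sqrt (m a)) + b * (\<theta> t - \<theta> a) = t - a" if t: "t \<in> {a..c}" for t
  proof -
    have "1 * (W b (sqrt (m t)) - W b (sqrt (m a))) + b * (\<theta> t - \<theta> a) \<le> integral {a..t} (\<lambda>_. 1)"
      by (rule calibration[OF profile_subinterval[OF P]]) (use t k in auto)
    moreover have "1 * (W b (sqrt (m c)) - W b (sqrt (m t))) + b * (\<theta> c - \<theta> t) \<le> integral {t..c} (\<lambda>_. 1)"
      by (rule calibration[OF profile_subinterval[OF P]]) (use t k in auto)
    ultimately show ?thesis using eq t by (simp add: algebra_simps)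
  qed
  then show ?thesis using assms by (simp add: tight_def)
qed

lemma tight_increment:
  assumes "tight S a c m \<theta> b" "a \<le> x" "x \<le> y" "y \<le> c"
  shows "W b (sqrt (m y)) - W b (sqrt (m x)) + b * (\<theta> y - \<theta> x) = y - x"
proof -
  have "W b (sqrt (m t)) - W b (sqrt (m a)) + b * (\<theta> t - \<theta> a) = t - a" if "t \<in> {a..c}" for t
    using assms(1) that unfolding tight_def by blast
  from this[of x] this[of y] show ?thesis using assms by (simp add: algebra_simps)
qed

text \<open>At unit speed |\<theta>'| is at most tanh (r / 2), so the hypothesis bounds b \<theta>'
  by \<open>M\<close>. With M = 1 this says that \<open>b \<theta>\<close> alone cannot outrun time
  inside the rim, with M = 0 that no holonomy is gained while resting at the base point.\<close>

lemma angle_increment: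
  assumes P: "profile S a c m \<theta> (\<lambda>_. 1)" and ac: "a \<le> c" and M: "M \<ge> 0"
    and k: "\<And>t. t \<in> {a..c} \<Longrightarrow> b\<^sup>2 * m t \<le> M\<^sup>2 * (1 + m t)"
  shows "b * (\<theta> c - \<theta> a) \<le> M * (c - a)"
proof -
  have "b * \<theta> c - b * \<theta> a \<le> integral {a..c} (\<lambda>_. M)"
  proof (rule increment_le_integral[of S])
    show "continuous_on {a..c} (\<lambda>t. b * \<theta> t)" by (intro continuous_intros profileD[OF P])
    fix t assume t: "t \<in> {a<..<c} - S"
    obtain m' \<theta>' where D: "(m has_real_derivative m') (at t)" "(\<theta> has_real_derivative \<theta>') (at t)"
      and sp: "m'\<^sup>2 + ((1 + m t) * \<theta>')\<^sup>2 = 1\<^sup>2 * (m t * (1 + m t))" by (rule profile_deriv[OF P t])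
    have m: "m t \<ge> 0" using t by (intro profileD(5)[OF P]) auto
    have "((1 + m t) * \<theta>')\<^sup>2 \<le> m t * (1 + m t)" using sp zero_le_power2[of m'] unfolding power_one mult_1 by linarith
    then have "(1 + m t) * ((1 + m t) * \<theta>'\<^sup>2) \<le> (1 + m t) * m t"
      by (simp add: power_mult_distrib power2_eq_square mult_ac)
    then have "(1 + m t) * \<theta>'\<^sup>2 \<le> m t" using m by simp
    then have "(b * \<theta>')\<^sup>2 * (1 + m t) \<le> b\<^sup>2 * m t"
      using mult_left_mono[of "(1 + m t) * \<theta>'\<^sup>2" "m t" "b\<^sup>2"] by (simp add: power_mult_distrib mult_ac)
    also have "\<dots> \<le> M\<^sup>2 * (1 + m t)" using t by (intro k) auto
    finally have "(b * \<theta>')\<^sup>2 \<le> M\<^sup>2" using m by simp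
    then have "b * \<theta>' \<le> M" using M by (rule power2_le_imp_le)
    with DERIV_cmult[OF D(2), of b] show "\<exists>D. ((\<lambda>t. b * \<theta> t) has_real_derivative D) (at t) \<and> D \<le> M"
      by blast
  qed (use profileD(1)[OF P] ac in auto)
  then show ?thesis using ac by (simp add: algebra_simps)
qed

text \<open>Since b \<theta> grows at most as fast as time, equality forces \<open>W\<close> to be
  nondecreasing, and \<open>W b\<close> is strictly increasing in the radius up to the rim.\<close>

lemma tight_mono:
  assumes T: "tight S a c m \<theta> b" and xy: "a \<le> x" "x \<le> y" "y \<le> c"
  shows "m x \<le> m y"
proof -
  have P: "profile S a c m \<theta> (\<lambda>_. 1)" and k: "\<And>t. t \<in> {a..c} \<Longrightarrow> (b\<^sup>2 - 1) * m t \<le> 1"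
    using T unfolding tight_def by blast+
  have "b * (\<theta> y - \<theta> x) \<le> 1 * (y - x)"
  proof (rule angle_increment[OF profile_subinterval[OF P]])
    fix t assume "t \<in> {x..y}"
    then show "b\<^sup>2 * m t \<le> 1\<^sup>2 * (1 + m t)" using k[of t] xy by (simp add: algebra_simps)
  qed (use xy in auto)
  then have "W b (sqrt (m x)) \<le> W b (sqrt (m y))"
    using tight_increment[OF T xy] by simp
  moreover have "m x \<ge> 0" "m y \<ge> 0" using xy by (auto intro!: profileD(5)[OF P])
  ultimately show ?thesis using W_le_iff[of "sqrt (m x)" "sqrt (m y)" b] k[of x] k[of y] xy by simp
qed

text \<open>If the radius vanished at \<open>x\<close>, monotonicity would keep it zero on [a, x],
  where neither \<open>W\<close> nor the holonomy could account for the elapsed time.\<close>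

lemma tight_pos:
  assumes T: "tight S a c m \<theta> b" and x: "a < x" "x \<le> c"
  shows "m x > 0"
proof (rule ccontr)
  assume neg: "\<not> m x > 0"
  have P: "profile S a c m \<theta> (\<lambda>_. 1)" and k: "\<And>t. t \<in> {a..c} \<Longrightarrow> (b\<^sup>2 - 1) * m t \<le> 1"
    using T unfolding tight_def by blast+
  have z: "m t = 0" if "t \<in> {a..x}" for t
    using tight_mono[OF T, of t x] neg profileD(5)[OF P, of t] that x by auto
  have "b * (\<theta> x - \<theta> a) \<le> 0 * (x - a)"
    by (rule angle_increment[OF profile_subinterval[OF P]]) (use x z in auto)
  then show False using tight_increment[OF T, of a x] z x by simp
qed

text \<open>This is the equality case of Cauchy-Schwarz: the velocity has to be the gradient of the
  calibration, which gives both derivatives explicitly.\<close>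

lemma tight_deriv:
  assumes T: "tight S a c m \<theta> b" and t: "t \<in> {a<..<c} - S"
  shows "(m has_real_derivative sqrt (m t) * sqrt (1 - (b\<^sup>2 - 1) * m t)) (at t)"
    and "(\<theta> has_real_derivative b * m t / (1 + m t)) (at t)"
proof -
  have P: "profile S a c m \<theta> (\<lambda>_. 1)" and k: "\<And>t. t \<in> {a..c} \<Longrightarrow> (b\<^sup>2 - 1) * m t \<le> 1"
    using T unfolding tight_def by blast+
  obtain m' \<theta>' where D: "(m has_real_derivative m') (at t)" "(\<theta> has_real_derivative \<theta>') (at t)"
    and sp: "m'\<^sup>2 + ((1 + m t) * \<theta>')\<^sup>2 = 1\<^sup>2 * (m t * (1 + m t))" by (rule profile_deriv[OF P t])
  have m: "m t > 0" using t by (intro tight_pos[OF T]) auto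
  have kt: "(b\<^sup>2 - 1) * m t \<le> 1" using t by (intro k) auto
  define s where "s = sqrt (m t)"
  have s: "s > 0" "s\<^sup>2 = m t" using m by (auto simp: s_def)
  define A where "A = slope b s / (2 * s)"
  have "((\<lambda>t. sqrt (m t)) has_real_derivative m' / (2 * s)) (at t)"
    using DERIV_chain2[OF DERIV_real_sqrt[OF m] D(1)] by (simp add: field_simps s_def)
  then have "((\<lambda>t. W b (sqrt (m t))) has_real_derivative slope b s * (m' / (2 * s))) (at t)"
    using s unfolding s_def by (intro DERIV_chain2[OF DERIV_W]) auto
  then have 1: "((\<lambda>t. W b (sqrt (m t)) + b * \<theta> t) has_real_derivative slope b s * (m' / (2 * s)) + b * \<theta>') (at t)"
    by (intro DERIV_add DERIV_cmult D(2))
  have 2: "((\<lambda>t. W b (sqrt (m t)) + b * \<theta> t) has_real_derivative 1) (at t)"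
  proof (rule has_field_derivative_transform_within_open[of "\<lambda>t. t + (W b (sqrt (m a)) + b * \<theta> a - a)" _ _ "{a<..<c}"])
    fix u assume "u \<in> {a<..<c}"
    then show "u + (W b (sqrt (m a)) + b * \<theta> a - a) = W b (sqrt (m u)) + b * \<theta> u"
      using tight_increment[OF T, of a u] by (simp add: algebra_simps)
  qed (use t in \<open>auto intro!: derivative_eq_intros\<close>)
  have "slope b s * (m' / (2 * s)) + b * \<theta>' = 1" using DERIV_unique[OF 1 2] .
  then have dot: "A * m' + b / (1 + m t) * ((1 + m t) * \<theta>') = 1" using m by (simp add: A_def)
  have Aeq: "A = sqrt (1 - (b\<^sup>2 - 1) * m t) / ((1 + m t) * s)"
    using kt m s by (simp add: A_def slope_def max_def)
  have "A\<^sup>2 * (m t * (1 + m t)) = (1 - (b\<^sup>2 - 1) * m t) / (1 + m t)"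
    using m kt by (simp add: Aeq power_divide power_mult_distrib s) (simp add: power2_eq_square)
  moreover have "(b / (1 + m t))\<^sup>2 * (m t * (1 + m t)) = b\<^sup>2 * m t / (1 + m t)"
    using m by (simp add: power_divide power2_eq_square)
  moreover have "(1 - (b\<^sup>2 - 1) * m t) / (1 + m t) + b\<^sup>2 * m t / (1 + m t) = 1"
    using m by (simp add: add_divide_distrib[symmetric]) (simp add: algebra_simps)
  ultimately have C: "(A\<^sup>2 + (b / (1 + m t))\<^sup>2) * (m t * (1 + m t)) = 1"
    by (simp add: distrib_right)
  define g where "g = m t * (1 + m t)"
  define q where "q = b / (1 + m t)"
  define y where "y = (1 + m t) * \<theta>'"
  \<comment> \<open>The squared distance between velocity and gradient. The velocity has squared
    norm \<open>g\<close>, its product with (A, q) is 1, and (A^2 + q^2) g = 1, so the sum is g - 2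
    g + g.\<close>
  have "(m' - g * A)\<^sup>2 + (y - g * q)\<^sup>2 = (m'\<^sup>2 + y\<^sup>2) - 2 * g * (A * m' + q * y) + g * ((A\<^sup>2 + q\<^sup>2) * g)"
    by (simp add: power2_eq_square algebra_simps)
  also have "\<dots> = 0" using sp dot C by (simp add: g_def q_def y_def)
  finally have "m' = g * A" "y = g * q" by (auto simp: sum_power2_eq_zero_iff)
  then have "m' = s * sqrt (1 - (b\<^sup>2 - 1) * m t)" "\<theta>' = b * m t / (1 + m t)"
    using m s by (auto simp: g_def Aeq q_def y_def) (auto simp: field_simps power2_eq_square)
  with D show "(m has_real_derivative sqrt (m t) * sqrt (1 - (b\<^sup>2 - 1) * m t)) (at t)"
    and "(\<theta> has_real_derivative b * m t / (1 + m t)) (at t)" by (auto simp: s_def)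
qed

text \<open>For s = sqrt m and c = sqrt (1 - k m) the derivative of \<open>m\<close> turns into the
  linear system s' = c / 2, c' = - k s / 2. Strictness in \<open>lt\<close> keeps \<open>c\<close>
  positive and differentiable; on the rim the equation for \<open>m\<close> also admits a constant
  solution.\<close>

lemma tight_ode:
  assumes T: "tight S a c m \<theta> b" and xy: "a \<le> x" "x \<le> y" "y \<le> c"
    and lt: "\<And>t. x < t \<Longrightarrow> t < y \<Longrightarrow> (b\<^sup>2 - 1) * m t < 1"
  defines "k \<equiv> b\<^sup>2 - 1"
  shows "sqrt (m y) = sqrt (m x) * cs k (y - x) + sqrt (1 - k * m x) * sn k (y - x)"
    and "sqrt (1 - k * m y) = sqrt (1 - k * m x) * cs k (y - x) - k * sqrt (m x) * sn k (y - x)"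
proof -
  have P: "profile S a c m \<theta> (\<lambda>_. 1)" using T unfolding tight_def by blast+
  have sub: "{x..y} \<subseteq> {a..c}" using xy by auto
  have D: "((\<lambda>t. sqrt (m t)) has_real_derivative sqrt (1 - k * m t) / 2) (at t)"
     "((\<lambda>t. sqrt (1 - k * m t)) has_real_derivative - k * sqrt (m t) / 2) (at t)" if t: "t \<in> {x<..<y} - S" for t
  proof -
    have m: "m t > 0" using t xy by (intro tight_pos[OF T]) auto
    have m2: "1 - k * m t > 0" using lt t by (auto simp: k_def)
    have "(m has_real_derivative sqrt (m t) * sqrt (1 - k * m t)) (at t)"
      using tight_deriv(1)[OF T, of t] t xy by (auto simp: k_def)
    note d = this DERIV_diff[OF DERIV_const[of 1] DERIV_cmult[OF this, of k]]
    show "((\<lambda>t. sqrt (m t)) has_real_derivative sqrt (1 - k * m t) / 2) (at t)"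
      by (rule DERIV_cong[OF DERIV_chain2[OF DERIV_real_sqrt[OF m] d(1)]]) (use m in \<open>simp add: field_simps\<close>)
    show "((\<lambda>t. sqrt (1 - k * m t)) has_real_derivative - k * sqrt (m t) / 2) (at t)"
      by (rule DERIV_cong[OF DERIV_chain2[OF DERIV_real_sqrt[OF m2] d(2)]]) (use m2 in \<open>simp add: field_simps\<close>)
  qed
  have cont: "continuous_on {x..y} (\<lambda>t. sqrt (m t))" "continuous_on {x..y} (\<lambda>t. sqrt (1 - k * m t))"
    by (intro continuous_intros continuous_on_subset[OF profileD(2)[OF P] sub])+
  note ode = cs_sn_ode[OF profileD(1)[OF P] xy(2) cont D]
  show "sqrt (m y) = sqrt (m x) * cs k (y - x) + sqrt (1 - k * m x) * sn k (y - x)"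
    and "sqrt (1 - k * m y) = sqrt (1 - k * m x) * cs k (y - x) - k * sqrt (m x) * sn k (y - x)"
    by (rule ode; assumption)+
qed

lemma first_hit:
  fixes m :: "real \<Rightarrow> real"
  assumes "continuous_on {a..c} m" "a \<le> c" "m c = M"
  obtains t where "t \<in> {a..c}" "m t = M" "\<And>x. a \<le> x \<Longrightarrow> x < t \<Longrightarrow> m x \<noteq> M"
proof -
  define X where "X = {t \<in> {a..c}. m t = M}"
  have "closed X" unfolding X_def
    using continuous_closed_preimage_constant[OF assms(1) closed_atLeastAtMost] by simp
  moreover have "bounded X" by (rule bounded_subset[of "{a..c}"]) (auto simp: X_def)
  ultimately have "compact X" by (simp add: compact_eq_bounded_closed)
  moreover have "X \<noteq> {}" using assms by (auto simp: X_def)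
  ultimately obtain t where t: "t \<in> X" "\<And>u. u \<in> X \<Longrightarrow> t \<le> u"
    using compact_attains_inf by metis
  show ?thesis
  proof (rule that[of t])
    fix x assume "a \<le> x" "x < t"
    then show "m x \<noteq> M" using t(2)[of x] t(1) by (auto simp: X_def)
  qed (use t in \<open>auto simp: X_def\<close>)
qed

section \<open>Holonomy of arcs of constant curvature\<close>

text \<open>The holonomy of a geodesic of curvature \<open>b\<close> and length \<open>t\<close>, up to the first return to the base point:
  because of the range of \<open>arccos\<close> the formula is wrong afterwards.\<close>

definition Theta :: "real \<Rightarrow> real \<Rightarrow> real" where
  "Theta b t = b * t - 2 * arccos (cs (b\<^sup>2 - 1) t / sqrt (1 + (sn (b\<^sup>2 - 1) t)\<^sup>2))"

lemma cs_square: "(cs (b\<^sup>2 - 1) t)\<^sup>2 = 1 + (sn (b\<^sup>2 - 1) t)\<^sup>2 - b\<^sup>2 * (sn (b\<^sup>2 - 1) t)\<^sup>2"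
  using cs_sn[of "b\<^sup>2 - 1" t] by (simp add: algebra_simps)

lemma cs_ratio_le: "\<bar>cs (b\<^sup>2 - 1) t / sqrt (1 + (sn (b\<^sup>2 - 1) t)\<^sup>2)\<bar> \<le> 1"
proof -
  have "(cs (b\<^sup>2 - 1) t)\<^sup>2 \<le> 1 + (sn (b\<^sup>2 - 1) t)\<^sup>2" by (simp add: cs_square)
  then have "\<bar>cs (b\<^sup>2 - 1) t\<bar> \<le> sqrt (1 + (sn (b\<^sup>2 - 1) t)\<^sup>2)"
    using real_sqrt_le_mono by fastforce
  then show ?thesis by (simp add: abs_divide)
qed

lemma Theta_0 [simp]: "Theta b 0 = 0"
  by (simp add: Theta_def)

lemma continuous_on_Theta: "continuous_on X (Theta b)"
proof -
  have "-1 \<le> cs (b\<^sup>2 - 1) t / sqrt (1 + (sn (b\<^sup>2 - 1) t)\<^sup>2) \<and>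
      cs (b\<^sup>2 - 1) t / sqrt (1 + (sn (b\<^sup>2 - 1) t)\<^sup>2) \<le> 1" for t
    using cs_ratio_le[of b t] unfolding abs_le_iff by linarith
  then have "continuous_on X (\<lambda>t. arccos (cs (b\<^sup>2 - 1) t / sqrt (1 + (sn (b\<^sup>2 - 1) t)\<^sup>2)))"
    by (intro continuous_on_arccos continuous_intros ballI) simp_all
  then show ?thesis unfolding Theta_def[abs_def]
    by (auto intro!: continuous_on_diff continuous_on_mult continuous_on_const continuous_on_id)
qed

text \<open>With curvature 0 the projection is a straight line through the base point, which sweeps
  no area.\<close>

lemma Theta_flat: "Theta 0 t = 0"
proof -
  have "(cs (0\<^sup>2 - 1) t)\<^sup>2 = 1 + (sn (0\<^sup>2 - 1) t)\<^sup>2" by (simp only: cs_square) simp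
  moreover have "cs (0\<^sup>2 - 1) t \<ge> 1" unfolding cs_def by (intro cosq_ge_1) auto
  ultimately have "cs (0\<^sup>2 - 1) t = sqrt (1 + (sn (0\<^sup>2 - 1) t)\<^sup>2)" by (simp add: real_sqrt_unique)
  then show ?thesis using one_plus_square_pos(1)[of "sn (0\<^sup>2 - 1) t"] by (simp add: Theta_def)
qed

text \<open>The arccos term has derivative b / (2 (1 + s^2)), and b - b / (1 + s^2) = b tanh^2 (r /
  2) is exactly the holonomy rate found in \<open>tight_deriv\<close>. Positivity of
  \<open>sn\<close> keeps the argument of arccos inside (-1, 1).\<close>

lemma DERIV_Theta:
  assumes b: "b > 0" and s: "sn (b\<^sup>2 - 1) t > 0"
  shows "(Theta b has_real_derivative b * (sn (b\<^sup>2 - 1) t)\<^sup>2 / (1 + (sn (b\<^sup>2 - 1) t)\<^sup>2)) (at t)"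
proof -
  define k where "k = b\<^sup>2 - 1"
  define S where "S = sn k t"
  define C where "C = cs k t"
  define R where "R = sqrt (1 + S\<^sup>2)"
  have R: "R > 0" "R\<^sup>2 = 1 + S\<^sup>2" by (auto simp: R_def)
  have S: "S > 0" using s by (simp add: S_def k_def)
  have C2: "C\<^sup>2 = R\<^sup>2 - b\<^sup>2 * S\<^sup>2" using cs_square[of b t] by (simp add: C_def S_def k_def R)
  define x where "x = C / R"
  have x2: "1 - x\<^sup>2 = (b * S / R)\<^sup>2"
    using R by (simp add: x_def power_divide C2 power_mult_distrib) (simp add: divide_simps)
  have sx: "sqrt (1 - x\<^sup>2) = b * S / R"
    unfolding x2 using b S R by simp
  have "(b * S / R)\<^sup>2 > 0" using b S R by simp
  then have "x\<^sup>2 < 1" using x2 by linarith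
  then have x: "-1 < x" "x < 1" by (auto simp: abs_square_less_1)
  have dS: "(sn k has_real_derivative C / 2) (at t)" and dC: "(cs k has_real_derivative - k * S / 2) (at t)"
    using DERIV_sn[of k t] DERIV_cs[of k t] by (auto simp: S_def C_def)
  have d1: "((\<lambda>t. 1 + (sn k t)\<^sup>2) has_real_derivative S * C) (at t)"
    by (rule DERIV_cong[OF DERIV_add[OF DERIV_const DERIV_power[OF dS, of 2]]]) (simp add: S_def)
  have d2: "((\<lambda>t. sqrt (1 + (sn k t)\<^sup>2)) has_real_derivative S * C / (2 * R)) (at t)"
    by (rule DERIV_cong[OF DERIV_chain2[OF DERIV_real_sqrt d1]]) (simp_all add: S_def R_def field_simps)
  have "((\<lambda>t. cs k t / sqrt (1 + (sn k t)\<^sup>2)) has_real_derivative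
      (- k * S / 2 * R - C * (S * C / (2 * R))) / (R * R)) (at t)"
    by (rule DERIV_cong[OF DERIV_divide[OF dC d2]]) (auto simp: R_def S_def C_def)
  moreover have "(- k * S / 2 * R - C * (S * C / (2 * R))) / (R * R) = - (b\<^sup>2 * S / (2 * R * R\<^sup>2))"
  proof -
    have "(- k * S / 2 * R - C * (S * C / (2 * R))) / (R * R) = - (S * (k * R\<^sup>2 + C\<^sup>2) / (2 * R * R\<^sup>2))"
      using R(1) by (simp add: field_simps power2_eq_square)
    moreover have "k * R\<^sup>2 + C\<^sup>2 = b\<^sup>2" unfolding C2 by (simp add: R k_def algebra_simps)
    ultimately show ?thesis by (simp add: mult.commute)
  qed
  ultimately have d3: "((\<lambda>t. cs k t / sqrt (1 + (sn k t)\<^sup>2)) has_real_derivative - (b\<^sup>2 * S / (2 * R * R\<^sup>2))) (at t)"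
    by simp
  have xe: "cs k t / sqrt (1 + (sn k t)\<^sup>2) = x" by (simp add: x_def C_def R_def S_def)
  have "((\<lambda>t. arccos (cs k t / sqrt (1 + (sn k t)\<^sup>2))) has_real_derivative
       inverse (- sqrt (1 - x\<^sup>2)) * - (b\<^sup>2 * S / (2 * R * R\<^sup>2))) (at t)"
    by (rule DERIV_chain2[OF _ d3]) (use DERIV_arccos[OF x] xe in simp)
  moreover have "inverse (- sqrt (1 - x\<^sup>2)) * - (b\<^sup>2 * S / (2 * R * R\<^sup>2)) = b / (2 * R\<^sup>2)"
    unfolding sx using b S R(1) by (simp add: field_simps power2_eq_square)
  ultimately have "((\<lambda>t. arccos (cs k t / sqrt (1 + (sn k t)\<^sup>2))) has_real_derivative b / (2 * R\<^sup>2)) (at t)"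
    by simp
  from DERIV_diff[OF DERIV_cmult[OF DERIV_ident, of b] DERIV_cmult[OF this, of 2]]
  have "(Theta b has_real_derivative b - b / R\<^sup>2) (at t)"
    by (simp add: Theta_def[abs_def] k_def)
  moreover have "b - b / R\<^sup>2 = b * S\<^sup>2 / (1 + S\<^sup>2)" unfolding R(2) by (simp add: field_simps)
  ultimately show ?thesis by (simp add: S_def k_def)
qed

lemma Theta_strict_mono:
  assumes b: "b > 0" and t: "0 \<le> s" "s < t" "(b\<^sup>2 - 1) * t\<^sup>2 \<le> 4 * pi\<^sup>2"
  shows "Theta b s < Theta b t"
proof (rule DERIV_pos_imp_increasing_open[OF t(2)])
  fix x assume x: "s < x" "x < t"
  have "(b\<^sup>2 - 1) * x\<^sup>2 < 4 * pi\<^sup>2"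
    by (rule scaled_square_less[OF _ x(2) t(3)]) (use t x in simp_all)
  then have s: "sn (b\<^sup>2 - 1) x > 0" using x t by (intro sn_pos) auto
  then have "b * (sn (b\<^sup>2 - 1) x)\<^sup>2 / (1 + (sn (b\<^sup>2 - 1) x)\<^sup>2) > 0"
    using b by (intro divide_pos_pos mult_pos_pos) auto
  with DERIV_Theta[OF b s] show "\<exists>y. (Theta b has_real_derivative y) (at x) \<and> 0 < y" by blast
qed (rule continuous_on_Theta)

lemma Theta_nonneg:
  assumes "b \<ge> 0" "0 \<le> t" "(b\<^sup>2 - 1) * t\<^sup>2 \<le> 4 * pi\<^sup>2" shows "Theta b t \<ge> 0"
  using Theta_strict_mono[of b 0 t] assms Theta_flat[of t] by (cases "b = 0"; cases "t = 0") auto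

lemma cs_pos: assumes "k * t\<^sup>2 < pi\<^sup>2" shows "cs k t > 0"
proof (cases "k * t\<^sup>2 \<le> 0")
  case True
  then show ?thesis using cosq_ge_1[of "k * t\<^sup>2 / 4"] by (simp add: cs_def)
next
  case False
  define y where "y = sqrt (k * t\<^sup>2 / 4)"
  have y: "y \<ge> 0" "k * t\<^sup>2 / 4 = y\<^sup>2" using False by (auto simp: y_def)
  have "y\<^sup>2 < (pi / 2)\<^sup>2" using assms y(2) by (simp add: power_divide)
  then have "y < pi / 2" by (rule power_less_imp_less_base) simp
  then show ?thesis using y cos_gt_zero_pi[of y] pi_gt_zero by (simp add: cs_def cosq_square)
qed

text \<open>The arc of curvature \<open>b\<close> follows the gradient as long as \<open>cs\<close>
  is nonnegative, so the calibration grows at unit rate. For b > 1 the limit pi^2 is where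
  \<open>cs\<close> vanishes, at the farthest point of the projected circle.\<close>

lemma W_along_ascent:
  assumes b: "b \<ge> 0" and t: "0 \<le> t" "(b\<^sup>2 - 1) * t\<^sup>2 \<le> pi\<^sup>2"
  shows "W b (sn (b\<^sup>2 - 1) t) + b * Theta b t = t"
proof -
  define k where "k = b\<^sup>2 - 1"
  define F where "F t = W b (sn k t) + b * Theta b t - t" for t
  have le: "k * x\<^sup>2 < pi\<^sup>2" if "0 \<le> x" "x < t" for x
    using scaled_square_less[OF that] t by (simp add: k_def)
  have pp: "pi\<^sup>2 < 4 * pi\<^sup>2" by simp
  have pos: "sn k x > 0" if "0 < x" "x \<le> t" for x
  proof (rule sn_pos)
    have "k * x\<^sup>2 \<le> pi\<^sup>2" using le[of x] t that by (cases "x = t") (auto simp: k_def)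
    then show "k * x\<^sup>2 < 4 * pi\<^sup>2" using pp by linarith
  qed (use that in simp)
  have "F t = F 0"
  proof (rule constant_if_deriv_0[where F=F and a=0 and b=t and S="{}"])
    have "sn k x \<ge> 0" if "x \<in> {0..t}" for x using pos[of x] that by (cases "x = 0") auto
    then show "continuous_on {0..t} F" unfolding F_def
      by (intro continuous_intros continuous_on_W[of "{0..}"] continuous_on_Theta) auto
    fix x assume "x \<in> {0<..<t} - {}"
    then have x: "0 < x" "x < t" by auto
    define S where "S = sn k x"
    have S: "S > 0" using pos x by (simp add: S_def)
    have c: "cs k x > 0" using le x by (intro cs_pos) auto
    have c2: "1 - k * S\<^sup>2 = (cs k x)\<^sup>2" using cs_sn[of k x] by (simp add: S_def algebra_simps)
    define N where "N = 1 + S\<^sup>2"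
    have N: "N \<noteq> 0" by (simp add: N_def)
    have sl: "slope b S = 2 * cs k x / (1 + S\<^sup>2)"
      unfolding slope_def k_def[symmetric] c2 using c by (simp add: max_def)
    have d1: "((\<lambda>x. W b (sn k x)) has_real_derivative slope b S * (cs k x / 2)) (at x)"
      using S unfolding S_def by (intro DERIV_chain2[OF DERIV_W DERIV_sn]) auto
    have d2: "(Theta b has_real_derivative b * S\<^sup>2 / (1 + S\<^sup>2)) (at x)"
    proof (cases "b = 0")
      case True
      then have "Theta b = (\<lambda>_. 0)" using Theta_flat by auto
      then show ?thesis using True by simp
    next
      case False
      then show ?thesis using DERIV_Theta[of b x] b S by (simp add: S_def k_def)
    qed
    have "slope b S * (cs k x / 2) + b * (b * S\<^sup>2 / (1 + S\<^sup>2)) = ((cs k x)\<^sup>2 + b\<^sup>2 * S\<^sup>2) / (1 + S\<^sup>2)"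
      unfolding sl N_def[symmetric] using N by (simp add: field_simps power2_eq_square)
    also have "\<dots> = 1" unfolding c2[symmetric] by (simp add: k_def algebra_simps)
    finally have "(F has_real_derivative 0) (at x)" unfolding F_def
      by (intro DERIV_cong[OF DERIV_diff[OF DERIV_add[OF d1 DERIV_cmult[OF d2]] DERIV_ident]]) simp
    then show "(F has_vector_derivative 0) (at x)"
      by (simp add: has_real_derivative_iff_has_vector_derivative)
  qed (use t in auto)
  then show ?thesis by (simp add: F_def k_def)
qed

text \<open>Past the farthest point s = 1 / \<sigma>, reached at time pi / \<sigma>,
  \<open>cs\<close> is negative: the radius decreases, and now the sheet with \<open>- W\<close>
  grows at unit rate. The constant 2 W(1 / \<sigma>) makes the two sheets agree at the turn.\<close>

lemma W_along_descent:
  assumes sg: "\<sigma> > 0" "b\<^sup>2 = 1 + \<sigma>\<^sup>2" "b > 0" and t: "pi / \<sigma> \<le> t" "t \<le> 2 * pi / \<sigma>"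
  shows "2 * W b (1 / \<sigma>) - W b (sn (\<sigma>\<^sup>2) t) + b * Theta b t = t"
proof -
  define k where "k = \<sigma>\<^sup>2"
  have k: "b\<^sup>2 - 1 = k" using sg by (simp add: k_def)
  define h where "h = pi / \<sigma>"
  have h: "h > 0" "\<sigma> * h = pi" using sg by (auto simp: h_def)
  have "k * h\<^sup>2 = pi\<^sup>2" using h by (simp add: k_def power_mult_distrib[symmetric])
  moreover have snh: "sn k h = 1 / \<sigma>" using sg h by (simp add: k_def sn_elliptic)
  ultimately have half: "W b (1 / \<sigma>) + b * Theta b h = h"
    using W_along_ascent[of b h, unfolded k] h sg by simp
  define F where "F t = - W b (sn k t) + b * Theta b t - t" for t
  have pos: "sn k x > 0" if "h \<le> x" "x < t" for x
  proof -
    have pos: "\<sigma> * x / 2 > 0" using that h sg by simp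
    have "\<sigma> * x < \<sigma> * t" using that sg by simp
    moreover have "\<sigma> * t \<le> 2 * pi" using t sg by (simp add: field_simps)
    ultimately have "\<sigma> * x / 2 < pi" by linarith
    then show ?thesis using pos sg sin_gt_zero[of "\<sigma> * x / 2"] by (simp add: k_def sn_elliptic)
  qed
  have t0: "sn k t \<ge> 0"
  proof -
    have "\<sigma> * t / 2 \<ge> 0" "\<sigma> * t / 2 \<le> pi" using t h sg by (auto simp: field_simps h_def[symmetric]) 
    then show ?thesis using sg sin_ge_zero[of "\<sigma> * t / 2"] by (simp add: k_def sn_elliptic)
  qed
  have "F t = F h"
  proof (rule constant_if_deriv_0[where F=F and a=h and b=t and S="{}"])
    have "sn k x \<ge> 0" if "x \<in> {h..t}" for x using pos[of x] t0 that by (cases "x = t") auto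
    then show "continuous_on {h..t} F" unfolding F_def
      by (intro continuous_intros continuous_on_W[of "{0..}"] continuous_on_Theta) auto
    fix x assume "x \<in> {h<..<t} - {}"
    then have x: "h < x" "x < t" by auto
    define S where "S = sn k x"
    have S: "S > 0" using pos x by (simp add: S_def)
    have c: "cs k x \<le> 0"
    proof -
      have "\<sigma> * h < \<sigma> * x" using x sg by simp
      then have 1: "pi / 2 < \<sigma> * x / 2" using h by simp
      have "\<sigma> * x < \<sigma> * t" using x sg by simp
      also have "\<sigma> * t \<le> 2 * pi" using t sg by (simp add: field_simps)
      finally have "\<sigma> * x / 2 < pi" by simp
      then have "- cos (\<sigma> * x / 2) \<ge> 0" using 1 cos_ge_zero[of "pi - \<sigma> * x / 2"] by simp
      then show ?thesis using sg by (simp add: k_def cs_elliptic)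
    qed
    have c2: "1 - k * S\<^sup>2 = (cs k x)\<^sup>2" using cs_sn[of k x] by (simp add: S_def algebra_simps)
    define N where "N = 1 + S\<^sup>2"
    have N: "N \<noteq> 0" by (simp add: N_def)
    have sl: "slope b S = - 2 * cs k x / (1 + S\<^sup>2)"
      unfolding slope_def k c2 using c by (simp add: max_def)
    have d1: "((\<lambda>x. W b (sn k x)) has_real_derivative slope b S * (cs k x / 2)) (at x)"
      using S unfolding S_def by (intro DERIV_chain2[OF DERIV_W DERIV_sn]) auto
    have d2: "(Theta b has_real_derivative b * S\<^sup>2 / (1 + S\<^sup>2)) (at x)"
      using DERIV_Theta[of b x, unfolded k] sg S by (simp add: S_def)
    have "- (slope b S * (cs k x / 2)) + b * (b * S\<^sup>2 / (1 + S\<^sup>2)) = ((cs k x)\<^sup>2 + b\<^sup>2 * S\<^sup>2) / (1 + S\<^sup>2)"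
      unfolding sl N_def[symmetric] using N by (simp add: field_simps power2_eq_square)
    also have "\<dots> = 1" unfolding c2[symmetric] by (simp add: k[symmetric] algebra_simps)
    finally have "(F has_real_derivative 0) (at x)" unfolding F_def
      by (intro DERIV_cong[OF DERIV_diff[OF DERIV_add[OF DERIV_minus[OF d1] DERIV_cmult[OF d2]] DERIV_ident]]) simp
    then show "(F has_vector_derivative 0) (at x)"
      by (simp add: has_real_derivative_iff_has_vector_derivative)
  qed (use t in \<open>auto simp: h_def\<close>)
  then show ?thesis using half snh by (simp add: F_def k_def)
qed

section \<open>Comparison of arcs with the same chord\<close>

text \<open>The arcs of constant curvature joining two points at distance \<open>2 arsinh s\<close>, parametrized by
  half the phase \<open>y\<close>: curvature, length and holonomy.\<close>

definition arc_b :: "real \<Rightarrow> real \<Rightarrow> real" where "arc_b s y = sqrt (1 + (sin y / s)\<^sup>2)"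
definition arc_t :: "real \<Rightarrow> real \<Rightarrow> real" where "arc_t s y = 2 * s * y / sin y"
definition arc_h :: "real \<Rightarrow> real \<Rightarrow> real" where
  "arc_h s y = arc_b s y * arc_t s y - 2 * arccos (cos y / sqrt (1 + s\<^sup>2))"

lemma arc_b_square: "(arc_b s y)\<^sup>2 = 1 + (sin y / s)\<^sup>2"
  by (simp add: arc_b_def)

lemma arc_b_ge_1: "arc_b s y \<ge> 1"
  by (simp add: arc_b_def)

lemma arc_eqs:
  assumes s: "s > 0" and y: "0 < y" "y < pi"
  shows "arc_t s y > 0" "((arc_b s y)\<^sup>2 - 1) * (arc_t s y)\<^sup>2 = 4 * y\<^sup>2"
    "sn ((arc_b s y)\<^sup>2 - 1) (arc_t s y) = s" "Theta (arc_b s y) (arc_t s y) = arc_h s y"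
proof -
  have sy: "sin y > 0" using y by (simp add: sin_gt_zero)
  define \<sigma> where "\<sigma> = sin y / s"
  have sg: "\<sigma> > 0" using sy s by (simp add: \<sigma>_def)
  have k: "(arc_b s y)\<^sup>2 - 1 = \<sigma>\<^sup>2" by (simp add: arc_b_square \<sigma>_def)
  have st: "\<sigma> * arc_t s y = 2 * y" using s sy by (simp add: \<sigma>_def arc_t_def)
  show "arc_t s y > 0" using sy s y by (simp add: arc_t_def)
  show "((arc_b s y)\<^sup>2 - 1) * (arc_t s y)\<^sup>2 = 4 * y\<^sup>2"
    unfolding k power_mult_distrib[symmetric] st by simp
  show sn: "sn ((arc_b s y)\<^sup>2 - 1) (arc_t s y) = s"
    unfolding k sn_elliptic[OF sg] st using s sy by (simp add: \<sigma>_def)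
  show "Theta (arc_b s y) (arc_t s y) = arc_h s y"
    unfolding Theta_def arc_h_def sn unfolding k cs_elliptic[OF less_imp_le[OF sg]] st by simp
qed

text \<open>Along the family of arcs with common ends, dt / dh = b: the curvature is the Lagrange
  multiplier that measures length per unit of holonomy. Both quantities grow with the phase because
  y cos y < sin y.\<close>

lemma DERIV_arc:
  assumes s: "s > 0" and y: "0 < y" "y < pi"
  obtains T' where "T' > 0" "(arc_t s has_real_derivative T') (at y)"
    "(arc_h s has_real_derivative T' / arc_b s y) (at y)"
proof -
  have sy: "sin y > 0" using y by (simp add: sin_gt_zero)
  define T' where "T' = 2 * s * (sin y - y * cos y) / (sin y)\<^sup>2"
  have T'0: "T' > 0" using mult_cos_less_sin[of y] s sy y by (simp add: T'_def)
  have dT: "(arc_t s has_real_derivative T') (at y)"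
    unfolding arc_t_def[abs_def] T'_def
    by (rule DERIV_cong[OF DERIV_divide[OF DERIV_cmult[OF DERIV_ident] DERIV_sin]])
       (use sy in \<open>auto simp: field_simps power2_eq_square\<close>)
  define B where "B = arc_b s y"
  define R where "R = sqrt (1 + s\<^sup>2)"
  have B: "B > 0" "B\<^sup>2 = 1 + (sin y)\<^sup>2 / s\<^sup>2"
    using arc_b_ge_1[of s y] arc_b_square[of s y] by (auto simp: B_def power_divide)
  have sB: "s\<^sup>2 * B\<^sup>2 = s\<^sup>2 + (sin y)\<^sup>2" using s by (simp add: B field_simps)
  have R: "R > 0" "R\<^sup>2 = 1 + s\<^sup>2" by (auto simp: R_def)
  have d0: "((\<lambda>y. sin y / s) has_real_derivative cos y / s) (at y)"
    by (rule DERIV_cdivide[OF DERIV_sin])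
  have d1: "((\<lambda>y. 1 + (sin y / s)\<^sup>2) has_real_derivative 2 * sin y * cos y / s\<^sup>2) (at y)"
    by (rule DERIV_cong[OF DERIV_add[OF DERIV_const DERIV_power[OF d0, of 2]]])
      (simp add: power2_eq_square)
  have dB: "(arc_b s has_real_derivative sin y * cos y / (s\<^sup>2 * B)) (at y)"
    unfolding arc_b_def[abs_def]
  proof (rule DERIV_cong[OF DERIV_chain2[OF DERIV_real_sqrt d1]])
    have "sqrt (1 + (sin y / s)\<^sup>2) = B" by (simp add: B_def arc_b_def)
    then show "inverse (sqrt (1 + (sin y / s)\<^sup>2)) / 2 * (2 * sin y * cos y / s\<^sup>2) = sin y * cos y / (s\<^sup>2 * B)"
      by (simp only:) (use B(1) s in \<open>simp add: field_simps\<close>)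
  qed (rule one_plus_square_pos)
  define x where "x = cos y / R"
  have x2: "1 - x\<^sup>2 = (s * B / R)\<^sup>2"
  proof -
    have "(1 - x\<^sup>2) * R\<^sup>2 = R\<^sup>2 - (cos y)\<^sup>2" using R(1) by (simp add: x_def power_divide field_simps)
    also have "\<dots> = (s * B)\<^sup>2" by (simp add: power_mult_distrib sB R sin_squared_eq)
    finally show ?thesis using R(1) by (simp add: power_divide field_simps)
  qed
  have sx: "sqrt (1 - x\<^sup>2) = s * B / R" unfolding x2 using s B R by simp
  have "(s * B / R)\<^sup>2 > 0" using s B R by simp
  then have "x\<^sup>2 < 1" using x2 by linarith
  then have x: "-1 < x" "x < 1" by (auto simp: abs_square_less_1)
  have "((\<lambda>y. cos y / R) has_real_derivative - sin y / R) (at y)"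
    by (rule DERIV_cdivide[OF DERIV_cos])
  then have "((\<lambda>y. arccos (cos y / R)) has_real_derivative inverse (- sqrt (1 - x\<^sup>2)) * (- sin y / R)) (at y)"
    by (rule DERIV_chain2[rotated]) (use DERIV_arccos[OF x] in \<open>simp add: x_def\<close>)
  moreover have "inverse (- sqrt (1 - x\<^sup>2)) * (- sin y / R) = sin y / (s * B)"
    unfolding sx using R s B(1) by (simp add: field_simps)
  ultimately have dA: "((\<lambda>y. arccos (cos y / R)) has_real_derivative sin y / (s * B)) (at y)" by simp
  have "(arc_h s has_real_derivative sin y * cos y / (s\<^sup>2 * B) * arc_t s y + T' * B - 2 * (sin y / (s * B))) (at y)"
    unfolding arc_h_def[abs_def] R_def[symmetric]
    by (rule DERIV_cong[OF DERIV_diff[OF DERIV_mult[OF dB dT] DERIV_cmult[OF dA, of 2]]]) (simp add: B_def)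
  moreover have "sin y * cos y / (s\<^sup>2 * B) * arc_t s y + T' * B - 2 * (sin y / (s * B)) = T' / B"
  proof -
    have "T' * (sin y)\<^sup>2 = 2 * s * (sin y - y * cos y)" using sy by (simp add: T'_def)
    then have 1: "T' * (s\<^sup>2 * B\<^sup>2 - s\<^sup>2) = 2 * s * (sin y - y * cos y)" by (simp add: sB)
    have "sin y * cos y / (s\<^sup>2 * B) * arc_t s y - 2 * (sin y / (s * B)) = - (2 * s * (sin y - y * cos y)) / (s\<^sup>2 * B)"
      using s B(1) sy by (simp add: arc_t_def field_simps power2_eq_square)
    also have "\<dots> = - (T' * B) + T' / B"
      unfolding 1[symmetric] using s B(1) by (simp add: field_simps power2_eq_square)
    finally show ?thesis by simp
  qed
  ultimately show ?thesis using that[OF T'0 dT] by (simp add: B_def)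
qed

text \<open>On the increasing branch \<open>sin z\<close> exceeds \<open>sin y\<close>, on the
  decreasing branch it exceeds \<open>sin x\<close>; the disjunction allows for a start on either
  branch.\<close>

lemma sin_less_sin_of_obtuse:
  assumes "0 < y" "y < x" "x < pi" "y \<ge> pi / 2 \<or> sin y > sin x" "pi / 2 \<le> x"
    and z: "y < z" "z < x"
  shows "sin z > sin x"
proof (cases "z \<ge> pi / 2")
  case True
  have "cos (x - pi / 2) < cos (z - pi / 2)" by (rule cos_monotone_0_pi) (use assms True in auto)
  then show ?thesis by (simp add: cos_diff)
next
  case False
  then have "sin y < sin z" using assms sin_monotone_2pi[of y z] by auto
  then show ?thesis using assms False by auto
qed

text \<open>With \<open>b\<close> frozen at the curvature of the arc \<open>x\<close>, the function
  t - b h has derivative T' (1 - b / arc_b s z). As curvature grows with sin z, this is positive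
  between \<open>y\<close> and \<open>x\<close> if y < x and negative if y > x, so the value at
  \<open>x\<close> is strictly larger.\<close>

lemma arc_compare:
  assumes s: "s > 0" and y: "0 < y" "y < pi" and x: "pi / 2 \<le> x" "x < pi"
    and yx: "y \<ge> pi / 2 \<or> sin y > sin x" "y \<noteq> x"
  defines "b \<equiv> arc_b s x"
  shows "arc_t s y - b * arc_h s y < arc_t s x - b * arc_h s x"
proof -
  define h where "h z = arc_t s z - b * arc_h s z" for z
  have b: "b > 0" using arc_b_ge_1[of s x] by (simp add: b_def)
  have dh: "\<exists>T'>0. (h has_real_derivative T' * (1 - b / arc_b s z)) (at z)" if z: "0 < z" "z < pi" for z
  proof -
    obtain T' where T': "T' > 0" "(arc_t s has_real_derivative T') (at z)"
      "(arc_h s has_real_derivative T' / arc_b s z) (at z)" using DERIV_arc[OF s z] .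
    have "(h has_real_derivative T' * (1 - b / arc_b s z)) (at z)"
      unfolding h_def by (rule DERIV_cong[OF DERIV_diff[OF T'(2) DERIV_cmult[OF T'(3)]]])
         (simp add: algebra_simps)
    then show ?thesis using T' by blast
  qed
  have cont: "continuous_on {u..v} h" if "0 < u" "v < pi" for u v
  proof (rule continuous_at_imp_continuous_on, rule ballI)
    fix z assume "z \<in> {u..v}"
    then show "isCont h z" using dh[of z] that by (auto intro: DERIV_isCont)
  qed
  have b_mono: "arc_b s u < arc_b s v" if "sin u < sin v" "0 \<le> sin u" for u v
  proof -
    have "(sin u / s)\<^sup>2 < (sin v / s)\<^sup>2"
      using that s by (intro power_strict_mono) (auto simp: divide_strict_right_mono)
    then show ?thesis by (simp add: arc_b_def)
  qed
  have "h y < h x"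
  proof (cases "y < x")
    case True
    show ?thesis
    proof (rule DERIV_pos_imp_increasing_open[OF True])
      fix z assume z: "y < z" "z < x"
      have zp: "0 < z" "z < pi" using z y x by auto
      have "sin x < sin z" by (rule sin_less_sin_of_obtuse[OF y(1) True x(2) yx(1) x(1) z])
      moreover have "0 \<le> sin x" using x pi_gt_zero by (intro sin_ge_zero) linarith+
      ultimately have lt: "b < arc_b s z" using b_mono by (simp add: b_def)
      obtain T' where "T' > 0" "(h has_real_derivative T' * (1 - b / arc_b s z)) (at z)"
        using dh[OF zp] by blast
      moreover have "1 - b / arc_b s z > 0" using lt b by simp
      ultimately show "\<exists>D. (h has_real_derivative D) (at z) \<and> D > 0" by (metis mult_pos_pos)
    qed (use cont y x in auto)
  next
    case False
    then have xy: "x < y" using yx by simp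
    show ?thesis
    proof (rule DERIV_neg_imp_decreasing_open[OF xy])
      fix z assume z: "x < z" "z < y"
      have zp: "0 < z" "z < pi" using z y x pi_gt_zero by auto
      have "cos (z - pi / 2) < cos (x - pi / 2)" by (rule cos_monotone_0_pi) (use x z zp in auto)
      then have "sin z < sin x" by (simp add: cos_diff)
      moreover have "0 \<le> sin z" using zp by (intro sin_ge_zero) auto
      ultimately have lt: "arc_b s z < b" using b_mono by (simp add: b_def)
      have bz: "arc_b s z > 0" using arc_b_ge_1[of s z] by simp
      obtain T' where "T' > 0" "(h has_real_derivative T' * (1 - b / arc_b s z)) (at z)"
        using dh[OF zp] by blast
      moreover have "1 - b / arc_b s z < 0" using lt bz by (simp add: less_divide_eq)
      ultimately show "\<exists>D. (h has_real_derivative D) (at z) \<and> D < 0" by (metis mult_pos_neg)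
    qed (use cont y x pi_gt_zero in auto)
  qed
  then show ?thesis by (simp add: h_def)
qed

text \<open>For b > 1 the third condition says that the projected circle is traversed at most once.
  Curvature is taken nonnegative; the orientation is carried by a separate factor \<open>e\<close>
  with \<open>e\<^sup>2 = 1\<close>.\<close>

definition admissible :: "real \<Rightarrow> real \<Rightarrow> bool" where
  "admissible b t \<longleftrightarrow> 0 \<le> b \<and> 0 < t \<and> (b\<^sup>2 - 1) * t\<^sup>2 \<le> 4 * pi\<^sup>2 \<and> Theta b t \<le> pi"

text \<open>The right-hand side is the two-sheet bound with its rim at m = M, where \<open>c\<close>
  is coth (r / 2). On the returning arc of curvature \<open>c\<close> over the same chord this bound
  is exact; so the target is compared with that arc, at the exchange rate \<open>c\<close> between
  holonomy and length. The assumption \<open>far\<close> describes what one sheet with parameter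
  \<open>b\<close> cannot handle.\<close>

lemma two_sheet_compare:
  assumes A: "admissible b t" and M: "M > 0" "(sn (b\<^sup>2 - 1) t)\<^sup>2 \<le> M"
    and far: "(b\<^sup>2 - 1) * t\<^sup>2 > pi\<^sup>2 \<or> (b\<^sup>2 - 1) * M > 1"
  defines "s \<equiv> sn (b\<^sup>2 - 1) t" and "c \<equiv> sqrt (1 + 1 / M)"
  shows "t \<le> 2 * W c (sqrt M) - W c s + c * Theta b t"
    and "t = 2 * W c (sqrt M) - W c s + c * Theta b t \<Longrightarrow> b = c \<and> (b\<^sup>2 - 1) * t\<^sup>2 \<ge> pi\<^sup>2"
proof -
  have bt: "0 \<le> b" "0 < t" "(b\<^sup>2 - 1) * t\<^sup>2 \<le> 4 * pi\<^sup>2" using A by (auto simp: admissible_def)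
  define \<sigma> where "\<sigma> = 1 / sqrt M"
  have sg: "\<sigma> > 0" "1 / \<sigma> = sqrt M" "\<sigma>\<^sup>2 = 1 / M" using M by (auto simp: \<sigma>_def power_divide)
  have c: "c > 0" "c\<^sup>2 = 1 + \<sigma>\<^sup>2" using M by (auto simp: c_def sg add_pos_pos)
  have k: "b\<^sup>2 - 1 > 0"
  proof (rule ccontr)
    assume "\<not> b\<^sup>2 - 1 > 0"
    then have "(b\<^sup>2 - 1) * t\<^sup>2 \<le> 0" "(b\<^sup>2 - 1) * M \<le> 0" using M by (auto simp: mult_nonpos_nonneg)
    moreover have "pi\<^sup>2 > 0" by simp
    ultimately show False using far by linarith
  qed
  define \<sigma>0 where "\<sigma>0 = sqrt (b\<^sup>2 - 1)"
  have s0: "\<sigma>0 > 0" "\<sigma>0\<^sup>2 = b\<^sup>2 - 1" using k by (auto simp: \<sigma>0_def)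
  define y where "y = \<sigma>0 * t / 2"
  have y4: "4 * y\<^sup>2 = (b\<^sup>2 - 1) * t\<^sup>2" by (simp add: y_def power_mult_distrib power_divide s0)
  have y: "y > 0" "y \<le> pi"
  proof -
    show "y > 0" using s0 bt by (simp add: y_def)
    have "y\<^sup>2 \<le> pi\<^sup>2" using bt(3) y4 by simp
    then show "y \<le> pi" by (rule power2_le_imp_le) simp
  qed
  have far': "y > pi / 2 \<or> \<sigma>0 > \<sigma>"
  proof (cases "(b\<^sup>2 - 1) * t\<^sup>2 > pi\<^sup>2")
    case True
    then have "(pi / 2)\<^sup>2 < y\<^sup>2" using y4 by (simp add: power_divide)
    then have "pi / 2 < y" using y by (intro power_less_imp_less_base[of "pi/2" 2 y]) auto
    then show ?thesis ..
  next
    case False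
    then have "\<sigma>0\<^sup>2 > \<sigma>\<^sup>2" using far M by (simp add: s0 sg field_simps)
    then have "\<sigma> < \<sigma>0" using s0 by (intro power_less_imp_less_base[of \<sigma> 2 \<sigma>0]) auto
    then show ?thesis ..
  qed
  have pi2: "(b\<^sup>2 - 1) * t\<^sup>2 \<ge> pi\<^sup>2" if "y \<ge> pi / 2"
  proof -
    have "(pi / 2)\<^sup>2 \<le> y\<^sup>2" using that by (intro power_mono) auto
    then show ?thesis using y4 by (simp add: power_divide)
  qed
  have ss: "s = sin y / \<sigma>0" unfolding s_def s0(2)[symmetric] sn_elliptic[OF s0(1)] y_def ..
  have "t \<le> 2 * W c (sqrt M) - W c s + c * Theta b t \<and>
    (t = 2 * W c (sqrt M) - W c s + c * Theta b t \<longrightarrow> b = c \<and> (b\<^sup>2 - 1) * t\<^sup>2 \<ge> pi\<^sup>2)"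
  \<comment> \<open>A full circle has chord 0, where the family of arcs over a chord degenerates.
    The claim then comes down to 1 + \<sigma>0 \<sigma> \<le> b c.\<close>
  proof (cases "y = pi")
    case True
    then have s: "s = 0" by (simp add: ss)
    have "cs (b\<^sup>2 - 1) t = -1"
      using True cs_elliptic[of \<sigma>0 t] s0 by (simp add: y_def)
    then have Th: "Theta b t = b * t - 2 * pi" using s by (simp add: Theta_def s_def)
    have tt: "t = 2 * pi / \<sigma>0" using True s0 by (simp add: y_def field_simps)
    have sn0: "sn (\<sigma>\<^sup>2) (2 * pi / \<sigma>) = 0"
      unfolding sn_elliptic[OF sg(1)] using sg(1) by simp
    have loop: "2 * W c (sqrt M) + c * Theta c (2 * pi / \<sigma>) = 2 * pi / \<sigma>"
      using W_along_descent[OF sg(1) c(2,1), of "2 * pi / \<sigma>", unfolded sn0 sg(2)] sg(1)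
      by (simp add: divide_right_mono)
    have "c\<^sup>2 - 1 = \<sigma>\<^sup>2" using c by simp
    then have "Theta c (2 * pi / \<sigma>) = c * (2 * pi / \<sigma>) - 2 * pi"
      using sg(1) sn0 cs_elliptic[of \<sigma> "2 * pi / \<sigma>"] by (simp add: Theta_def)
    with loop have W2: "2 * W c (sqrt M) = 2 * pi * (c - \<sigma>)"
    proof -
      have "2 * W c (sqrt M) = 2 * pi / \<sigma> - c * (c * (2 * pi / \<sigma>) - 2 * pi)"
        using loop unfolding \<open>Theta c _ = _\<close> by linarith
      also have "\<dots> = 2 * pi / \<sigma> - c\<^sup>2 * (2 * pi / \<sigma>) + 2 * pi * c"
        by (simp only: right_diff_distrib power2_eq_square mult_ac)
      also have "2 * pi / \<sigma> - c\<^sup>2 * (2 * pi / \<sigma>) = - 2 * pi * \<sigma>"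
        unfolding c using sg(1) by (simp add: field_simps power2_eq_square)
      finally show ?thesis by (simp add: algebra_simps)
    qed
    have E: "2 * W c (sqrt M) - W c s + c * Theta b t - t = t * (b * c - \<sigma>0 * \<sigma> - 1)"
    proof -
      have "\<sigma>0 * t = 2 * pi" using s0(1) by (simp add: tt)
      then have "\<sigma> * (\<sigma>0 * t) = \<sigma> * (2 * pi)" by simp
      then have "t * (\<sigma>0 * \<sigma>) = 2 * pi * \<sigma>" by (simp only: mult_ac)
      moreover have "2 * W c (sqrt M) - W c s + c * Theta b t - t = t * (b * c - 1) - 2 * pi * \<sigma>"
        unfolding W2 s Th W_0 by (simp add: algebra_simps)
      ultimately show ?thesis by (simp only: right_diff_distrib)
    qed
    \<comment> \<open>Lagrange's identity for the vectors (1, \<sigma>0) and (1, \<sigma>), whose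
      norms are \<open>b\<close> and \<open>c\<close>; the explicit defect also settles the equality
      case.\<close>
    have Q: "(b * c)\<^sup>2 - (1 + \<sigma>0 * \<sigma>)\<^sup>2 = (\<sigma>0 - \<sigma>)\<^sup>2"
    proof -
      have "b\<^sup>2 = 1 + \<sigma>0\<^sup>2" using s0 by simp
      then show ?thesis unfolding power_mult_distrib c(2) by (simp add: power2_eq_square algebra_simps)
    qed
    have "(1 + \<sigma>0 * \<sigma>)\<^sup>2 \<le> (b * c)\<^sup>2" using Q zero_le_power2[of "\<sigma>0 - \<sigma>"] by linarith
    then have le: "1 + \<sigma>0 * \<sigma> \<le> b * c" by (rule power2_le_imp_le) (use bt c in simp)
    define e where "e = b * c - \<sigma>0 * \<sigma> - 1"
    have "t * e \<ge> 0" using le bt by (simp add: e_def)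
    moreover have "b = c" if "t * e = 0"
    proof -
      have "e = 0" using that bt by simp
      then have "b * c = 1 + \<sigma>0 * \<sigma>" by (simp add: e_def)
      then have "\<sigma>0 = \<sigma>" using Q by simp
      then have "b\<^sup>2 = c\<^sup>2" using s0 c by simp
      then show ?thesis using bt(1) c(1) by (auto dest: power2_eq_imp_eq)
    qed
    moreover have "(b\<^sup>2 - 1) * t\<^sup>2 \<ge> pi\<^sup>2" using True by (intro pi2) simp
    moreover have "2 * W c (sqrt M) - W c s + c * Theta b t - t = t * e" unfolding E e_def ..
    ultimately show ?thesis by fastforce
  next
    case False
    then have y': "y < pi" using y by simp
    have s: "s > 0" using s0 sin_gt_zero[OF y(1) y'] by (simp add: ss)
    have sM: "s \<le> sqrt M" using M s real_le_rsqrt[of s M] by (simp add: s_def)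
    have ss1: "\<sigma> * s \<le> 1" "0 < \<sigma> * s" using sM M s by (auto simp: \<sigma>_def)
    \<comment> \<open>The obtuse half-phase at which the arc of curvature \<open>c\<close>, on its
      way back from the rim, is again at radius \<open>s\<close>.\<close>
    define x where "x = pi - arcsin (\<sigma> * s)"
    have ax: "0 < arcsin (\<sigma> * s)" using arcsin_less_mono[of 0 "\<sigma> * s"] ss1 by simp
    have x: "pi / 2 \<le> x" "x < pi" using arcsin_bounded[of "\<sigma> * s"] ss1 ax by (auto simp: x_def)
    have sx: "sin x = \<sigma> * s" using ss1 by (simp add: x_def)
    have bb: "b = arc_b s y" "t = arc_t s y"
    proof -
      have 1: "sin y / s = \<sigma>0" using s s0 unfolding ss by (auto simp: field_simps)
      show "b = arc_b s y" unfolding arc_b_def 1 s0 using bt by simp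
      show "t = arc_t s y" using 1 s s0 sin_gt_zero[OF y(1) y'] by (simp add: arc_t_def y_def field_simps)
    qed
    have cc: "c = arc_b s x" using s c unfolding arc_b_def sx by (simp add: real_sqrt_unique)
    have x0: "0 < x" using x pi_gt_zero by linarith
    have k2: "(arc_b s x)\<^sup>2 - 1 = \<sigma>\<^sup>2" unfolding cc[symmetric] using c by simp
    note ax = arc_eqs[OF s x0 x(2), unfolded k2]
    have tx: "arc_t s x = 2 * x / \<sigma>" using s sg by (simp add: arc_t_def sx)
    \<comment> \<open>The two-sheet function is exact on that arc, so the values of \<open>W\<close>
      can be traded for its length.\<close>
    have D: "2 * W c (sqrt M) - W c s + c * arc_h s x = arc_t s x"
      using W_along_descent[OF sg(1) c(2,1), of "arc_t s x"] ax sg x cc unfolding tx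
      by (simp add: divide_right_mono)
    have Th: "Theta b t = arc_h s y" unfolding bb by (rule arc_eqs(4)[OF s y(1) y'])
    show ?thesis
    proof (cases "x = y")
      case True
      have "2 * W c (sqrt M) - W c s + c * Theta b t = t" using D Th bb(2) True by simp
      moreover have "b = c" using bb(1) cc True by simp
      moreover have "(b\<^sup>2 - 1) * t\<^sup>2 \<ge> pi\<^sup>2" using x(1) True by (intro pi2) simp
      ultimately show ?thesis by simp
    next
      case False
      have "y \<ge> pi / 2 \<or> sin y > sin x"
      proof (cases "y \<ge> pi / 2")
        case False
        then have "\<sigma>0 > \<sigma>" using far' by auto
        then have "\<sigma>0 * s > \<sigma> * s" using s by simp
        moreover have "sin y = \<sigma>0 * s" using s0 by (simp add: ss)
        ultimately show ?thesis by (simp add: sx)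
      qed simp
      from arc_compare[OF s y(1) y' x this] False
      have "arc_t s y - c * arc_h s y < arc_t s x - c * arc_h s x" by (simp add: cc)
      then have "t < 2 * W c (sqrt M) - W c s + c * Theta b t"
        unfolding Th bb(2)[symmetric] using D by simp
      then show ?thesis by simp
    qed
  qed
  then show "t \<le> 2 * W c (sqrt M) - W c s + c * Theta b t"
    and "t = 2 * W c (sqrt M) - W c s + c * Theta b t \<Longrightarrow> b = c \<and> (b\<^sup>2 - 1) * t\<^sup>2 \<ge> pi\<^sup>2"
    by blast+
qed

section \<open>The isoperimetric inequality\<close>

lemma admissible_sn_nonneg: "admissible b t \<Longrightarrow> 0 \<le> x \<Longrightarrow> x \<le> t \<Longrightarrow> sn (b\<^sup>2 - 1) x \<ge> 0"
  and admissible_sn_pos: "admissible b t \<Longrightarrow> 0 < x \<Longrightarrow> x < t \<Longrightarrow> sn (b\<^sup>2 - 1) x > 0"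
proof -
  assume A: "admissible b t"
  have k: "(b\<^sup>2 - 1) * t\<^sup>2 \<le> 4 * pi\<^sup>2" using A by (simp add: admissible_def)
  have p: "(0::real) < 4 * pi\<^sup>2" by simp
  show pos: "sn (b\<^sup>2 - 1) x > 0" if "0 < x" "x < t" for x
    using scaled_square_less[OF _ that(2) k p] that by (intro sn_pos) auto
  show "sn (b\<^sup>2 - 1) x \<ge> 0" if "0 \<le> x" "x \<le> t" for x
    using pos[of x] sn_nonneg[of t, OF _ k] that by (cases "x = 0"; cases "x = t") auto
qed

text \<open>A path that stays at the base point gains no holonomy, whereas the prescribed end has
  positive radius (if b = 0) or positive holonomy (if b > 0).\<close>

lemma profile_max:
  assumes P: "profile S 0 T m \<theta> v" and T: "T \<ge> 0" and \<theta>0: "\<theta> 0 = 0"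
    and A: "admissible b t" and mT: "m T = (sn (b\<^sup>2 - 1) t)\<^sup>2" and th: "Theta b t \<le> \<theta> T"
  obtains t1 where "t1 \<in> {0..T}" "\<And>x. x \<in> {0..T} \<Longrightarrow> m x \<le> m t1" "m t1 > 0"
proof -
  obtain t1 where t1: "t1 \<in> {0..T}" "\<And>x. x \<in> {0..T} \<Longrightarrow> m x \<le> m t1"
    using continuous_attains_sup[OF compact_Icc _ profileD(2)[OF P]] T by auto
  have "m t1 > 0"
  proof (rule ccontr)
    assume "\<not> m t1 > 0"
    then have z: "m x = 0" if "x \<in> {0..T}" for x
      using t1(2)[OF that] profileD(5)[OF P that] by simp
    have "\<theta> T = \<theta> 0"
    proof (rule constant_if_deriv_0[OF profileD(1)[OF P] T profileD(3)[OF P]])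
      fix x assume x: "x \<in> {0<..<T} - S"
      obtain m' \<theta>' where D: "(\<theta> has_real_derivative \<theta>') (at x)"
        and sp: "m'\<^sup>2 + ((1 + m x) * \<theta>')\<^sup>2 = (v x)\<^sup>2 * (m x * (1 + m x))" by (rule profile_deriv[OF P x])
      have "m x = 0" using x by (intro z) auto
      then have "\<theta>' = 0" using sp by (simp add: sum_power2_eq_zero_iff)
      then show "(\<theta> has_vector_derivative 0) (at x)"
        using D by (simp add: has_real_derivative_iff_has_vector_derivative)
    qed
    then have th0: "Theta b t \<le> 0" using th \<theta>0 by simp
    have sn0: "sn (b\<^sup>2 - 1) t = 0" using mT z[of T] T by simp
    have bt: "0 \<le> b" "0 < t" "(b\<^sup>2 - 1) * t\<^sup>2 \<le> 4 * pi\<^sup>2" using A by (auto simp: admissible_def)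
    show False
    proof (cases "b = 0")
      case True
      have "(b\<^sup>2 - 1) * t\<^sup>2 \<le> 0" using True by simp
      also have "0 < 4 * pi\<^sup>2" by simp
      finally show False using sn_pos[of t "b\<^sup>2 - 1"] sn0 bt by simp
    next
      case False
      then show False using Theta_strict_mono[of b 0 t] bt th0 by simp
    qed
  qed
  then show ?thesis using that t1 by blast
qed

lemma scaled_le_one:
  fixes k :: real
  assumes "k * M \<le> 1" "0 \<le> x" "x \<le> M" shows "k * x \<le> 1"
proof (cases "k \<le> 0")
  case True
  then have "k * x \<le> 0" using assms by (simp add: mult_nonpos_nonneg)
  then show ?thesis by simp
next
  case False
  then have "k * x \<le> k * M" using assms by (intro mult_left_mono) auto
  then show ?thesis using assms by simp
qed

text \<open>With this \<open>c\<close> the rim passes exactly through the farthest point, so the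
  whole path lies in the domain of the calibration. The sheet e = 1 bounds the part before
  \<open>t1\<close>, the sheet e = -1 the part after it.\<close>

lemma two_sheet_bound:
  assumes P: "profile S 0 T m \<theta> v" and t1: "t1 \<in> {0..T}" "\<And>x. x \<in> {0..T} \<Longrightarrow> m x \<le> m t1" "m t1 > 0"
  defines "c \<equiv> sqrt (1 + 1 / m t1)"
  shows "x \<in> {0..T} \<Longrightarrow> (c\<^sup>2 - 1) * m x \<le> 1"
    and "W c (sqrt (m t1)) - W c (sqrt (m 0)) + c * (\<theta> t1 - \<theta> 0) \<le> integral {0..t1} v"
    and "W c (sqrt (m t1)) - W c (sqrt (m T)) + c * (\<theta> T - \<theta> t1) \<le> integral {t1..T} v"
proof -
  have k: "c\<^sup>2 - 1 = 1 / m t1" using t1(3) by (simp add: c_def add_pos_pos less_imp_le)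
  show le: "(c\<^sup>2 - 1) * m x \<le> 1" if "x \<in> {0..T}" for x
    using t1(2)[OF that] t1(3) by (simp add: k)
  show "W c (sqrt (m t1)) - W c (sqrt (m 0)) + c * (\<theta> t1 - \<theta> 0) \<le> integral {0..t1} v"
    using calibration[OF profile_subinterval[OF P, of 0 t1], of 1 c] le t1 by simp
  have "- 1 * (W c (sqrt (m T)) - W c (sqrt (m t1))) + c * (\<theta> T - \<theta> t1) \<le> integral {t1..T} v"
    by (rule calibration[OF profile_subinterval[OF P, of t1 T]]) (use le t1 in auto)
  then show "W c (sqrt (m t1)) - W c (sqrt (m T)) + c * (\<theta> T - \<theta> t1) \<le> integral {t1..T} v"
    by simp
qed

theorem profile_lower_bound:
  assumes P: "profile S 0 T m \<theta> v" and T: "T \<ge> 0" and m0: "m 0 = 0" and \<theta>0: "\<theta> 0 = 0"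
    and A: "admissible b t" and mT: "m T = (sn (b\<^sup>2 - 1) t)\<^sup>2" and th: "Theta b t \<le> \<theta> T"
  shows "t \<le> integral {0..T} v"
proof -
  have bt: "0 \<le> b" "0 < t" "(b\<^sup>2 - 1) * t\<^sup>2 \<le> 4 * pi\<^sup>2" using A by (auto simp: admissible_def)
  have sT: "sqrt (m T) = sn (b\<^sup>2 - 1) t" using mT admissible_sn_nonneg[OF A, of t] bt by simp
  obtain t1 where t1: "t1 \<in> {0..T}" "\<And>x. x \<in> {0..T} \<Longrightarrow> m x \<le> m t1" "m t1 > 0"
    using profile_max[OF P T \<theta>0 A mT th] by blast
  show ?thesis
  \<comment> \<open>If the target ends on its ascending half and the competitor stays within the rim
    for \<open>b\<close>, the target's own sheet applies. Otherwise the competitor's rim and both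
    sheets are used.\<close>
  proof (cases "(b\<^sup>2 - 1) * t\<^sup>2 > pi\<^sup>2 \<or> (b\<^sup>2 - 1) * m t1 > 1")
    case False
    have "1 * (W b (sqrt (m T)) - W b (sqrt (m 0))) + b * (\<theta> T - \<theta> 0) \<le> integral {0..T} v"
    proof (rule calibration[OF P T])
      fix x assume x: "x \<in> {0..T}"
      show "(b\<^sup>2 - 1) * m x \<le> 1"
        by (rule scaled_le_one[OF _ profileD(5)[OF P x] t1(2)[OF x]]) (use False in simp)
    qed simp
    moreover have "W b (sn (b\<^sup>2 - 1) t) + b * Theta b t = t"
      by (rule W_along_ascent) (use bt False in auto)
    moreover have "b * Theta b t \<le> b * \<theta> T" using th bt by (intro mult_left_mono)
    ultimately show ?thesis by (simp add: m0 \<theta>0 sT)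
  next
    case True
    define c where "c = sqrt (1 + 1 / m t1)"
    note bd = two_sheet_bound[OF P t1, folded c_def]
    have "(sn (b\<^sup>2 - 1) t)\<^sup>2 \<le> m t1" using t1(2)[of T] T mT by simp
    from two_sheet_compare(1)[OF A t1(3) this True, folded c_def]
    have "t \<le> 2 * W c (sqrt (m t1)) - W c (sqrt (m T)) + c * Theta b t" by (simp add: sT)
    moreover have "c \<ge> 0" using t1(3) by (simp add: c_def)
    then have "c * Theta b t \<le> c * \<theta> T" using th by (intro mult_left_mono)
    moreover have "integral {0..t1} v + integral {t1..T} v = integral {0..T} v"
      using t1(1) by (intro Henstock_Kurzweil_Integration.integral_combine profileD(4)[OF P]) auto
    ultimately show ?thesis using bd(2,3) by (simp add: m0 \<theta>0 algebra_simps)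
  qed
qed

lemma DERIV_Theta':
  assumes "b \<ge> 0" "sn (b\<^sup>2 - 1) t > 0"
  shows "(Theta b has_real_derivative b * (sn (b\<^sup>2 - 1) t)\<^sup>2 / (1 + (sn (b\<^sup>2 - 1) t)\<^sup>2)) (at t)"
proof (cases "b = 0")
  case True
  then have "Theta b = (\<lambda>_. 0)" using Theta_flat by auto
  then show ?thesis using True by simp
next
  case False
  then show ?thesis using assms by (intro DERIV_Theta) auto
qed

lemma angle_eq_Theta:
  assumes S: "finite S" "continuous_on {0..t} \<theta>" "\<theta> 0 = 0" and A: "admissible b t"
    and D: "\<And>x. x \<in> {0<..<t} - S \<Longrightarrow> (\<theta> has_real_derivative b * m x / (1 + m x)) (at x)"
    and m: "\<And>x. x \<in> {0..t} \<Longrightarrow> m x = (sn (b\<^sup>2 - 1) x)\<^sup>2" and x: "x \<in> {0..t}"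
  shows "\<theta> x = Theta b x"
proof -
  define F where "F x = \<theta> x - Theta b x" for x
  have b: "b \<ge> 0" using A by (simp add: admissible_def)
  have "F x = F 0"
  proof (rule constant_if_deriv_0[where F=F and a=0 and b=x, OF S(1)])
    show "continuous_on {0..x} F" unfolding F_def
      by (intro continuous_intros continuous_on_Theta continuous_on_subset[OF S(2)]) (use x in auto)
    fix u assume u: "u \<in> {0<..<x} - S"
    have "sn (b\<^sup>2 - 1) u > 0" using u x by (intro admissible_sn_pos[OF A]) auto
    then have d: "(Theta b has_real_derivative b * m u / (1 + m u)) (at u)"
      using DERIV_Theta'[OF b, of u] m[of u] u x by simp
    have "(F has_real_derivative 0) (at u)" unfolding F_def
      by (rule DERIV_cong[OF DERIV_diff[OF D d]]) (use u x in auto)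
    then show "(F has_vector_derivative 0) (at u)"
      by (simp add: has_real_derivative_iff_has_vector_derivative)
  qed (use x in simp)
  then show ?thesis using S(3) by (simp add: F_def)
qed

text \<open>At the first time on the rim the linear system would give \<open>cs\<close> = 0, but
  \<open>cs\<close> is positive while k x^2 < pi^2. So the rim is not met before \<open>t\<close>
  and the explicit solution is valid throughout.\<close>

lemma tight_before_turn:
  assumes T: "tight S 0 t m \<theta> b" and m0: "m 0 = 0" and k: "(b\<^sup>2 - 1) * t\<^sup>2 \<le> pi\<^sup>2"
    and x: "0 \<le> x" "x \<le> t"
  shows "sqrt (m x) = sn (b\<^sup>2 - 1) x"
proof -
  have P: "profile S 0 t m \<theta> (\<lambda>_. 1)" and le: "\<And>x. x \<in> {0..t} \<Longrightarrow> (b\<^sup>2 - 1) * m x \<le> 1"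
    using T unfolding tight_def by blast+
  have lt: "(b\<^sup>2 - 1) * m u < 1" if u: "0 < u" "u < t" for u
  proof (rule ccontr)
    assume "\<not> (b\<^sup>2 - 1) * m u < 1"
    then have eq: "(b\<^sup>2 - 1) * m u = 1" using le[of u] u by auto
    have "continuous_on {0..u} (\<lambda>u. (b\<^sup>2 - 1) * m u)"
      by (intro continuous_intros continuous_on_subset[OF profileD(2)[OF P]]) (use u in auto)
    from first_hit[OF this _ eq] u obtain t2
      where t2: "t2 \<in> {0..u}" "(b\<^sup>2 - 1) * m t2 = 1" "\<And>x. 0 \<le> x \<Longrightarrow> x < t2 \<Longrightarrow> (b\<^sup>2 - 1) * m x \<noteq> 1" by auto
    have "(b\<^sup>2 - 1) * m x < 1" if "0 < x" "x < t2" for x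
      using le[of x] t2(3)[of x] t2(1) that u by auto
    then have "sqrt (1 - (b\<^sup>2 - 1) * m t2) = sqrt (1 - (b\<^sup>2 - 1) * m 0) * cs (b\<^sup>2 - 1) (t2 - 0)
        - (b\<^sup>2 - 1) * sqrt (m 0) * sn (b\<^sup>2 - 1) (t2 - 0)"
      by (intro tight_ode(2)[OF T]) (use t2 u in auto)
    then have "cs (b\<^sup>2 - 1) t2 = 0" by (simp add: t2 m0)
    moreover have "(b\<^sup>2 - 1) * t2\<^sup>2 < pi\<^sup>2" 
      by (rule scaled_square_less[OF _ _ k]) (use t2 u in auto)
    ultimately show False using cs_pos[of "b\<^sup>2 - 1" t2] by simp
  qed
  have "sqrt (m x) = sqrt (m 0) * cs (b\<^sup>2 - 1) (x - 0) + sqrt (1 - (b\<^sup>2 - 1) * m 0) * sn (b\<^sup>2 - 1) (x - 0)"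
    by (rule tight_ode(1)[OF T]) (use x lt in auto)
  then show ?thesis by (simp add: m0)
qed

text \<open>The extremal of the two-sheeted calibration cannot linger on the circle where the
  sheets meet: the times needed for the ascent and for the descent already add up to \<open>t\<close>.\<close>

lemma ascent_time:
  assumes T: "tight S a c n \<theta> b" and sg: "\<sigma> > 0" "b\<^sup>2 - 1 = \<sigma>\<^sup>2" and nc: "\<sigma>\<^sup>2 * n c = 1"
    and ph: "0 \<le> \<psi>" "\<psi> \<le> pi / 2" "sqrt (n a) = sin \<psi> / \<sigma>"
  defines "d \<equiv> (pi / 2 - \<psi>) * 2 / \<sigma>"
  shows "d \<le> c - a" "\<And>x. a \<le> x \<Longrightarrow> x \<le> a + d \<Longrightarrow> sqrt (n x) = sin (\<psi> + \<sigma> * (x - a) / 2) / \<sigma>"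
proof -
  have P: "profile S a c n \<theta> (\<lambda>_. 1)" and le: "\<And>x. x \<in> {a..c} \<Longrightarrow> \<sigma>\<^sup>2 * n x \<le> 1" and ac: "a \<le> c"
    using T sg unfolding tight_def by auto
  have na: "n a = (sin \<psi> / \<sigma>)\<^sup>2"
    using ph(3) profileD(5)[OF P, of a] ac by (metis atLeastAtMost_iff order_refl real_sqrt_pow2)
  have ca: "sqrt (1 - \<sigma>\<^sup>2 * n a) = cos \<psi>"
  proof -
    have "1 - \<sigma>\<^sup>2 * n a = (cos \<psi>)\<^sup>2" using sg by (simp add: na power_divide cos_squared_eq)
    moreover have "cos \<psi> \<ge> 0" using ph by (intro cos_ge_zero) auto
    ultimately show ?thesis by simp
  qed
  have "continuous_on {a..c} (\<lambda>u. \<sigma>\<^sup>2 * n u)"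
    by (intro continuous_intros profileD(2)[OF P])
  from first_hit[OF this ac nc] obtain t2
    where t2: "t2 \<in> {a..c}" "\<sigma>\<^sup>2 * n t2 = 1" "\<And>x. a \<le> x \<Longrightarrow> x < t2 \<Longrightarrow> \<sigma>\<^sup>2 * n x \<noteq> 1" by blast
  have lt: "\<sigma>\<^sup>2 * n x < 1" if "a \<le> x" "x < t2" for x
    using le[of x] t2(3)[of x] t2(1) that by auto
  have ode: "sqrt (n x) = sin (\<psi> + \<sigma> * (x - a) / 2) / \<sigma>" "sqrt (1 - \<sigma>\<^sup>2 * n x) = cos (\<psi> + \<sigma> * (x - a) / 2)"
    if x: "a \<le> x" "x \<le> t2" for x
  proof -
    have l: "(b\<^sup>2 - 1) * n u < 1" if "a < u" "u < x" for u
      using lt[of u] that x sg by simp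
    have xc: "x \<le> c" using x t2 by simp
    note o = tight_ode[OF T order_refl x(1) xc l, unfolded sg ca ph(3) sn_elliptic[OF sg(1)]
        cs_elliptic[OF less_imp_le[OF sg(1)]]]
    show "sqrt (n x) = sin (\<psi> + \<sigma> * (x - a) / 2) / \<sigma>"
      using o(1) by (simp add: sin_add add_divide_distrib)
    show "sqrt (1 - \<sigma>\<^sup>2 * n x) = cos (\<psi> + \<sigma> * (x - a) / 2)"
      using o(2) sg(1) by (simp add: cos_add power2_eq_square)
  qed
  have d: "\<sigma> * d / 2 = pi / 2 - \<psi>" "d \<ge> 0" using sg ph by (auto simp: d_def)
  \<comment> \<open>The first time on the rim is when the phase \<psi> + \<sigma> (t2 - a) / 2
    reaches pi / 2; \<open>d\<close> is defined by this.\<close>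
  have "t2 = a + d"
  proof (rule antisym)
    show "t2 \<le> a + d"
    proof (rule ccontr)
      assume "\<not> t2 \<le> a + d"
      then have l: "\<sigma>\<^sup>2 * n (a + d) < 1" and "sqrt (1 - \<sigma>\<^sup>2 * n (a + d)) = cos (\<psi> + \<sigma> * (a + d - a) / 2)"
        using d(2) by (intro lt ode; simp)+
      moreover have "cos (\<psi> + \<sigma> * (a + d - a) / 2) = 0"
        unfolding add_diff_cancel_left' d(1) by simp
      ultimately have "sqrt (1 - \<sigma>\<^sup>2 * n (a + d)) = 0" by (simp only:)
      then show False using l by simp
    qed
    show "a + d \<le> t2"
    proof (rule ccontr)
      assume lt2: "\<not> a + d \<le> t2"
      have "cos (\<psi> + \<sigma> * (t2 - a) / 2) = 0" using ode(2)[of t2] t2 by simp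
      moreover have "\<sigma> * (t2 - a) / 2 < pi / 2 - \<psi>"
      proof -
        have "\<sigma> * (t2 - a) < \<sigma> * d" using lt2 sg by (intro mult_strict_left_mono) auto
        then show ?thesis using d(1) by simp
      qed
      moreover have "\<sigma> * (t2 - a) / 2 \<ge> 0" using t2 sg by simp
      ultimately show False using cos_gt_zero_pi[of "\<psi> + \<sigma> * (t2 - a) / 2"] ph pi_gt_zero by simp
    qed
  qed
  then show "d \<le> c - a" "\<And>x. a \<le> x \<Longrightarrow> x \<le> a + d \<Longrightarrow> sqrt (n x) = sin (\<psi> + \<sigma> * (x - a) / 2) / \<sigma>"
    using t2(1) ode(1) by auto
qed

text \<open>All inequalities behind the lower bound become equalities. Either one sheet makes the
  whole path tight, or the comparison yields \<open>b = c\<close> and the path consists of a tight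
  ascent followed by the time reversal of another one.\<close>

theorem profile_equality:
  assumes P: "profile S 0 t m \<theta> (\<lambda>_. 1)" and m0: "m 0 = 0" and \<theta>0: "\<theta> 0 = 0"
    and A: "admissible b t" and mT: "m t = (sn (b\<^sup>2 - 1) t)\<^sup>2" and th: "Theta b t \<le> \<theta> t"
    and x: "x \<in> {0..t}"
  shows "m x = (sn (b\<^sup>2 - 1) x)\<^sup>2 \<and> \<theta> x = Theta b x"
proof -
  have bt: "0 \<le> b" "0 < t" "(b\<^sup>2 - 1) * t\<^sup>2 \<le> 4 * pi\<^sup>2" using A by (auto simp: admissible_def)
  have t: "0 \<le> t" using bt by simp
  have sT: "sqrt (m t) = sn (b\<^sup>2 - 1) t" using mT admissible_sn_nonneg[OF A, of t] bt by simp
  obtain t1 where t1: "t1 \<in> {0..t}" "\<And>x. x \<in> {0..t} \<Longrightarrow> m x \<le> m t1" "m t1 > 0"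
    using profile_max[OF P t \<theta>0 A mT th] by blast
  have msq: "m x = (sn (b\<^sup>2 - 1) x)\<^sup>2" if "sqrt (m x) = sn (b\<^sup>2 - 1) x" "x \<in> {0..t}" for x
    using that(1) profileD(5)[OF P that(2)] by (metis real_sqrt_pow2)
  show ?thesis
  proof (cases "(b\<^sup>2 - 1) * t\<^sup>2 > pi\<^sup>2 \<or> (b\<^sup>2 - 1) * m t1 > 1")
    case False
    have "W b (sn (b\<^sup>2 - 1) t) + b * Theta b t = t"
      by (rule W_along_ascent) (use bt False in auto)
    moreover have "b * Theta b t \<le> b * \<theta> t" using th bt by (intro mult_left_mono)
    ultimately have T: "tight S 0 t m \<theta> b"
    proof (intro tightI[OF P t])
      fix x assume x: "x \<in> {0..t}"
      show "(b\<^sup>2 - 1) * m x \<le> 1"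
        by (rule scaled_le_one[OF _ profileD(5)[OF P x] t1(2)[OF x]]) (use False in simp)
    qed (simp add: m0 \<theta>0 sT)
    have m: "m x = (sn (b\<^sup>2 - 1) x)\<^sup>2" if "x \<in> {0..t}" for x
      by (rule msq[OF tight_before_turn[OF T m0] that]) (use False that in auto)
    then show ?thesis
      using angle_eq_Theta[OF profileD(1,3)[OF P] \<theta>0 A tight_deriv(2)[OF T] m x] x by simp
  next
    case True
    define c where "c = sqrt (1 + 1 / m t1)"
    note bd = two_sheet_bound[OF P t1, folded c_def]
    have "(sn (b\<^sup>2 - 1) t)\<^sup>2 \<le> m t1" using t1(2)[of t] t mT by simp
    note cmp = two_sheet_compare[OF A t1(3) this True, folded c_def]
    have c0: "c \<ge> 0" using t1(3) by (simp add: c_def)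
    then have th': "c * Theta b t \<le> c * \<theta> t" using th by (intro mult_left_mono)
    have bd2: "W c (sqrt (m t1)) + c * \<theta> t1 \<le> t1"
      and bd3: "W c (sqrt (m t1)) - W c (sn (b\<^sup>2 - 1) t) + c * (\<theta> t - \<theta> t1) \<le> t - t1"
      using bd(2,3) t1(1) by (auto simp: m0 \<theta>0 sT)
    have sum: "2 * W c (sqrt (m t1)) - W c (sn (b\<^sup>2 - 1) t) + c * \<theta> t \<le> t"
      using bd2 bd3 by (simp add: algebra_simps)
    then have "t = 2 * W c (sqrt (m t1)) - W c (sn (b\<^sup>2 - 1) t) + c * Theta b t"
      using cmp(1) th' by linarith
    from cmp(2)[OF this] have bc: "b = c" and half: "(b\<^sup>2 - 1) * t\<^sup>2 \<ge> pi\<^sup>2" by auto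
    have eq: "2 * W c (sqrt (m t1)) - W c (sn (b\<^sup>2 - 1) t) + c * \<theta> t = t"
      using sum cmp(1) th' by linarith
    define \<sigma> where "\<sigma> = 1 / sqrt (m t1)"
    have sg: "\<sigma> > 0" "b\<^sup>2 - 1 = \<sigma>\<^sup>2" "\<sigma>\<^sup>2 * m t1 = 1"
      using t1(3) by (auto simp: \<sigma>_def bc c_def power_divide add_pos_pos less_imp_le)
    have t1': "0 \<le> t1" "t1 \<le> t" using t1 by auto
    have T1: "tight S 0 t1 m \<theta> b"
    proof (rule tightI[OF profile_subinterval[OF P]])
      show "t1 - 0 \<le> W b (sqrt (m t1)) - W b (sqrt (m 0)) + b * (\<theta> t1 - \<theta> 0)"
        using eq bd3 by (simp add: bc m0 \<theta>0 algebra_simps)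
    qed (use t1' bd(1) bc in auto)
    \<comment> \<open>The descent run backwards, which is tight for the sheet
      \<open>W\<close>.\<close>
    define n where "n x = m (t1 + t - x)" for x
    define \<phi> where "\<phi> x = - \<theta> (t1 + t - x)" for x
    define S' where "S' = (\<lambda>x. t1 + t - x) ` S"
    have T2: "tight S' t1 t n \<phi> b"
    proof (rule tightI)
      show "profile S' t1 t n \<phi> (\<lambda>_. 1)"
        unfolding S'_def n_def \<phi>_def
        by (rule profile_reverse[OF profile_subinterval[OF P]]) (use t1' in auto)
      show "t - t1 \<le> W b (sqrt (n t)) - W b (sqrt (n t1)) + b * (\<phi> t - \<phi> t1)"
        using eq bd2 by (simp add: bc n_def \<phi>_def sT algebra_simps)
    qed (use t1' bd(1) bc in \<open>auto simp: n_def\<close>)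
    have half_t: "pi \<le> \<sigma> * t" "\<sigma> * t \<le> 2 * pi"
    proof -
      have "pi\<^sup>2 \<le> (\<sigma> * t)\<^sup>2" "(\<sigma> * t)\<^sup>2 \<le> (2 * pi)\<^sup>2" using half bt by (auto simp: sg power_mult_distrib)
      then show "pi \<le> \<sigma> * t" "\<sigma> * t \<le> 2 * pi"
        using sg t by (auto intro: power2_le_imp_le)
    qed
    define h where "h = pi / \<sigma>"
    have "sqrt (m 0) = sin 0 / \<sigma>" by (simp add: m0)
    note a1 = ascent_time[OF T1 sg(1,2,3) order_refl _ this]
    have up: "h \<le> t1" "\<And>x. 0 \<le> x \<Longrightarrow> x \<le> h \<Longrightarrow> sqrt (m x) = sin (\<sigma> * x / 2) / \<sigma>"
      using a1 by (auto simp: h_def)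
    \<comment> \<open>The end lies at half-phase \<sigma> t / 2 on the way down, hence at pi -
      \<sigma> t / 2 on the reversed way up.\<close>
    have "sqrt (n t1) = sin (pi - \<sigma> * t / 2) / \<sigma>"
      by (simp add: n_def sT sg(2) sn_elliptic[OF sg(1)])
    note a2 = ascent_time[OF T2 sg(1,2) _ _ _ this]
    have dd: "(pi / 2 - (pi - \<sigma> * t / 2)) * 2 / \<sigma> = t - h" using sg(1) by (simp add: h_def field_simps)
    have down: "t - h \<le> t - t1"
        "\<And>x. t1 \<le> x \<Longrightarrow> x \<le> t1 + (t - h) \<Longrightarrow> sqrt (n x) = sin (pi - \<sigma> * t / 2 + \<sigma> * (x - t1) / 2) / \<sigma>"
      using a2 half_t sg(3) unfolding dd by (auto simp: n_def)
    have t1h: "t1 = h" using up(1) down(1) by simp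
    have sq: "sqrt (m x) = sn (b\<^sup>2 - 1) x" if x: "x \<in> {0..t}" for x
    proof (cases "x \<le> h")
      case True
      then show ?thesis using up(2)[of x] x by (simp add: sg(2) sn_elliptic[OF sg(1)])
    next
      case False
      have "sqrt (n (h + t - x)) = sin (pi - \<sigma> * t / 2 + \<sigma> * (t - x) / 2) / \<sigma>"
        using down(2)[of "h + t - x"] False x t1h by simp
      moreover have "pi - \<sigma> * t / 2 + \<sigma> * (t - x) / 2 = pi - \<sigma> * x / 2" by (simp add: algebra_simps diff_divide_distrib)
      ultimately show ?thesis by (simp add: n_def t1h sg(2) sn_elliptic[OF sg(1)])
    qed
    have m: "m x = (sn (b\<^sup>2 - 1) x)\<^sup>2" if "x \<in> {0..t}" for x
      by (rule msq[OF sq[OF that] that])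
    have D: "(\<theta> has_real_derivative b * m x / (1 + m x)) (at x)" if x: "x \<in> {0<..<t} - (S \<union> {t1})" for x
    proof (cases "x < t1")
      case True
      then show ?thesis using x by (intro tight_deriv(2)[OF T1]) auto
    next
      case False
      define y where "y = t1 + t - x"
      have y: "y \<in> {t1<..<t} - S'" using False x by (auto simp: y_def S'_def)
      have r: "((\<lambda>x. t1 + t - x) has_real_derivative -1) (at x)"
        by (auto intro!: derivative_eq_intros)
      have "(\<phi> has_real_derivative b * n y / (1 + n y)) (at y)" by (rule tight_deriv(2)[OF T2 y])
      then have "((\<lambda>x. \<phi> (t1 + t - x)) has_real_derivative b * n y / (1 + n y) * -1) (at x)"
        unfolding y_def by (rule DERIV_chain2[where g="\<lambda>x. t1 + t - x", OF _ r])
      from DERIV_minus[OF this] show ?thesis by (simp add: \<phi>_def n_def y_def)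
    qed
    have "finite (S \<union> {t1})" using profileD(1)[OF P] by simp
    from angle_eq_Theta[OF this profileD(3)[OF P] \<theta>0 A D m x] m[OF x] show ?thesis by simp
  qed
qed

section \<open>Existence of minimal arcs\<close>

text \<open>\<open>cosq\<close> decreases on the negative axis and is bounded by 1 in absolute value
  on the positive one. This keeps the squared curvature nonnegative and the arccos argument in range
  when arcs are parametrized by \<open>q\<close>.\<close>

lemma cosq_square_le: assumes "1 \<le> c" "q0 \<le> q" "cosq q0 = c" "q0 \<le> 0" shows "(cosq q)\<^sup>2 \<le> c\<^sup>2"
proof (cases "q \<le> 0")
  case True
  have "cosq q \<le> cosq q0"
  proof (rule DERIV_nonpos_imp_nonincreasing[OF assms(2)])
    fix x assume "q0 \<le> x" "x \<le> q"
    then have "- sinq x / 2 \<le> 0" using sinq_ge_1[of x] True by simp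
    then show "\<exists>y. (cosq has_real_derivative y) (at x) \<and> y \<le> 0" using DERIV_cosq by blast
  qed
  then show ?thesis using cosq_ge_1[OF True] assms by (intro power_mono) auto
next
  case False
  then have "q * (sinq q)\<^sup>2 \<ge> 0" by simp
  then have "(cosq q)\<^sup>2 \<le> 1" using cosq_sinq[of q] by linarith
  also have "1 \<le> c\<^sup>2" using assms(1) by simp
  finally show ?thesis .
qed

text \<open>A full circle has \<sigma> t = 2 pi and holonomy b t - 2 pi. Together with b^2 -
  \<sigma>^2 = 1, holonomy \<open>h\<close> forces t^2 = (h + 2 pi)^2 - (2 pi)^2, which is the
  choice made here.\<close>

lemma admissible_exists_0:
  assumes "h > 0" "h \<le> pi"
  obtains b t where "admissible b t" "sn (b\<^sup>2 - 1) t = 0" "Theta b t = h"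
proof -
  define t where "t = sqrt (h\<^sup>2 + 4 * pi * h)"
  have t: "t > 0" "t\<^sup>2 = h\<^sup>2 + 4 * pi * h" using assms by (auto simp: t_def add_pos_pos)
  define \<sigma> where "\<sigma> = 2 * pi / t"
  have sg: "\<sigma> > 0" "\<sigma> * t = 2 * pi" using t by (auto simp: \<sigma>_def)
  define b where "b = (h + 2 * pi) / t"
  have b: "b\<^sup>2 - 1 = \<sigma>\<^sup>2" "b > 0"
  proof -
    have "(h + 2 * pi)\<^sup>2 = t\<^sup>2 + (2 * pi)\<^sup>2" 
      unfolding t(2) by (simp add: power2_eq_square algebra_simps)
    then have "b\<^sup>2 = (t\<^sup>2 + (2 * pi)\<^sup>2) / t\<^sup>2" by (simp add: b_def power_divide)
    also have "\<dots> = 1 + \<sigma>\<^sup>2" using t(1) by (simp add: \<sigma>_def power_divide add_divide_distrib)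
    finally show "b\<^sup>2 - 1 = \<sigma>\<^sup>2" by simp
    show "b > 0" using assms t by (simp add: b_def add_pos_pos)
  qed
  have sn: "sn (b\<^sup>2 - 1) t = 0" unfolding b sn_elliptic[OF sg(1)] sg(2) by simp
  have cs: "cs (b\<^sup>2 - 1) t = -1" unfolding b cs_elliptic[OF less_imp_le[OF sg(1)]] sg(2) by simp
  have Th: "Theta b t = h" using t by (simp add: Theta_def sn cs) (simp add: b_def)
  have "(b\<^sup>2 - 1) * t\<^sup>2 = 4 * pi\<^sup>2" unfolding b power_mult_distrib[symmetric] sg(2) by simp
  then have "admissible b t" using b t Th assms by (simp add: admissible_def)
  then show ?thesis using that sn Th by blast
qed

text \<open>The arcs over the chord \<open>s\<close> are parametrized by the signed square
  \<open>q\<close> of half the phase, which passes smoothly through curvature 1. The holonomy is 0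
  on the straight line and at least pi close to the full circle; the intermediate value theorem does
  the rest.\<close>

lemma admissible_exists_pos:
  assumes s: "s > 0" and h: "0 \<le> h" "h \<le> pi"
  obtains b t where "admissible b t" "sn (b\<^sup>2 - 1) t = s" "Theta b t = h"
proof -
  define R where "R = sqrt (1 + s\<^sup>2)"
  have R: "R \<ge> 1" "R\<^sup>2 = 1 + s\<^sup>2" by (auto simp: R_def)
  \<comment> \<open>Here cosq q0 = cosh (r / 2), which makes the curvature 0: the straight
    line.\<close>
  obtain q0 where q0: "q0 \<le> 0" "cosq q0 = R"
  proof -
    have "1 \<le> (sinq (- s\<^sup>2))\<^sup>2" using sinq_ge_1[of "- s\<^sup>2"] by simp
    then have "s\<^sup>2 * 1 \<le> s\<^sup>2 * (sinq (- s\<^sup>2))\<^sup>2" by (intro mult_left_mono) auto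
    then have "R\<^sup>2 \<le> (cosq (- s\<^sup>2))\<^sup>2" using cosq_sinq[of "- s\<^sup>2"] by (simp add: R)
    then have "R \<le> cosq (- s\<^sup>2)" by (rule power2_le_imp_le) (use cosq_ge_1[of "- s\<^sup>2"] in simp)
    moreover have "continuous_on {- s\<^sup>2..0} cosq" using continuous_on_cosq[OF continuous_on_id] by simp
    ultimately show ?thesis
      using IVT2'[of cosq 0 R "- s\<^sup>2"] R that by auto
  qed
  \<comment> \<open>The bound makes the length 2 s / sinq q1 at least 3 pi. The arccos term takes
    away at most 2 pi, so a holonomy of at least pi remains.\<close>
  obtain q1 where q1: "0 \<le> q1" "q1 < pi\<^sup>2" "sinq q1 \<le> 2 * s / (3 * pi)"
  proof -
    define e where "e = min 1 (2 * s / (3 * pi))"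
    have e: "0 < e" "e \<le> 1" "e \<le> 2 * s / (3 * pi)" using s by (auto simp: e_def)
    have "continuous_on {0..pi\<^sup>2} sinq" using continuous_on_sinq[OF continuous_on_id] by simp
    then obtain q where q: "0 \<le> q" "q \<le> pi\<^sup>2" "sinq q = e"
      using IVT2'[of sinq "pi\<^sup>2" e 0] e by auto
    moreover have "q \<noteq> pi\<^sup>2" using q e by auto
    ultimately show ?thesis using that[of q] e by auto
  qed
  \<comment> \<open>\<open>k\<close> and \<open>T\<close> solve the two equations sn k T = s and k
    T^2 / 4 = q.\<close>
  define k where "k q = q * (sinq q)\<^sup>2 / s\<^sup>2" for q
  define T where "T q = 2 * s / sinq q" for q
  define B where "B q = sqrt (1 + k q)" for q
  define H where "H q = B q * T q - 2 * arccos (cosq q / R)" for q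
  have le: "(cosq q)\<^sup>2 \<le> R\<^sup>2" if "q0 \<le> q" for q
    by (rule cosq_square_le[OF R(1) that q0(2,1)])
  have k1: "1 + k q = (R\<^sup>2 - (cosq q)\<^sup>2) / s\<^sup>2" for q
  proof -
    have "q * (sinq q)\<^sup>2 = 1 - (cosq q)\<^sup>2" using cosq_sinq[of q] by simp
    then show ?thesis using s by (simp add: k_def R field_simps)
  qed
  have B: "B q \<ge> 0" "(B q)\<^sup>2 - 1 = k q" if "q0 \<le> q" for q
  proof -
    have "1 + k q \<ge> 0" unfolding k1 using le[OF that] by (intro divide_nonneg_nonneg) auto
    then show "B q \<ge> 0" "(B q)\<^sup>2 - 1 = k q" by (simp_all add: B_def)
  qed
  have rg: "-1 \<le> cosq q / R \<and> cosq q / R \<le> 1" if "q0 \<le> q" for q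
  proof -
    have "\<bar>cosq q\<bar> \<le> \<bar>R\<bar>" using le[OF that] by (simp add: abs_le_square_iff)
    then have "cosq q \<le> R" "- R \<le> cosq q" using R(1) by linarith+
    then show ?thesis using R(1) by (simp add: pos_le_divide_eq pos_divide_le_eq)
  qed
  have sq: "sinq q > 0" if "q \<le> q1" for q using that q1 by (intro sinq_pos) auto
  have Tq: "k q * (T q)\<^sup>2 / 4 = q" "T q > 0" if "q \<le> q1" for q
    using sq[OF that] s by (auto simp: k_def T_def power_divide)
  have main: "sn ((B q)\<^sup>2 - 1) (T q) = s" "Theta (B q) (T q) = H q" if "q0 \<le> q" "q \<le> q1" for q
  proof -
    show sn: "sn ((B q)\<^sup>2 - 1) (T q) = s"
      unfolding B(2)[OF that(1)] sn_def Tq(1)[OF that(2)] using sq[OF that(2)] by (simp add: T_def)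
    have cs: "cs ((B q)\<^sup>2 - 1) (T q) = cosq q"
      unfolding B(2)[OF that(1)] cs_def Tq(1)[OF that(2)] ..
    show "Theta (B q) (T q) = H q" unfolding Theta_def sn cs H_def R_def ..
  qed
  have q01: "q0 \<le> q1" using q0 q1 by simp
  have "H q0 = 0"
  proof -
    have "B q0 = 0" unfolding B_def k1 q0 by simp
    then show ?thesis using R by (simp add: H_def q0)
  qed
  moreover have "H q1 \<ge> pi"
  proof -
    have "3 * pi \<le> T q1" using q1(3) sq[of q1] s by (simp add: T_def field_simps)
    moreover have "B q1 \<ge> 1" using q1 by (simp add: B_def k_def)
    ultimately have "B q1 * T q1 \<ge> 1 * (3 * pi)" by (intro mult_mono) auto
    moreover have "arccos (cosq q1 / R) \<le> pi" using rg[OF q01] by (intro arccos_ubound) auto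
    ultimately show ?thesis by (simp add: H_def)
  qed
  moreover have "continuous_on {q0..q1} H"
  proof -
    have "continuous_on {q0..q1} (\<lambda>q. arccos (cosq q / R))"
      by (rule continuous_on_arccos) (use rg R in \<open>auto intro!: continuous_intros\<close>)
    moreover have "continuous_on {q0..q1} (\<lambda>q. sqrt (1 + q * (sinq q)\<^sup>2 / s\<^sup>2) * (2 * s / sinq q))"
      using sq s by (intro continuous_intros) (auto simp: less_imp_neq[symmetric])
    ultimately show ?thesis unfolding H_def B_def k_def T_def
      by (intro continuous_on_diff continuous_on_mult[OF continuous_on_const])
  qed
  ultimately obtain q where q: "q0 \<le> q" "q \<le> q1" "H q = h"
    using IVT'[of H q0 h q1] h q01 by auto
  have "((B q)\<^sup>2 - 1) * (T q)\<^sup>2 = 4 * q"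
    unfolding B(2)[OF q(1)] using Tq(1)[OF q(2)] by linarith
  moreover have "4 * q \<le> 4 * pi\<^sup>2" using q(2) q1(2) by simp
  ultimately have "admissible (B q) (T q)"
    unfolding admissible_def using B(1)[OF q(1)] Tq(2)[OF q(2)] main(2)[OF q(1,2)] q(3) h(2)
    by (intro conjI) linarith+
  then show ?thesis using that main[OF q(1,2)] q(3) by simp
qed

section \<open>Coordinates on the group\<close>

lemma mat3_eq_iff:
  "(A :: mat3) = B \<longleftrightarrow> A$1$1 = B$1$1 \<and> A$1$2 = B$1$2 \<and> A$1$3 = B$1$3 \<and>
     A$2$1 = B$2$1 \<and> A$2$2 = B$2$2 \<and> A$2$3 = B$2$3 \<and> A$3$1 = B$3$1 \<and> A$3$2 = B$3$2 \<and> A$3$3 = B$3$3"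
  by (auto simp: vec_eq_iff forall_3)

lemma mult_entry: "((A :: mat3) ** B)$i$j = A$i$1 * B$1$j + A$i$2 * B$2$j + A$i$3 * B$3$j"
  by (simp add: matrix_matrix_mult_def sum_3)

lemma transpose_entry: "transpose (A :: mat3)$i$j = A$j$i"
  by (simp add: transpose_def)

lemma one_entry: "(mat 1 :: mat3)$i$j = (if i = j then 1 else 0)"
  by (simp add: mat_def)

lemma inner_mat3: "(A :: mat3) \<bullet> B = A$1$1 * B$1$1 + A$1$2 * B$1$2 + A$1$3 * B$1$3 +
     A$2$1 * B$2$1 + A$2$2 * B$2$2 + A$2$3 * B$2$3 + A$3$1 * B$3$1 + A$3$2 * B$3$2 + A$3$3 * B$3$3"
  by (simp add: inner_vec_def sum_3)

lemmas mat3_simps = mat3_eq_iff mult_entry transpose_entry one_entry inner_mat3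
  I21_def mat_a_def mat_b_def mat_c_def

lemma I21_I21 [simp]: "I21 ** I21 = mat 1" "transpose I21 = I21"
  by (simp_all add: mat3_simps)

text \<open>The group inverse written without choice. It is linear in \<open>C\<close>, so curves of
  inverses can be differentiated directly.\<close>

definition linv :: "mat3 \<Rightarrow> mat3" where "linv C = I21 ** transpose C ** I21"

lemma linv_mult: "linv (A ** B) = linv B ** linv A"
proof -
  have "linv B ** linv A = I21 ** transpose B ** (I21 ** I21) ** transpose A ** I21"
    by (simp only: linv_def matrix_mul_assoc)
  then show ?thesis by (simp add: linv_def matrix_transpose_mul matrix_mul_assoc)
qed

text \<open>\<open>matrix_inv\<close> chooses some two-sided inverse, and inverses are unique; so
  one product equation expresses the condition on it.\<close>

lemma SO21_iff: "C \<in> SO21 \<longleftrightarrow> C ** linv C = mat 1 \<and> C$1$1 \<ge> 1 \<and> det C = 1"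
proof
  assume "C \<in> SO21"
  then have C: "matrix_inv C = linv C" "C$1$1 \<ge> 1" "det C = 1" by (auto simp: SO21_def linv_def)
  then have "invertible C" by (simp add: invertible_det_nz)
  then show "C ** linv C = mat 1 \<and> C$1$1 \<ge> 1 \<and> det C = 1"
    using C someI_ex[of "\<lambda>A'. C ** A' = mat 1 \<and> A' ** C = mat 1"]
    by (auto simp: invertible_def matrix_inv_def)
next
  assume C: "C ** linv C = mat 1 \<and> C$1$1 \<ge> 1 \<and> det C = 1"
  then have inv: "linv C ** C = mat 1" by (simp add: matrix_left_right_inverse)
  have "C ** matrix_inv C = mat 1 \<and> matrix_inv C ** C = mat 1"
    unfolding matrix_inv_def
    by (rule someI[of "\<lambda>A'. C ** A' = mat 1 \<and> A' ** C = mat 1" "linv C"]) (simp add: C inv)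
  then have "linv C ** (C ** matrix_inv C) = linv C" by simp
  then have "(linv C ** C) ** matrix_inv C = linv C" by (simp only: matrix_mul_assoc)
  then have "matrix_inv C = linv C" using \<open>linv C ** C = mat 1\<close> by simp
  then show "C \<in> SO21" using C by (simp add: SO21_def linv_def)
qed

lemma SO21_linv:
  assumes "C \<in> SO21"
  shows "C ** linv C = mat 1" "linv C ** C = mat 1" "matrix_inv C = linv C"
  using assms SO21_iff[of C] matrix_left_right_inverse[of C "linv C"] by (auto simp: SO21_def linv_def)

lemma SO21_cancel [simp]:
  assumes "C \<in> SO21"
  shows "linv C ** (C ** A) = A" "C ** (linv C ** A) = A"
  using SO21_linv[OF assms] by (simp_all add: matrix_mul_assoc)

lemma SO21_rows:
  assumes "C \<in> SO21"
  shows "(C$1$1)\<^sup>2 = 1 + (C$1$2)\<^sup>2 + (C$1$3)\<^sup>2" "(C$2$2)\<^sup>2 + (C$2$3)\<^sup>2 = 1 + (C$2$1)\<^sup>2"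
    "(C$3$2)\<^sup>2 + (C$3$3)\<^sup>2 = 1 + (C$3$1)\<^sup>2" "C$2$2 * C$3$2 + C$2$3 * C$3$3 = C$2$1 * C$3$1"
  using SO21_linv(1)[OF assms] unfolding linv_def mat3_simps
  by (simp_all add: power2_eq_square)

lemma SO21_columns:
  assumes "C \<in> SO21"
  shows "(C$1$1)\<^sup>2 = 1 + (C$2$1)\<^sup>2 + (C$3$1)\<^sup>2"
    "C$1$1 * C$1$2 = C$2$1 * C$2$2 + C$3$1 * C$3$2" "C$1$1 * C$1$3 = C$2$1 * C$2$3 + C$3$1 * C$3$3"
  using SO21_linv(2)[OF assms] unfolding linv_def mat3_simps
  by (simp_all add: power2_eq_square)

text \<open>\<open>X\<close> is the adjugate. With determinant 1 it is the inverse, hence equal to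
  \<open>linv C\<close>, and the entries can be compared.\<close>

lemma SO21_cofactors:
  assumes "C \<in> SO21"
  shows "C$1$1 = C$2$2 * C$3$3 - C$2$3 * C$3$2" "C$1$2 = C$2$1 * C$3$3 - C$2$3 * C$3$1"
    "C$1$3 = C$2$2 * C$3$1 - C$2$1 * C$3$2"
proof -
  define X :: mat3 where "X = vector [
    vector [C$2$2 * C$3$3 - C$2$3 * C$3$2, C$1$3 * C$3$2 - C$1$2 * C$3$3, C$1$2 * C$2$3 - C$1$3 * C$2$2],
    vector [C$2$3 * C$3$1 - C$2$1 * C$3$3, C$1$1 * C$3$3 - C$1$3 * C$3$1, C$1$3 * C$2$1 - C$1$1 * C$2$3],
    vector [C$2$1 * C$3$2 - C$2$2 * C$3$1, C$1$2 * C$3$1 - C$1$1 * C$3$2, C$1$1 * C$2$2 - C$1$2 * C$2$1]]"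
  have "det C = 1" using assms by (simp add: SO21_iff)
  then have "C ** X = mat 1"
    unfolding det_3 mat3_simps X_def by (simp add: algebra_simps)
  then have "linv C ** (C ** X) = linv C ** mat 1" by simp
  then have "X = linv C" using assms by simp
  then show "C$1$1 = C$2$2 * C$3$3 - C$2$3 * C$3$2" "C$1$2 = C$2$1 * C$3$3 - C$2$3 * C$3$1"
    "C$1$3 = C$2$2 * C$3$1 - C$2$1 * C$3$2"
    unfolding linv_def mat3_simps X_def by simp_all
qed

text \<open>The delicate point is the sign of the corner entry. The first row of \<open>A\<close>
  and the first column of \<open>B\<close> are timelike, so a1 b1 dominates a2 b2 + a3 b3 by
  Cauchy-Schwarz and the entry is positive; as its square is at least 1, so is the entry.\<close>

lemma SO21_mult:
  assumes A: "A \<in> SO21" and B: "B \<in> SO21"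
  shows "A ** B \<in> SO21"
proof -
  have "A ** B ** linv (A ** B) = A ** (B ** (linv B ** linv A))"
    by (simp add: linv_mult matrix_mul_assoc)
  then have 1: "A ** B ** linv (A ** B) = mat 1" using A B SO21_linv(1)[OF A] by simp
  then have p: "((A ** B)$1$1)\<^sup>2 = 1 + ((A ** B)$1$2)\<^sup>2 + ((A ** B)$1$3)\<^sup>2"
    unfolding linv_def mat3_eq_iff mult_entry[of "A ** B"] mult_entry[of I21] 
      mult_entry[of "I21 ** transpose (A ** B)"] transpose_entry one_entry
    by (simp add: I21_def power2_eq_square)
  define a1 a2 a3 b1 b2 b3 where "a1 = A$1$1" "a2 = A$1$2" "a3 = A$1$3" "b1 = B$1$1" "b2 = B$2$1" "b3 = B$3$1"
  note d = this
  have a: "a1\<^sup>2 = 1 + a2\<^sup>2 + a3\<^sup>2" "a1 \<ge> 1" and b: "b1\<^sup>2 = 1 + b2\<^sup>2 + b3\<^sup>2" "b1 \<ge> 1"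
    using SO21_rows(1)[OF A] SO21_columns(1)[OF B] A B by (auto simp: d SO21_iff)
  have "(a2 * b2 + a3 * b3)\<^sup>2 + (a2 * b3 - a3 * b2)\<^sup>2 = (a2\<^sup>2 + a3\<^sup>2) * (b2\<^sup>2 + b3\<^sup>2)"
    by (simp add: power2_eq_square algebra_simps)
  moreover have "(a1 * b1)\<^sup>2 = 1 + a2\<^sup>2 + a3\<^sup>2 + b2\<^sup>2 + b3\<^sup>2 + (a2\<^sup>2 + a3\<^sup>2) * (b2\<^sup>2 + b3\<^sup>2)"
    unfolding power_mult_distrib a b by (simp add: algebra_simps)
  ultimately have "(a2 * b2 + a3 * b3)\<^sup>2 < (a1 * b1)\<^sup>2"
    using zero_le_power2[of a2] zero_le_power2[of a3] zero_le_power2[of b2] zero_le_power2[of b3]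
      zero_le_power2[of "a2 * b3 - a3 * b2"] by linarith
  then have "\<bar>a2 * b2 + a3 * b3\<bar> < \<bar>a1 * b1\<bar>" 
    unfolding not_le[symmetric] abs_le_square_iff by simp
  moreover have "a1 * b1 > 0" using a b by simp
  ultimately have "a1 * b1 + a2 * b2 + a3 * b3 > 0" by linarith
  then have "(A ** B)$1$1 > 0" by (simp add: mult_entry d)
  moreover have "((A ** B)$1$1)\<^sup>2 \<ge> 1" unfolding p by simp
  ultimately have "(A ** B)$1$1 \<ge> 1" by (auto intro: power2_le_imp_le)
  then show ?thesis using 1 A B by (simp add: SO21_iff det_mul)
qed

lemma SO21_linv_in: assumes "C \<in> SO21" shows "linv C \<in> SO21"
proof -
  have "linv (linv C) = C" unfolding linv_def by (simp add: mat3_simps)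
  moreover have "det (linv C) = 1"
  proof -
    have "det (I21 ** I21) = 1" by simp
    then have "det I21 * det I21 = 1" by (simp only: det_mul)
    then show ?thesis using assms unfolding linv_def det_mul det_transpose SO21_iff by (simp add: mult_ac)
  qed
  moreover have "linv C$1$1 = C$1$1" unfolding linv_def mat3_simps by simp
  ultimately show ?thesis using SO21_linv(2)[OF assms] assms by (simp add: SO21_iff)
qed

lemma one_in_SO21 [simp]: "mat 1 \<in> SO21"
  unfolding SO21_iff linv_def by (simp add: one_entry transpose_mat)

text \<open>\<open>zc\<close> is the projection to the hyperbolic plane and the argument of \<open>wc\<close> is the rotation angle in the
  polar decomposition; together they determine the group element.\<close>

definition zc :: "mat3 \<Rightarrow> complex" where "zc C = Complex (C$2$1) (C$3$1)"
definition wc :: "mat3 \<Rightarrow> complex" where "wc C = Complex (C$2$2 + C$3$3) (C$3$2 - C$2$3)"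

lemma linear_zc: "bounded_linear zc" and linear_wc: "bounded_linear wc"
  and linear_entry: "bounded_linear (\<lambda>C :: mat3. C$i$j)"
proof -
  show "bounded_linear zc" "bounded_linear wc"
    by (simp_all add: linear_conv_bounded_linear[symmetric] linear_iff zc_def wc_def complex_eq_iff algebra_simps)
  show "bounded_linear (\<lambda>C :: mat3. C$i$j)"
    by (simp add: linear_conv_bounded_linear[symmetric] linear_iff)
qed

lemma cmod_zc: assumes "C \<in> SO21" shows "(cmod (zc C))\<^sup>2 = (C$1$1)\<^sup>2 - 1"
  using SO21_columns(1)[OF assms] by (simp add: zc_def cmod_power2)

text \<open>Writing \<open>C\<close> as a boost of length r times a rotation, \<open>C$1$1\<close>
  is cosh r and the modulus is 1 + cosh r. The computation uses the row relations and the cofactor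
  formula for the corner.\<close>

lemma cmod_wc: assumes "C \<in> SO21" shows "cmod (wc C) = 1 + C$1$1"
proof -
  have "(cmod (wc C))\<^sup>2 = ((C$2$2)\<^sup>2 + (C$2$3)\<^sup>2) + ((C$3$2)\<^sup>2 + (C$3$3)\<^sup>2) + 2 * (C$2$2 * C$3$3 - C$2$3 * C$3$2)"
    by (simp add: wc_def cmod_power2) (simp add: power2_eq_square algebra_simps)
  also have "\<dots> = (1 + C$1$1)\<^sup>2"
    unfolding SO21_rows[OF assms] SO21_cofactors(1)[OF assms, symmetric]
    using SO21_columns(1)[OF assms] by (simp add: power2_eq_square algebra_simps)
  finally show ?thesis using assms by (simp add: SO21_iff)
qed

text \<open>Adding the orthogonality relations of the columns to the cofactor formulas gives this
  product. With \<open>lower_block\<close> it recovers from \<open>zc\<close> and \<open>wc\<close>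
  all entries that they do not display, so these coordinates are injective.\<close>

lemma first_row: assumes "C \<in> SO21" shows "(1 + C$1$1) * Complex (C$1$2) (C$1$3) = cnj (wc C) * zc C"
proof -
  have "(1 + C$1$1) * C$1$2 = (C$2$2 + C$3$3) * C$2$1 + (C$3$2 - C$2$3) * C$3$1"
    "(1 + C$1$1) * C$1$3 = (C$2$2 + C$3$3) * C$3$1 - (C$3$2 - C$2$3) * C$2$1"
    using SO21_columns(2,3)[OF assms] SO21_cofactors(2,3)[OF assms]
    unfolding distrib_right left_diff_distrib mult_1 by (simp_all only: mult.commute)
  then show ?thesis by (simp add: zc_def wc_def complex_eq_iff left_diff_distrib)
qed

lemma lower_block:
  assumes "C \<in> SO21"
  shows "Complex (C$2$2 - C$3$3) (C$3$2 + C$2$3) * wc C = (zc C)\<^sup>2"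
  using SO21_rows(2-4)[OF assms]
  by (simp add: zc_def wc_def complex_eq_iff power2_eq_square algebra_simps)

lemma SO21_eqI:
  assumes "C \<in> SO21" "D \<in> SO21" "zc C = zc D" "wc C = wc D"
  shows "C = D"
proof -
  have 1: "C$1$1 = D$1$1" using cmod_wc[OF assms(1)] cmod_wc[OF assms(2)] assms(4) by simp
  have p: "1 + D$1$1 \<noteq> 0" and w: "wc D \<noteq> 0"
    using assms(2) cmod_wc[OF assms(2)] by (auto simp: SO21_iff)
  have "of_real (1 + D$1$1) * Complex (C$1$2) (C$1$3) = of_real (1 + D$1$1) * Complex (D$1$2) (D$1$3)"
    using first_row[OF assms(1)] first_row[OF assms(2)] assms(3,4) 1 by simp
  then have 2: "Complex (C$1$2) (C$1$3) = Complex (D$1$2) (D$1$3)"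
    using p by (simp del: of_real_add)
  have "Complex (C$2$2 - C$3$3) (C$3$2 + C$2$3) * wc D = Complex (D$2$2 - D$3$3) (D$3$2 + D$2$3) * wc D"
    using lower_block[OF assms(1)] lower_block[OF assms(2)] assms(3,4) by simp
  then have 3: "Complex (C$2$2 - C$3$3) (C$3$2 + C$2$3) = Complex (D$2$2 - D$3$3) (D$3$2 + D$2$3)"
    using w by simp
  show ?thesis using 1 2 3 assms(3,4) by (simp add: mat3_eq_iff zc_def wc_def)
qed

section \<open>Horizontal paths\<close>

lemma has_derivative_mat3:
  fixes f :: "'a::real_normed_vector \<Rightarrow> mat3"
  assumes "\<And>i j. ((\<lambda>x. f x$i$j) has_derivative (\<lambda>h. f' h$i$j)) (at x within S)"
  shows "(f has_derivative f') (at x within S)"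
  unfolding has_derivative_componentwise_within[of f]
  using assms by (auto simp: Basis_vec_def inner_axis)

lemma matmul_linear:
  "(A :: mat3) ** (B + C) = A ** B + A ** C" "(A + B) ** C = A ** C + (B :: mat3) ** C"
  "A ** (B - C) = A ** B - A ** C" "(A - B) ** C = A ** C - (B :: mat3) ** C"
  "A ** (r *\<^sub>R B) = r *\<^sub>R (A ** B)" "(r *\<^sub>R A) ** B = r *\<^sub>R (A ** B)"
  by (simp_all add: mat3_eq_iff mult_entry algebra_simps)

lemma bounded_bilinear_matmul: "bounded_bilinear (\<lambda>(A :: mat3) (B :: mat3). A ** B)"
  by (simp add: bilinear_conv_bounded_bilinear[symmetric] bilinear_def linear_iff matmul_linear)

lemma has_vector_derivative_matmul:
  fixes X Y :: "real \<Rightarrow> mat3"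
  assumes "(X has_vector_derivative X') (at t within S)" "(Y has_vector_derivative Y') (at t within S)"
  shows "((\<lambda>t. X t ** Y t) has_vector_derivative (X t ** Y' + X' ** Y t)) (at t within S)"
  by (rule bounded_bilinear.has_vector_derivative[OF bounded_bilinear_matmul assms])

definition hor :: "real \<Rightarrow> real \<Rightarrow> mat3" where
  "hor u1 u2 = u1 *\<^sub>R mat_a + u2 *\<^sub>R mat_b"

lemma hor_entry:
  "hor u1 u2 = vector [vector [0, u1, u2], vector [u1, 0, 0], vector [u2, 0, 0]]"
  by (simp add: hor_def mat3_simps)

lemma distr_eq: "distr x = {x ** hor u1 u2 | u1 u2. True}"
proof -
  have "span {mat_a, mat_b} = {hor u1 u2 | u1 u2. True}"
  proof (intro set_eqI iffI)
    fix A assume "A \<in> span {mat_a, mat_b}"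
    then obtain k where "A - k *\<^sub>R mat_a \<in> span {mat_b}" by (auto simp: span_insert)
    then obtain l where "A - k *\<^sub>R mat_a = l *\<^sub>R mat_b" by (auto simp: span_singleton)
    then have "A = hor k l" by (simp add: hor_def algebra_simps)
    then show "A \<in> {hor u1 u2 | u1 u2. True}" by blast
  next
    fix A assume "A \<in> {hor u1 u2 | u1 u2. True}"
    then show "A \<in> span {mat_a, mat_b}"
      unfolding hor_def by (auto intro!: span_add span_scale intro: span_base)
  qed
  then show ?thesis unfolding distr_def by auto
qed

lemma sr_norm_hor:
  assumes "x \<in> SO21" shows "sr_norm x (x ** hor u1 u2) = sqrt (u1\<^sup>2 + u2\<^sup>2)"
proof -
  have "hor u1 u2 \<bullet> hor u1 u2 = 2 * (u1\<^sup>2 + u2\<^sup>2)"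
    by (simp add: hor_entry inner_mat3 power2_eq_square)
  then show ?thesis using assms by (simp add: sr_norm_def sr_inner_def SO21_linv(3))
qed

lemma zc_hor: "zc (C ** hor u1 u2) = Complex u1 u2 * (wc C / 2) + cnj (Complex u1 u2) * (Complex (C$2$2 - C$3$3) (C$3$2 + C$2$3) / 2)"
  by (simp add: zc_def wc_def hor_entry mult_entry complex_eq_iff algebra_simps add_divide_distrib diff_divide_distrib)

lemma wc_hor: "wc (C ** hor u1 u2) = cnj (Complex u1 u2) * zc C"
  by (simp add: zc_def wc_def hor_entry mult_entry complex_eq_iff algebra_simps)

text \<open>A horizontal velocity has two real components, and where \<open>zc\<close> is nonzero
  \<open>w'\<close> determines them. So the logarithmic derivative of \<open>zc\<close> depends only
  on \<open>wc\<close>, its derivative and the modulus of \<open>zc\<close>.\<close>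

lemma zc_hor':
  assumes C: "C \<in> SO21" and z: "zc C \<noteq> 0" and w': "w' = wc (C ** hor u1 u2)"
  shows "zc (C ** hor u1 u2) / zc C = (cnj w' * wc C / (cmod (zc C))\<^sup>2 + w' / wc C) / 2"
proof -
  have w: "wc C \<noteq> 0" using cmod_wc[OF C] C by (auto simp: SO21_iff)
  define u where "u = Complex u1 u2"
  have v: "Complex (C$2$2 - C$3$3) (C$3$2 + C$2$3) = (zc C)\<^sup>2 / wc C"
    using lower_block[OF C] w by (simp add: field_simps)
  have 1: "zc (C ** hor u1 u2) = u * wc C / 2 + cnj u * ((zc C)\<^sup>2 / wc C) / 2"
    unfolding zc_hor v u_def by simp
  have 2: "w' = cnj u * zc C" unfolding w' wc_hor u_def ..
  have 3: "complex_of_real ((cmod (zc C))\<^sup>2) = zc C * cnj (zc C)" by (rule complex_norm_square)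
  have cz: "cnj (zc C) \<noteq> 0" using z by simp
  show ?thesis unfolding 1 2 3 using w z cz by (simp add: field_simps power2_eq_square)
qed

section \<open>From horizontal paths to radius and holonomy\<close>

lemma horizontal_pathE:
  assumes "horizontal_path T \<gamma>"
  obtains S where "finite S" "continuous_on {0..T} \<gamma>" "\<forall>t\<in>{0..T}. \<gamma> t \<in> SO21"
    "speed \<gamma> integrable_on {0..T}"
    "\<forall>t\<in>{0..T} - S. \<exists>u1 u2. (\<gamma> has_vector_derivative \<gamma> t ** hor u1 u2) (at t) \<and>
        speed \<gamma> t = sqrt (u1\<^sup>2 + u2\<^sup>2)"
proof -
  obtain S1 where S1: "finite S1" "\<gamma> C1_differentiable_on ({0..T} - S1)" and c: "continuous_on {0..T} \<gamma>"
    using assms unfolding horizontal_path_def piecewise_C1_differentiable_on_def by blast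
  obtain S2 where S2: "finite S2" "\<forall>t\<in>{0..T} - S2. vector_derivative \<gamma> (at t) \<in> distr (\<gamma> t)"
    using assms unfolding horizontal_path_def by blast
  have so: "\<gamma> t \<in> SO21" if "t \<in> {0..T}" for t
    using assms that unfolding horizontal_path_def by blast
  show ?thesis
  proof (rule that[of "S1 \<union> S2"]; (intro ballI)?)
    fix t assume t: "t \<in> {0..T} - (S1 \<union> S2)"
    then have "\<gamma> differentiable (at t)" using S1(2) by (auto simp: C1_differentiable_on_eq)
    then have d: "(\<gamma> has_vector_derivative vector_derivative \<gamma> (at t)) (at t)"
      by (simp add: vector_derivative_works)
    have "vector_derivative \<gamma> (at t) \<in> distr (\<gamma> t)" using S2 t by blast
    then obtain u1 u2 where u: "vector_derivative \<gamma> (at t) = \<gamma> t ** hor u1 u2"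
      by (auto simp: distr_eq)
    moreover have "speed \<gamma> t = sqrt (u1\<^sup>2 + u2\<^sup>2)"
      unfolding speed_def u by (rule sr_norm_hor) (use so t in auto)
    ultimately show "\<exists>u1 u2. (\<gamma> has_vector_derivative \<gamma> t ** hor u1 u2) (at t) \<and>
        speed \<gamma> t = sqrt (u1\<^sup>2 + u2\<^sup>2)" using d by auto
  qed (use S1 S2 c so assms in \<open>auto simp: horizontal_path_def\<close>)
qed

text \<open>Close to \<open>t\<close> the imaginary part of \<open>g\<close> changes by less than
  pi, so \<open>g\<close> equals \<open>g t\<close> plus the principal logarithm of f u / f t and
  inherits its derivative.\<close>

lemma continuous_log_deriv:
  fixes f g :: "real \<Rightarrow> complex"
  assumes g: "isCont g t" and f: "(f has_vector_derivative f') (at t)"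
    and fg: "\<And>u. u \<in> U \<Longrightarrow> f u = exp (g u)" and U: "open U" "t \<in> U"
  shows "(g has_vector_derivative f' / f t) (at t)"
proof -
  have nz: "f t \<noteq> 0" using fg U by simp
  have "((\<lambda>u. f u / f t) has_vector_derivative f' / f t) (at t)"
    using has_vector_derivative_mult_left[OF f, of "inverse (f t)"] by (simp add: divide_inverse)
  moreover have "(Ln has_field_derivative 1) (at (f t / f t))"
    using has_field_derivative_Ln[of 1] nz by simp
  ultimately have "((Ln \<circ> (\<lambda>u. f u / f t)) has_vector_derivative f' / f t * 1) (at t)"
    by (rule field_vector_diff_chain_at)
  then have L: "((\<lambda>u. g t + Ln (f u / f t)) has_vector_derivative f' / f t) (at t)"
    by (auto simp: o_def intro!: derivative_eq_intros)
  have "\<forall>\<^sub>F u in at t. dist (g u) (g t) < pi"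
    using g pi_gt_zero unfolding isCont_def by (rule tendstoD)
  then obtain V where V: "open V" "t \<in> V" "\<And>u. u \<in> V \<Longrightarrow> u \<noteq> t \<Longrightarrow> dist (g u) (g t) < pi"
    unfolding eventually_at_topological by blast
  show ?thesis
  proof (rule has_vector_derivative_transform_within_open[OF L])
    show "open (U \<inter> V)" "t \<in> U \<inter> V" using U V by auto
    fix u assume u: "u \<in> U \<inter> V"
    then have "f u / f t = exp (g u - g t)" using fg U by (simp add: exp_diff)
    moreover have "\<bar>Im (g u - g t)\<bar> < pi"
      using V(3)[of u] u abs_Im_le_cmod[of "g u - g t"] by (cases "u = t") (auto simp: dist_norm)
    ultimately show "g t + Ln (f u / f t) = g u"
      by (simp add: Ln_exp del: exp_diff)
  qed
qed

text \<open>The holonomy is a continuous argument of \<open>wc\<close>, which never vanishes because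
  its modulus is 1 + cosh r; (cosh r - 1) / 2 is sinh^2 (r / 2). The real and imaginary parts of the
  one complex number \<open>Y\<close> give the derivatives of both, and its modulus contains the
  speed.\<close>

theorem horizontal_path_profile:
  assumes H: "horizontal_path T \<gamma>" and T: "0 \<le> T" and g0: "\<gamma> 0 = mat 1"
  obtains S \<theta> where "profile S 0 T (\<lambda>t. (\<gamma> t$1$1 - 1) / 2) \<theta> (speed \<gamma>)" "\<theta> 0 = 0"
    "\<forall>t\<in>{0..T}. wc (\<gamma> t) = (1 + \<gamma> t$1$1) * cis (\<theta> t)"
proof -
  obtain S where S: "finite S" "continuous_on {0..T} \<gamma>" and S3: "\<forall>t\<in>{0..T}. \<gamma> t \<in> SO21"
    and S4: "speed \<gamma> integrable_on {0..T}" and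
    D: "\<forall>t\<in>{0..T} - S. \<exists>u1 u2. (\<gamma> has_vector_derivative \<gamma> t ** hor u1 u2) (at t) \<and>
        speed \<gamma> t = sqrt (u1\<^sup>2 + u2\<^sup>2)" by (rule horizontal_pathE[OF H])
  note S = S bspec[OF S3]
  define f where "f t = wc (\<gamma> t)" for t
  have fc: "continuous_on {0..T} f"
    unfolding f_def by (rule bounded_linear.continuous_on[OF linear_wc S(2)])
  have fn: "cmod (f t) = 1 + \<gamma> t$1$1" "\<gamma> t$1$1 \<ge> 1" if "t \<in> {0..T}" for t
    using cmod_wc[OF S(3)[OF that]] S(3)[OF that] by (auto simp: f_def SO21_iff)
  have "f t \<noteq> 0" if "t \<in> {0..T}" for t using fn[OF that] by auto
  then obtain g where g: "continuous_on {0..T} g" "\<And>t. t \<in> {0..T} \<Longrightarrow> f t = exp (g t)"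
    using continuous_logarithm_on_contractible[OF fc convex_imp_contractible] by auto
  define \<theta> where "\<theta> t = Im (g t) - Im (g 0)" for t
  have "f 0 = 2" by (simp add: f_def g0 wc_def one_entry complex_eq_iff)
  then have e0: "exp (g 0) = 2" using g(2)[of 0] T by simp
  then have "cmod (exp (g 0)) = 2" by simp
  then have "exp (Re (g 0)) = 2" by (simp only: norm_exp_eq_Re)
  then have c0: "cis (Im (g 0)) = 1" using e0 by (simp add: exp_eq_polar)
  have polar: "f t = (1 + \<gamma> t$1$1) * cis (\<theta> t)" if t: "t \<in> {0..T}" for t
  proof -
    have "f t = cmod (f t) * cis (Im (g t))" unfolding g(2)[OF t] by (simp add: exp_eq_polar norm_mult)
    also have "cis (Im (g t)) = cis (\<theta> t) * cis (Im (g 0))" by (simp add: cis_mult \<theta>_def)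
    finally show ?thesis by (simp add: c0 fn[OF t])
  qed
  have "profile S 0 T (\<lambda>t. (\<gamma> t$1$1 - 1) / 2) \<theta> (speed \<gamma>)"
    unfolding profile_def
  proof (intro conjI ballI)
    show "continuous_on {0..T} (\<lambda>t. (\<gamma> t$1$1 - 1) / 2)"
      by (intro continuous_intros S(2)) simp
    show "continuous_on {0..T} \<theta>" unfolding \<theta>_def by (intro continuous_intros g(1))
    show "0 \<le> (\<gamma> t$1$1 - 1) / 2" if "t \<in> {0..T}" for t using fn[OF that] by simp
    fix t assume t: "t \<in> {0<..<T} - S"
    then have t': "t \<in> {0..T}" and tS: "t \<in> {0..T} - S" by auto
    obtain u1 u2 where d: "(\<gamma> has_vector_derivative \<gamma> t ** hor u1 u2) (at t)"
      and v: "speed \<gamma> t = sqrt (u1\<^sup>2 + u2\<^sup>2)" using bspec[OF D tS] by blast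
    show "0 \<le> speed \<gamma> t" unfolding v by simp
    define u where "u = Complex u1 u2"
    define z where "z = zc (\<gamma> t)"
    define Y where "Y = cnj u * z * cnj (f t)"
    define N where "N = cmod (f t)"
    have N: "N > 0" "N = 1 + \<gamma> t$1$1" using fn[OF t'] by (auto simp: N_def)
    have fd: "(f has_vector_derivative cnj u * z) (at t)"
      using bounded_linear.has_vector_derivative[OF linear_wc d] by (simp add: f_def[abs_def] wc_hor u_def z_def)
    have gc: "isCont g t"
      using t by (intro continuous_on_interior[OF g(1)]) auto
    have "(g has_vector_derivative cnj u * z / f t) (at t)"
      by (rule continuous_log_deriv[OF gc fd, where U = "{0<..<T}"]) (use g t in auto)
    from bounded_linear.has_vector_derivative[OF bounded_linear_Im this]
    have "(\<theta> has_real_derivative Im (cnj u * z / f t)) (at t)"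
      unfolding \<theta>_def has_real_derivative_iff_has_vector_derivative
      by (auto intro!: derivative_eq_intros)
    moreover have "Im (cnj u * z / f t) = Im Y / N\<^sup>2"
    proof -
      have "cnj u * z / f t = Y / (f t * cnj (f t))" using N by (simp add: Y_def N_def)
      also have "f t * cnj (f t) = of_real (N\<^sup>2)" unfolding N_def by (rule complex_norm_square[symmetric])
      finally show ?thesis by (simp only: Im_divide_of_real)
    qed
    ultimately have d2: "(\<theta> has_real_derivative Im Y / N\<^sup>2) (at t)" by simp
    have "((\<lambda>t. \<gamma> t$1$1) has_real_derivative (\<gamma> t ** hor u1 u2)$1$1) (at t)"
      using bounded_linear.has_vector_derivative[OF linear_entry d]
      by (simp add: has_real_derivative_iff_has_vector_derivative)
    moreover have "(\<gamma> t ** hor u1 u2)$1$1 = Re Y / N"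
    proof -
      have "Y = cnj u * (of_real N * Complex (\<gamma> t$1$2) (\<gamma> t$1$3))"
        unfolding Y_def N(2) first_row[OF S(3)[OF t']] by (simp add: z_def f_def mult_ac)
      then have "Re Y = N * (u1 * \<gamma> t$1$2 + u2 * \<gamma> t$1$3)"
        by (simp add: u_def algebra_simps)
      then show ?thesis using N(1) by (simp add: mult_entry hor_entry mult_ac)
    qed
    ultimately have d1: "((\<lambda>t. (\<gamma> t$1$1 - 1) / 2) has_real_derivative Re Y / (2 * N)) (at t)"
      by (auto intro!: derivative_eq_intros)
    have "(cmod Y)\<^sup>2 = (u1\<^sup>2 + u2\<^sup>2) * ((\<gamma> t$1$1)\<^sup>2 - 1) * N\<^sup>2"
    proof -
      have "(cmod u)\<^sup>2 = u1\<^sup>2 + u2\<^sup>2" by (simp add: u_def cmod_power2)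
      moreover have "(cmod z)\<^sup>2 = (\<gamma> t$1$1)\<^sup>2 - 1" unfolding z_def by (rule cmod_zc[OF S(3)[OF t']])
      ultimately show ?thesis
        unfolding Y_def norm_mult power_mult_distrib complex_mod_cnj N_def by simp
    qed
    then have 3: "(Re Y)\<^sup>2 + (Im Y)\<^sup>2 = (u1\<^sup>2 + u2\<^sup>2) * ((\<gamma> t$1$1)\<^sup>2 - 1) * N\<^sup>2"
      by (simp add: cmod_power2)
    have "(Re Y / (2 * N))\<^sup>2 + ((1 + (\<gamma> t$1$1 - 1) / 2) * (Im Y / N\<^sup>2))\<^sup>2 = ((Re Y)\<^sup>2 + (Im Y)\<^sup>2) / (4 * N\<^sup>2)"
    proof -
      have 1: "1 + (\<gamma> t$1$1 - 1) / 2 = N / 2" unfolding N(2) by (simp add: field_simps)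
      have 2: "N / 2 * (Im Y / N\<^sup>2) = Im Y / (2 * N)" using N(1) by (simp add: power2_eq_square)
      show ?thesis unfolding 1 2 by (simp add: power_divide power_mult_distrib add_divide_distrib)
    qed
    also have "\<dots> = (speed \<gamma> t)\<^sup>2 * ((\<gamma> t$1$1 - 1) / 2 * (1 + (\<gamma> t$1$1 - 1) / 2))"
      unfolding 3 v using N(1) by (simp add: field_simps power2_eq_square)
    finally show "\<exists>m' \<theta>'. ((\<lambda>t. (\<gamma> t$1$1 - 1) / 2) has_real_derivative m') (at t) \<and>
       (\<theta> has_real_derivative \<theta>') (at t) \<and>
       m'\<^sup>2 + ((1 + (\<gamma> t$1$1 - 1) / 2) * \<theta>')\<^sup>2 = (speed \<gamma> t)\<^sup>2 * ((\<gamma> t$1$1 - 1) / 2 * (1 + (\<gamma> t$1$1 - 1) / 2))"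
      using d1 d2 by blast
  qed (rule S(1) S4)+
  then show ?thesis using that[of S \<theta>] polar by (simp add: \<theta>_def f_def)
qed

section \<open>Geodesics\<close>

definition gen :: "real \<Rightarrow> real \<Rightarrow> real \<Rightarrow> mat3" where
  "gen u1 u2 B = hor u1 u2 - B *\<^sub>R mat_c"

definition rot :: "real \<Rightarrow> mat3" where
  "rot \<tau> = vector [vector [1, 0, 0], vector [0, cos \<tau>, - sin \<tau>], vector [0, sin \<tau>, cos \<tau>]]"

text \<open>If A^3 = - \<kappa> A, then exp A is of this form with p = sin (sqrt \<kappa>) / sqrt
  \<kappa> and r = (1 - cos (sqrt \<kappa>)) / \<kappa>. Half-angle formulas with \<kappa> = 4 q
  give the coefficients in \<open>gexp\<close>.\<close>

definition pexp :: "real \<Rightarrow> real \<Rightarrow> mat3 \<Rightarrow> mat3" where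
  "pexp p r A = mat 1 + p *\<^sub>R A + r *\<^sub>R (A ** A)"

text \<open>\<open>gexp u1 u2 B\<close> is \<open>exp (u1 a + u2 b - B c) exp (B c)\<close>; as \<open>A = u1 a + u2 b - B c\<close> satisfies
  \<open>A ** A ** A = - 4 q A\<close>, its exponential is a quadratic polynomial in \<open>A\<close>.\<close>

definition gexp :: "real \<Rightarrow> real \<Rightarrow> real \<Rightarrow> mat3" where
  "gexp u1 u2 B = (let q = (B\<^sup>2 - u1\<^sup>2 - u2\<^sup>2) / 4
     in pexp (cosq q * sinq q) ((sinq q)\<^sup>2 / 2) (gen u1 u2 B) ** rot B)"

lemma gen_entry: "gen u1 u2 B = vector [vector [0, u1, u2], vector [u1, 0, B], vector [u2, -B, 0]]"
  by (simp add: gen_def hor_entry mat3_simps)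

lemma gen_cube: "gen u1 u2 B ** (gen u1 u2 B ** gen u1 u2 B) = - (B\<^sup>2 - u1\<^sup>2 - u2\<^sup>2) *\<^sub>R gen u1 u2 B"
  by (simp add: gen_entry mat3_eq_iff mult_entry power2_eq_square algebra_simps)

lemma rot_in_SO21: "rot \<tau> \<in> SO21"
proof -
  have "sin \<tau> * sin \<tau> + cos \<tau> * cos \<tau> = 1" using sin_cos_squared_add[of \<tau>] by (simp add: power2_eq_square)
  then show ?thesis
    unfolding SO21_iff linv_def det_3 by (simp add: rot_def mat3_simps algebra_simps)
qed

text \<open>The condition \<open>pr\<close> is cos^2 + sin^2 = 1 in disguise. It makes
  \<open>pexp (- p) r\<close> inverse to \<open>pexp p r\<close>, and this inverse is
  \<open>linv\<close> because \<open>linv\<close> changes the sign of the generator.\<close>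

lemma pexp_in_SO21:
  assumes pr: "p\<^sup>2 = 2 * r - k * r\<^sup>2" and k: "k = B\<^sup>2 - u1\<^sup>2 - u2\<^sup>2" and r: "r \<ge> 0"
  shows "pexp p r (gen u1 u2 B) \<in> SO21"
  unfolding SO21_iff
proof (intro conjI)
  define A where "A = gen u1 u2 B"
  define A2 where "A2 = A ** A"
  have c: "A ** A2 = - k *\<^sub>R A" unfolding A_def A2_def k by (rule gen_cube)
  have c': "A2 ** A = - k *\<^sub>R A" "A2 ** A2 = - k *\<^sub>R A2"
  proof -
    show "A2 ** A = - k *\<^sub>R A" using c by (simp add: A2_def matrix_mul_assoc)
    then have "A2 ** A ** A = (- k *\<^sub>R A) ** A" by simp
    then show "A2 ** A2 = - k *\<^sub>R A2" by (simp only: A2_def matmul_linear matrix_mul_assoc)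
  qed
  have AA: "A ** A = A2" by (simp add: A2_def)
  have l: "linv (pexp p r A) = pexp (- p) r A"
    unfolding linv_def pexp_def A_def gen_entry by (simp add: mat3_simps)
  have "pexp p r A ** pexp (- p) r A = mat 1 + (2 * r - p\<^sup>2 - k * r\<^sup>2) *\<^sub>R A2"
    unfolding pexp_def AA matmul_linear matrix_mul_lid matrix_mul_rid AA c c'
    by (simp add: mat3_eq_iff power2_eq_square algebra_simps)
  then show "pexp p r (gen u1 u2 B) ** linv (pexp p r (gen u1 u2 B)) = mat 1"
    using l pr by (simp add: A_def)
  have "det (pexp p r A) = (1 - k * r)\<^sup>2 + k * p\<^sup>2"
    unfolding pexp_def A_def gen_entry det_3 k by (simp add: mat3_simps power2_eq_square algebra_simps)
  also have "\<dots> = 1" unfolding pr by (simp add: power2_eq_square algebra_simps)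
  finally show "det (pexp p r (gen u1 u2 B)) = 1" by (simp add: A_def)
  have "r * (u1 * u1 + u2 * u2) \<ge> 0" using r by simp
  then show "pexp p r (gen u1 u2 B)$1$1 \<ge> 1"
    unfolding pexp_def gen_entry by (simp add: mat3_simps)
qed

lemma gexp_in_SO21: "gexp u1 u2 B \<in> SO21"
proof -
  define q where "q = (B\<^sup>2 - u1\<^sup>2 - u2\<^sup>2) / 4"
  have "(cosq q * sinq q)\<^sup>2 = 2 * ((sinq q)\<^sup>2 / 2) - (4 * q) * ((sinq q)\<^sup>2 / 2)\<^sup>2"
  proof -
    define x where "x = (sinq q)\<^sup>2"
    have C: "(cosq q)\<^sup>2 = 1 - q * x" using cosq_sinq[of q] by (simp add: x_def)
    show ?thesis unfolding power_mult_distrib C x_def[symmetric]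
      by (simp add: power2_eq_square algebra_simps)
  qed
  then show ?thesis unfolding gexp_def Let_def q_def[symmetric]
    by (intro SO21_mult rot_in_SO21 pexp_in_SO21) (auto simp: q_def)
qed

lemma zc_mult_rot: "zc (C ** rot \<tau>) = zc C" and wc_mult_rot: "wc (C ** rot \<tau>) = wc C * cis \<tau>"
  by (simp_all add: zc_def wc_def rot_def mult_entry complex_eq_iff algebra_simps)

lemma zc_gexp:
  assumes "q = (B\<^sup>2 - u1\<^sup>2 - u2\<^sup>2) / 4"
  shows "zc (gexp u1 u2 B) = Complex u1 u2 * Complex (cosq q * sinq q) (- B * (sinq q)\<^sup>2 / 2)"
  unfolding gexp_def Let_def assms[symmetric] zc_mult_rot unfolding pexp_def gen_entry zc_def
  by (simp add: mat3_simps complex_eq_iff algebra_simps)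

text \<open>By the doubling formulas the exponential contributes the square of a complex number,
  whose argument is therefore twice an elementary angle. This is the origin of the factor 2 in
  \<open>Theta\<close>.\<close>

lemma wc_gexp:
  assumes "q = (B\<^sup>2 - u1\<^sup>2 - u2\<^sup>2) / 4"
  shows "wc (gexp u1 u2 B) = 2 * (Complex (cosq q) (- B * sinq q / 2))\<^sup>2 * cis B"
proof -
  define C S where "C = cosq q" and "S = sinq q"
  have u: "u1\<^sup>2 + u2\<^sup>2 = B\<^sup>2 - 4 * q" using assms by simp
  have "wc (pexp (C * S) (S\<^sup>2 / 2) (gen u1 u2 B)) = Complex (2 + S\<^sup>2 / 2 * ((u1\<^sup>2 + u2\<^sup>2) - 2 * B\<^sup>2)) (- 2 * B * (C * S))"
    unfolding pexp_def gen_entry wc_def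
    by (simp add: mat3_simps power2_eq_square field_simps)
  moreover have "2 + S\<^sup>2 / 2 * ((u1\<^sup>2 + u2\<^sup>2) - 2 * B\<^sup>2) = 2 * (C\<^sup>2 - (B * S / 2)\<^sup>2)"
  proof -
    have "C\<^sup>2 = 1 - q * S\<^sup>2" using cosq_sinq[of q] by (simp add: C_def S_def)
    then show ?thesis unfolding u by (simp add: power2_eq_square algebra_simps)
  qed
  ultimately have "wc (pexp (C * S) (S\<^sup>2 / 2) (gen u1 u2 B)) = 2 * (Complex C (- B * S / 2))\<^sup>2"
    by (simp add: complex_eq_iff power2_eq_square algebra_simps)
  then show ?thesis
    unfolding gexp_def Let_def assms[symmetric] wc_mult_rot by (simp add: C_def S_def)
qed

lemma has_vector_derivative_rot:
  "((\<lambda>t. rot (t * B)) has_vector_derivative rot (t * B) ** (B *\<^sub>R mat_c)) (at t)"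
  unfolding has_vector_derivative_def
proof (rule has_derivative_mat3)
  fix i j :: 3
  show "((\<lambda>t. rot (t * B)$i$j) has_derivative (\<lambda>h. (h *\<^sub>R (rot (t * B) ** (B *\<^sub>R mat_c)))$i$j)) (at t)"
    using exhaust_3[of i] exhaust_3[of j]
    by (elim disjE) (auto simp: rot_def mat_c_def mult_entry intro!: derivative_eq_intros)
qed

lemma gexp_ray:
  assumes "k = B\<^sup>2 - u1\<^sup>2 - u2\<^sup>2"
  shows "gexp (t * u1) (t * u2) (t * B) = pexp (2 * sn k t * cs k t) (2 * (sn k t)\<^sup>2) (gen u1 u2 B) ** rot (t * B)"
proof -
  have q: "((t * B)\<^sup>2 - (t * u1)\<^sup>2 - (t * u2)\<^sup>2) / 4 = k * t\<^sup>2 / 4"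
    by (simp add: assms power_mult_distrib algebra_simps)
  have g: "gen (t * u1) (t * u2) (t * B) = t *\<^sub>R gen u1 u2 B"
    by (simp add: gen_entry mat3_eq_iff)
  show ?thesis
    unfolding gexp_def Let_def q g
    by (simp add: pexp_def matmul_linear sn_def cs_def power_mult_distrib power_divide power2_eq_square mult_ac)
qed

text \<open>\<open>E\<close> is the one-parameter group generated by \<open>A\<close>.
  Multiplication by rot (t B) cancels the \<open>mat_c\<close> component of the velocity and leaves
  the control (u1, u2) rotated by the angle - t B, which is horizontal.\<close>

lemma gexp_deriv:
  "((\<lambda>t. gexp (t * u1) (t * u2) (t * B)) has_vector_derivative gexp (t * u1) (t * u2) (t * B) **
      hor (u1 * cos (t * B) + u2 * sin (t * B)) (u2 * cos (t * B) - u1 * sin (t * B))) (at t)"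
proof -
  define k where "k = B\<^sup>2 - u1\<^sup>2 - u2\<^sup>2"
  define A where "A = gen u1 u2 B"
  define E where "E t = pexp (2 * sn k t * cs k t) (2 * (sn k t)\<^sup>2) A" for t
  have eq: "gexp (t * u1) (t * u2) (t * B) = E t ** rot (t * B)" for t
    unfolding E_def A_def by (rule gexp_ray[OF k_def])
  have d1: "((\<lambda>t. 2 * sn k t * cs k t) has_real_derivative 1 - 2 * k * (sn k t)\<^sup>2) (at t)"
  proof (rule DERIV_cong[OF DERIV_mult[OF DERIV_cmult[OF DERIV_sn] DERIV_cs]])
    have "(cs k t)\<^sup>2 = 1 - k * (sn k t)\<^sup>2" using cs_sn[of k t] by simp
    then show "2 * (cs k t / 2) * cs k t + - k * sn k t / 2 * (2 * sn k t) = 1 - 2 * k * (sn k t)\<^sup>2"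
      by (simp add: power2_eq_square algebra_simps)
  qed
  have d2: "((\<lambda>t. 2 * (sn k t)\<^sup>2) has_real_derivative 2 * sn k t * cs k t) (at t)"
    by (rule DERIV_cong[OF DERIV_cmult[OF DERIV_power[OF DERIV_sn, where n = 2]]]) simp
  have "(E has_vector_derivative (1 - 2 * k * (sn k t)\<^sup>2) *\<^sub>R A + (2 * sn k t * cs k t) *\<^sub>R (A ** A)) (at t)"
    using has_vector_derivative_add[OF has_vector_derivative_add[OF has_vector_derivative_const
          has_vector_derivative_scaleR[OF d1 has_vector_derivative_const]]
        has_vector_derivative_scaleR[OF d2 has_vector_derivative_const], of "mat 1" A "A ** A"]
    unfolding E_def pexp_def by simp
  moreover have "A ** (A ** A) = - k *\<^sub>R A" unfolding A_def k_def by (rule gen_cube)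
  then have "(1 - 2 * k * (sn k t)\<^sup>2) *\<^sub>R A + (2 * sn k t * cs k t) *\<^sub>R (A ** A) = E t ** A"
    unfolding E_def pexp_def by (simp add: matmul_linear matrix_mul_assoc[symmetric] algebra_simps)
  ultimately have dE: "(E has_vector_derivative E t ** A) (at t)" by simp
  have "((\<lambda>t. E t ** rot (t * B)) has_vector_derivative
      E t ** (rot (t * B) ** (B *\<^sub>R mat_c)) + E t ** A ** rot (t * B)) (at t)"
    by (rule has_vector_derivative_matmul[OF dE has_vector_derivative_rot])
  moreover have "rot (t * B) ** (B *\<^sub>R mat_c) + A ** rot (t * B) =
     rot (t * B) ** hor (u1 * cos (t * B) + u2 * sin (t * B)) (u2 * cos (t * B) - u1 * sin (t * B))"
  proof -
    define c s where "c = cos (t * B)" and "s = sin (t * B)"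
    have "c\<^sup>2 + s\<^sup>2 = 1" by (simp add: c_def s_def)
    moreover have "c * (c * x) + s * (s * x) = (c\<^sup>2 + s\<^sup>2) * x" for x
      by (simp add: power2_eq_square algebra_simps)
    ultimately have cs: "c * (c * x) + s * (s * x) = x" for x by simp
    show ?thesis unfolding rot_def c_def[symmetric] s_def[symmetric] A_def
      by (simp add: gen_entry hor_entry mat_c_def mat3_eq_iff mult_entry algebra_simps) (simp add: cs)
  qed
  then have "E t ** (rot (t * B) ** (B *\<^sub>R mat_c)) + E t ** A ** rot (t * B) =
    E t ** rot (t * B) ** hor (u1 * cos (t * B) + u2 * sin (t * B)) (u2 * cos (t * B) - u1 * sin (t * B))"
    by (metis matmul_linear(1) matrix_mul_assoc)
  ultimately show ?thesis unfolding eq by simp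
qed

section \<open>Unit-speed geodesics from the identity\<close>

definition geo :: "real \<Rightarrow> real \<Rightarrow> real \<Rightarrow> mat3" where
  "geo b \<phi> t = gexp (t * cos \<phi>) (t * sin \<phi>) (t * b)"

lemma geo_in_SO21: "geo b \<phi> t \<in> SO21"
  by (simp add: geo_def gexp_in_SO21)

lemma geo_deriv:
  "(geo b \<phi> has_vector_derivative geo b \<phi> t ** hor (cos (\<phi> - t * b)) (sin (\<phi> - t * b))) (at t)"
  using gexp_deriv[of "cos \<phi>" "sin \<phi>" b t] by (simp add: geo_def[abs_def] cos_diff sin_diff mult_ac)

lemma zc_geo:
  assumes "k = b\<^sup>2 - 1"
  shows "zc (geo b \<phi> t) = 2 * of_real (sn k t) * cis \<phi> * Complex (cs k t) (- b * sn k t)"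
proof -
  have "(t * b)\<^sup>2 - (t * cos \<phi>)\<^sup>2 - (t * sin \<phi>)\<^sup>2 = k * t\<^sup>2"
    using sin_cos_squared_add[of \<phi>] unfolding power_mult_distrib assms
    by (metis (no_types, opaque_lifting) add.commute diff_diff_eq distrib_left left_diff_distrib mult.commute mult.right_neutral)
  then have q: "k * t\<^sup>2 / 4 = ((t * b)\<^sup>2 - (t * cos \<phi>)\<^sup>2 - (t * sin \<phi>)\<^sup>2) / 4" by simp
  show ?thesis
    unfolding geo_def zc_gexp[OF q] by (simp add: sn_def cs_def complex_eq_iff power2_eq_square algebra_simps)
qed

lemma wc_geo:
  assumes "k = b\<^sup>2 - 1"
  shows "wc (geo b \<phi> t) = 2 * (Complex (cs k t) (- b * sn k t))\<^sup>2 * cis (t * b)"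
proof -
  have "(t * b)\<^sup>2 - (t * cos \<phi>)\<^sup>2 - (t * sin \<phi>)\<^sup>2 = k * t\<^sup>2"
    using sin_cos_squared_add[of \<phi>] unfolding power_mult_distrib assms
    by (metis (no_types, opaque_lifting) add.commute diff_diff_eq distrib_left left_diff_distrib mult.commute mult.right_neutral)
  then have q: "k * t\<^sup>2 / 4 = ((t * b)\<^sup>2 - (t * cos \<phi>)\<^sup>2 - (t * sin \<phi>)\<^sup>2) / 4" by simp
  show ?thesis
    unfolding geo_def wc_gexp[OF q] by (simp add: sn_def cs_def mult_ac)
qed

text \<open>The number cs - i e b sn has modulus sqrt (1 + sn^2), and since b sn is nonnegative its
  argument is - e times the arccos in \<open>Theta\<close>. Squaring doubles the argument, and cis
  (t e b) supplies the linear term.\<close>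

lemma wc_geo_polar:
  assumes b: "b \<ge> 0" and e: "e\<^sup>2 = 1" and s: "sn (b\<^sup>2 - 1) t \<ge> 0"
  shows "wc (geo (e * b) \<phi> t) = 2 * (1 + (sn (b\<^sup>2 - 1) t)\<^sup>2) * cis (e * Theta b t)"
proof -
  define S C where "S = sn (b\<^sup>2 - 1) t" and "C = cs (b\<^sup>2 - 1) t"
  define R where "R = sqrt (1 + S\<^sup>2)"
  have R: "R > 0" "R\<^sup>2 = 1 + S\<^sup>2" by (auto simp: R_def)
  define \<Phi> where "\<Phi> = arccos (C / R)"
  have le: "\<bar>C / R\<bar> \<le> 1" using cs_ratio_le[of b t] by (simp add: C_def S_def R_def)
  have C: "C = R * cos \<Phi>" using le R by (simp add: \<Phi>_def cos_arccos_abs)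
  have "R * sin \<Phi> = b * S"
  proof -
    have "(R * sin \<Phi>)\<^sup>2 = R\<^sup>2 - C\<^sup>2" unfolding C power_mult_distrib by (simp add: sin_squared_eq algebra_simps)
    also have "\<dots> = (b * S)\<^sup>2" using cs_square[of b t] by (simp add: R C_def S_def power_mult_distrib)
    finally have "(R * sin \<Phi>)\<^sup>2 = (b * S)\<^sup>2" .
    moreover have "sin \<Phi> \<ge> 0" using le unfolding \<Phi>_def abs_le_iff
      by (intro sin_ge_zero arccos_lbound arccos_ubound) linarith+
    ultimately show ?thesis using R b s by (intro power2_eq_imp_eq[of "R * sin \<Phi>"]) (auto simp: S_def)
  qed
  then have "Complex C (- (e * b) * S) = R * Complex (cos \<Phi>) (- (e * sin \<Phi>))"
    by (simp add: complex_eq_iff C algebra_simps)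
  also have "Complex (cos \<Phi>) (- (e * sin \<Phi>)) = cis (e * - \<Phi>)"
    using e by (auto simp: power2_eq_1_iff complex_eq_iff)
  finally have X: "Complex C (- (e * b) * S) = R * cis (e * - \<Phi>)" .
  have k: "b\<^sup>2 - 1 = (e * b)\<^sup>2 - 1" using e by (simp add: power_mult_distrib)
  have "wc (geo (e * b) \<phi> t) = 2 * (Complex C (- (e * b) * S))\<^sup>2 * cis (t * (e * b))"
    unfolding S_def C_def by (rule wc_geo[OF k])
  also have "\<dots> = 2 * of_real (R\<^sup>2) * (cis (e * - \<Phi>) * cis (e * - \<Phi>) * cis (t * (e * b)))"
    unfolding X by (simp add: power2_eq_square mult_ac)
  also have "cis (e * - \<Phi>) * cis (e * - \<Phi>) * cis (t * (e * b)) = cis (e * Theta b t)"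
    by (simp add: cis_mult Theta_def \<Phi>_def R_def C_def S_def algebra_simps)
  finally show ?thesis by (simp add: R S_def)
qed

section \<open>Shortest arcs\<close>

lemma geo_0 [simp]: "geo b \<phi> 0 = mat 1"
proof (rule SO21_eqI[OF geo_in_SO21 one_in_SO21])
  show "zc (geo b \<phi> 0) = zc (mat 1)" by (simp add: zc_geo[OF refl]) (simp add: zc_def one_entry complex_eq_iff)
  show "wc (geo b \<phi> 0) = wc (mat 1)"
    by (simp add: wc_geo[OF refl] complex_eq_iff power2_eq_square) (simp add: wc_def one_entry)
qed

lemma speed_geo: "speed (geo b \<phi>) t = 1"
  unfolding speed_def vector_derivative_at[OF geo_deriv] sr_norm_hor[OF geo_in_SO21] by simp

lemma continuous_on_geo: "continuous_on S (geo b \<phi>)"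
  by (rule continuous_at_imp_continuous_on) (blast intro: has_vector_derivative_continuous geo_deriv)

lemma horizontal_geo: "horizontal_path T (geo b \<phi>)"
proof -
  have "geo b \<phi> C1_differentiable_on {0..T}"
    unfolding C1_differentiable_on_def
  proof (intro exI conjI ballI)
    show "(geo b \<phi> has_vector_derivative geo b \<phi> t ** hor (cos (\<phi> - t * b)) (sin (\<phi> - t * b))) (at t)" for t
      by (rule geo_deriv)
    show "continuous_on {0..T} (\<lambda>t. geo b \<phi> t ** hor (cos (\<phi> - t * b)) (sin (\<phi> - t * b)))"
      unfolding hor_def
      by (intro bounded_bilinear.continuous_on[OF bounded_bilinear_matmul] continuous_on_geo continuous_intros)
  qed
  then have "geo b \<phi> piecewise_C1_differentiable_on {0..T}"
    by (simp add: C1_differentiable_imp_piecewise)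
  moreover have "vector_derivative (geo b \<phi>) (at t) \<in> distr (geo b \<phi> t)" for t
    unfolding vector_derivative_at[OF geo_deriv] distr_eq by blast
  moreover have "speed (geo b \<phi>) = (\<lambda>_. 1)" using speed_geo by auto
  ultimately show ?thesis
    unfolding horizontal_path_def using geo_in_SO21 by (auto intro!: exI[of _ "{}"] integrable_const_ivl)
qed

lemma length_geo: "0 \<le> T \<Longrightarrow> sr_length T (geo b \<phi>) = T"
proof -
  have "speed (geo b \<phi>) = (\<lambda>_. 1)" using speed_geo by auto
  then show "0 \<le> T \<Longrightarrow> sr_length T (geo b \<phi>) = T" by (simp add: sr_length_def)
qed

text \<open>As cos decreases on [0, pi], the value in this interval is the smallest absolute value
  among all angles with the same direction. Here the bound pi on the holonomy enters.\<close>

lemma abs_angle_ge: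
  assumes "cis x = cis (e * y)" "0 \<le> y" "y \<le> pi" "e\<^sup>2 = 1" shows "y \<le> \<bar>x\<bar>"
proof (rule ccontr)
  assume "\<not> y \<le> \<bar>x\<bar>"
  then have "cos y < cos \<bar>x\<bar>" using assms by (intro cos_monotone_0_pi) auto
  moreover have "cos x = cos (e * y)" using assms(1) by (simp add: complex_eq_iff)
  then have "cos \<bar>x\<bar> = cos y" using assms(4) by (auto simp: power2_eq_1_iff abs_if)
  ultimately show False by simp
qed

lemma entry_of_wc:
  assumes "C \<in> SO21" "wc C = of_real (2 * (1 + s\<^sup>2)) * cis x" shows "(C$1$1 - 1) / 2 = s\<^sup>2"
proof -
  have "cmod (wc C) = \<bar>2 * (1 + s\<^sup>2)\<bar>"
    unfolding assms(2) norm_mult norm_of_real norm_cis by simp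
  then have "cmod (wc C) = 2 * (1 + s\<^sup>2)" by simp
  then show ?thesis unfolding cmod_wc[OF assms(1)] by simp
qed

lemma cis_cancel: "of_real N * cis x = of_real N * cis y \<Longrightarrow> N \<noteq> 0 \<Longrightarrow> cis x = cis y"
  by simp

lemma double_one_plus_square: "2 * (1 + x\<^sup>2) \<noteq> (0::real)"
  unfolding mult_eq_0_iff by simp

lemma sr_length_nonneg: "horizontal_path T \<gamma> \<Longrightarrow> 0 \<le> sr_length T \<gamma>"
proof -
  assume "horizontal_path T \<gamma>"
  then have "0 \<le> integral {0..T} (speed \<gamma>)"
    by (intro integral_nonneg) (auto simp: horizontal_path_def speed_def sr_norm_def sr_inner_def)
  then show ?thesis by (simp add: sr_length_def)
qed

lemma sr_dist_le:
  assumes "0 \<le> T" "horizontal_path T \<gamma>" shows "sr_dist (\<gamma> 0) (\<gamma> T) \<le> sr_length T \<gamma>"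
  unfolding sr_dist_def
  by (rule cInf_lower) (use assms sr_length_nonneg in \<open>auto intro!: bdd_belowI[of _ 0]\<close>)

lemma signed_profile:
  assumes "profile S 0 T m \<theta> v"
  obtains e where "e\<^sup>2 = 1" "profile S 0 T m (\<lambda>t. e * \<theta> t) v" "e * \<theta> T = \<bar>\<theta> T\<bar>"
proof -
  define e :: real where "e = (if \<theta> T \<ge> 0 then 1 else -1)"
  have "e\<^sup>2 = 1" "e * \<theta> T = \<bar>\<theta> T\<bar>" by (auto simp: e_def)
  then show ?thesis using that[of e] profile_uminus[OF assms] by blast
qed

text \<open>The endpoint fixes the final radius and the holonomy modulo 2 pi. After a reflection the
  competitor's holonomy is nonnegative and at least \<open>Theta b t\<close>, and the isoperimetric
  bound applies.\<close>

lemma length_ge_admissible: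
  assumes A: "admissible b t" and e: "e\<^sup>2 = 1" and T: "0 \<le> T" and H: "horizontal_path T \<gamma>"
    and g: "\<gamma> 0 = mat 1" "\<gamma> T = geo (e * b) \<phi> t"
  shows "t \<le> sr_length T \<gamma>"
proof -
  have bt: "0 \<le> b" "0 < t" "(b\<^sup>2 - 1) * t\<^sup>2 \<le> 4 * pi\<^sup>2" "Theta b t \<le> pi" using A by (auto simp: admissible_def)
  obtain S \<theta> where P: "profile S 0 T (\<lambda>t. (\<gamma> t$1$1 - 1) / 2) \<theta> (speed \<gamma>)" and \<theta>0: "\<theta> 0 = 0"
    and w: "\<forall>t\<in>{0..T}. wc (\<gamma> t) = (1 + \<gamma> t$1$1) * cis (\<theta> t)"
    by (rule horizontal_path_profile[OF H T g(1)])
  have wT: "wc (\<gamma> T) = 2 * (1 + (sn (b\<^sup>2 - 1) t)\<^sup>2) * cis (e * Theta b t)"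
    unfolding g(2) by (rule wc_geo_polar[OF bt(1) e]) (use admissible_sn_nonneg[OF A] bt in auto)
  have mT: "(\<gamma> T$1$1 - 1) / 2 = (sn (b\<^sup>2 - 1) t)\<^sup>2"
    by (rule entry_of_wc[OF _ wT]) (simp add: g geo_in_SO21)
  have "1 + \<gamma> T$1$1 = 2 * (1 + (sn (b\<^sup>2 - 1) t)\<^sup>2)" unfolding mT[symmetric] by (simp add: field_simps)
  then have "wc (\<gamma> T) = of_real (2 * (1 + (sn (b\<^sup>2 - 1) t)\<^sup>2)) * cis (\<theta> T)" using bspec[OF w, of T] T by simp
  then have "of_real (2 * (1 + (sn (b\<^sup>2 - 1) t)\<^sup>2)) * cis (\<theta> T) = of_real (2 * (1 + (sn (b\<^sup>2 - 1) t)\<^sup>2)) * cis (e * Theta b t)"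
    unfolding wT by auto
  then have "cis (\<theta> T) = cis (e * Theta b t)"
    by (rule cis_cancel[OF _ double_one_plus_square])
  then have th: "Theta b t \<le> \<bar>\<theta> T\<bar>"
    by (rule abs_angle_ge) (use Theta_nonneg bt e in auto)
  obtain e' where e': "e'\<^sup>2 = 1" "profile S 0 T (\<lambda>t. (\<gamma> t$1$1 - 1) / 2) (\<lambda>t. e' * \<theta> t) (speed \<gamma>)"
    "e' * \<theta> T = \<bar>\<theta> T\<bar>" by (rule signed_profile[OF P])
  show ?thesis unfolding sr_length_def
    by (rule profile_lower_bound[OF e'(2) T _ _ A mT]) (use th e'(3) in \<open>auto simp: g one_entry \<theta>0\<close>)
qed

lemma sr_dist_geo:
  assumes A: "admissible b t" and e: "e\<^sup>2 = 1"
  shows "sr_dist (mat 1) (geo (e * b) \<phi> t) = t"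
  unfolding sr_dist_def
proof (rule cInf_eq_minimum)
  have "0 \<le> t" using A by (simp add: admissible_def)
  then show "t \<in> {sr_length T \<gamma> |T \<gamma>. 0 \<le> T \<and> horizontal_path T \<gamma> \<and> \<gamma> 0 = mat 1 \<and> \<gamma> T = geo (e * b) \<phi> t}"
    by (auto intro!: exI[of _ t] exI[of _ "geo (e * b) \<phi>"] simp: length_geo horizontal_geo)
qed (use length_ge_admissible[OF A e] in auto)

lemma shortest_geo:
  assumes A: "admissible b t" and e: "e\<^sup>2 = 1"
  shows "shortest_arc t (geo (e * b) \<phi>)"
  unfolding shortest_arc_def using sr_dist_geo[OF assms] A
  by (auto simp: horizontal_geo speed_geo length_geo admissible_def)

text \<open>The radius and the absolute value of the argument of \<open>wc\<close> prescribe chord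
  and holonomy of an arc, and the sign of the argument its orientation. The direction \<phi> rotates
  \<open>zc\<close> without touching \<open>wc\<close> and is adjusted last.\<close>

lemma admissible_reach:
  assumes C: "C \<in> SO21" "C \<noteq> mat 1"
  obtains b t e \<phi> where "admissible b t" "e\<^sup>2 = 1" "C = geo (e * b) \<phi> t"
proof -
  define s where "s = sqrt ((C$1$1 - 1) / 2)"
  have c1: "C$1$1 \<ge> 1" using C by (simp add: SO21_iff)
  have s: "s \<ge> 0" "s\<^sup>2 = (C$1$1 - 1) / 2" using c1 by (auto simp: s_def)
  have w1: "cmod (wc C) = 2 * (1 + s\<^sup>2)" unfolding cmod_wc[OF C(1)] s by (simp add: field_simps)
  define h where "h = \<bar>Arg (wc C)\<bar>"
  define e :: real where "e = (if Arg (wc C) \<ge> 0 then 1 else -1)"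
  have h: "0 \<le> h" "h \<le> pi" "e\<^sup>2 = 1" "e * h = Arg (wc C)"
    using Arg_bounded[of "wc C"] by (auto simp: h_def e_def)
  have w: "wc C = 2 * (1 + s\<^sup>2) * cis (e * h)"
  proof -
    have "wc C \<noteq> 0" using w1 one_plus_square_pos[of s] by (metis norm_zero mult_eq_0_iff zero_neq_numeral)
    then have "wc C = of_real (cmod (wc C)) * cis (e * h)"
      unfolding h(4) by (simp add: cis_Arg sgn_div_norm scaleR_conv_of_real)
    then show ?thesis unfolding w1 by simp
  qed
  obtain b t where A: "admissible b t" and sn: "sn (b\<^sup>2 - 1) t = s" and Th: "Theta b t = h"
  proof (cases "s = 0")
    case False
    then have "s > 0" using s by simp
    then show ?thesis by (rule admissible_exists_pos[OF _ h(1,2)]) (rule that)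
  next
    case True
    have "h \<noteq> 0"
    proof
      assume "h = 0"
      then have "wc C = wc (mat 1)" unfolding w True by (simp add: wc_def one_entry complex_eq_iff)
      moreover have "(cmod (zc C))\<^sup>2 = 0" unfolding cmod_zc[OF C(1)] using s True by simp
      then have "zc C = zc (mat 1)" by (simp add: zc_def one_entry complex_eq_iff)
      ultimately show False using SO21_eqI[OF C(1) one_in_SO21] C(2) by simp
    qed
    then have "h > 0" using h by simp
    then show ?thesis by (rule admissible_exists_0[OF _ h(2)]) (rule that, simp_all add: True)
  qed
  have b: "b \<ge> 0" using A by (simp add: admissible_def)
  have wg: "wc (geo (e * b) \<phi> t) = wc C" for \<phi>
    unfolding w sn[symmetric] Th[symmetric] by (rule wc_geo_polar[OF b h(3)]) (simp add: sn s)
  define z0 where "z0 = zc (geo (e * b) 0 t)"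
  have zphi: "zc (geo (e * b) \<phi> t) = cis \<phi> * z0" for \<phi>
    unfolding z0_def by (simp add: zc_geo[OF refl])
  have "geo (e * b) 0 t$1$1 = C$1$1"
    using cmod_wc[OF C(1)] cmod_wc[OF geo_in_SO21, of "e * b" 0 t] wg[of 0] by simp
  then have "(cmod z0)\<^sup>2 = (cmod (zc C))\<^sup>2"
    unfolding z0_def cmod_zc[OF geo_in_SO21] cmod_zc[OF C(1)] by simp
  then have zz: "cmod z0 = cmod (zc C)" by (simp add: power2_eq_iff_nonneg)
  obtain \<phi> where "zc C = cis \<phi> * z0"
  proof (cases "z0 = 0")
    case True
    then show ?thesis using zz that[of 0] by simp
  next
    case False
    then have "zc C / z0 \<noteq> 0" using zz by auto
    then have "cis (Arg (zc C / z0)) = sgn (zc C / z0)" by (rule cis_Arg)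
    also have "\<dots> = zc C / z0" using zz False by (simp add: sgn_div_norm norm_divide)
    finally show ?thesis using False that[of "Arg (zc C / z0)"] by simp
  qed
  then have "C = geo (e * b) \<phi> t" by (intro SO21_eqI[OF C(1) geo_in_SO21]) (simp_all add: zphi wg)
  then show ?thesis using that A h(3) by blast
qed

lemma sr_dist_self: "x \<in> SO21 \<Longrightarrow> sr_dist x x = 0"
proof -
  assume x: "x \<in> SO21"
  have H: "horizontal_path 0 (\<lambda>_. x)"
    unfolding horizontal_path_def piecewise_C1_differentiable_on_def
    using x integrable_on_refl[of "speed (\<lambda>_. x)" "0::real"] by (auto intro!: exI[of _ "{0}"])
  have "0 \<le> sr_dist x x"
    unfolding sr_dist_def
  proof (rule cInf_greatest)
    show "{sr_length T \<gamma> |T \<gamma>. 0 \<le> T \<and> horizontal_path T \<gamma> \<and> \<gamma> 0 = x \<and> \<gamma> T = x} \<noteq> {}"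
      using H by blast
  qed (use sr_length_nonneg in auto)
  moreover have "sr_dist x x \<le> 0"
    using sr_dist_le[OF _ H] by (simp add: sr_length_def)
  ultimately show ?thesis by simp
qed

text \<open>By \<open>zc_hor'\<close> both curves have the same logarithmic derivative, so the
  quotient is constant on the open interval, where the denominator has no zero. The ends, where it
  may vanish, follow by continuity.\<close>

lemma proportional_zc:
  assumes H: "horizontal_path T \<gamma>" and A: "admissible b T" and k: "k = c\<^sup>2 - 1" "c\<^sup>2 = b\<^sup>2"
    and w: "\<And>t. t \<in> {0..T} \<Longrightarrow> wc (\<gamma> t) = wc (geo c 0 t)"
  obtains \<kappa> where "\<And>t. t \<in> {0..T} \<Longrightarrow> zc (\<gamma> t) = \<kappa> * zc (geo c 0 t)"
proof -
  have T: "0 < T" using A by (simp add: admissible_def)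
  obtain S where S: "finite S" "continuous_on {0..T} \<gamma>" and S3: "\<forall>t\<in>{0..T}. \<gamma> t \<in> SO21"
    and "speed \<gamma> integrable_on {0..T}" and
    D: "\<forall>t\<in>{0..T} - S. \<exists>u1 u2. (\<gamma> has_vector_derivative \<gamma> t ** hor u1 u2) (at t) \<and>
        speed \<gamma> t = sqrt (u1\<^sup>2 + u2\<^sup>2)" by (rule horizontal_pathE[OF H])
  note S = S bspec[OF S3]
  define z where "z t = zc (\<gamma> t)" for t
  define y where "y t = zc (geo c 0 t)" for t
  have zy: "cmod (z t) = cmod (y t)" if t: "t \<in> {0..T}" for t
  proof -
    have "\<gamma> t$1$1 = geo c 0 t$1$1"
      using cmod_wc[OF S(3)[OF t]] cmod_wc[OF geo_in_SO21, of c 0 t] w[OF t] by simp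
    then have "(cmod (z t))\<^sup>2 = (cmod (y t))\<^sup>2"
      unfolding z_def y_def cmod_zc[OF geo_in_SO21] cmod_zc[OF S(3)[OF t]] by simp
    then show ?thesis by (simp add: power2_eq_iff_nonneg)
  qed
  have ynz: "y t \<noteq> 0" if t: "0 < t" "t < T" for t
  proof -
    have s: "sn k t > 0" using admissible_sn_pos[OF A t] k by simp
    have "(cs k t)\<^sup>2 + (c * sn k t)\<^sup>2 = 1 + (sn k t)\<^sup>2"
      using cs_sn[of k t] unfolding k(1) by (simp add: power_mult_distrib algebra_simps)
    then have "Complex (cs k t) (- c * sn k t) \<noteq> 0"
      using one_plus_square_pos(2)[of "sn k t"] by (auto simp: complex_eq_iff)
    then show ?thesis unfolding y_def zc_geo[OF k(1)] using s by simp
  qed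
  have contz: "continuous_on {0..T} z" "continuous_on {0..T} y" unfolding z_def y_def
    by (intro bounded_linear.continuous_on[OF linear_zc] S(2) continuous_on_geo)+
  define F where "F t = z t / y t" for t
  have F0: "(F has_vector_derivative 0) (at t)" if t: "t \<in> {0<..<T} - S" for t
  proof -
    have t': "t \<in> {0..T}" and tS: "t \<in> {0..T} - S" using t by auto
    obtain u1 u2 where d: "(\<gamma> has_vector_derivative \<gamma> t ** hor u1 u2) (at t)" using bspec[OF D tS] by blast
    define v1 v2 where "v1 = cos (0 - t * c)" "v2 = sin (0 - t * c)"
    note dg = geo_deriv[of c 0 t, folded v1_v2_def]
    have wd: "wc (\<gamma> t ** hor u1 u2) = wc (geo c 0 t ** hor v1 v2)"
    proof -
      have "((\<lambda>t. wc (\<gamma> t)) has_vector_derivative wc (\<gamma> t ** hor u1 u2)) (at t)"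
        by (rule bounded_linear.has_vector_derivative[OF linear_wc d])
      then have "((\<lambda>t. wc (geo c 0 t)) has_vector_derivative wc (\<gamma> t ** hor u1 u2)) (at t)"
        by (rule has_vector_derivative_transform_within_open[of _ _ _ "{0<..<T}"]) (use t w in auto)
      moreover have "((\<lambda>t. wc (geo c 0 t)) has_vector_derivative wc (geo c 0 t ** hor v1 v2)) (at t)"
        by (rule bounded_linear.has_vector_derivative[OF linear_wc dg])
      ultimately show ?thesis by (rule vector_derivative_unique_at)
    qed
    define z' where "z' = zc (\<gamma> t ** hor u1 u2)"
    define y' where "y' = zc (geo c 0 t ** hor v1 v2)"
    have dz: "(z has_vector_derivative z') (at t)" "(y has_vector_derivative y') (at t)"
      unfolding z_def y_def z'_def y'_def
      by (rule bounded_linear.has_vector_derivative[OF linear_zc d] bounded_linear.has_vector_derivative[OF linear_zc dg])+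
    have yn: "y t \<noteq> 0" using ynz t by auto
    then have zn: "z t \<noteq> 0" using zy[OF t'] by auto
    have "z' / z t = y' / y t"
      unfolding z'_def y'_def z_def y_def
        zc_hor'[OF S(3)[OF t'] zn[unfolded z_def] refl] zc_hor'[OF geo_in_SO21 yn[unfolded y_def] refl]
      unfolding wd w[OF t'] zy[OF t', unfolded z_def y_def] ..
    then have q: "z' * y t - z t * y' = 0" using yn zn by (simp add: field_simps)
    have "((inverse \<circ> y) has_vector_derivative y' * - (inverse (y t) ^ Suc (Suc 0))) (at t)"
      by (rule field_vector_diff_chain_at[OF dz(2) DERIV_inverse[OF yn]])
    then have "((\<lambda>t. inverse (y t)) has_vector_derivative y' * - (inverse (y t))\<^sup>2) (at t)"
      by (simp add: o_def power2_eq_square)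
    from has_vector_derivative_mult[OF dz(1) this]
    have "((\<lambda>t. z t * inverse (y t)) has_vector_derivative
        z t * (y' * - (inverse (y t))\<^sup>2) + z' * inverse (y t)) (at t)" .
    moreover have "z t * (y' * - (inverse (y t))\<^sup>2) + z' * inverse (y t) = (z' * y t - z t * y') * (inverse (y t))\<^sup>2"
      using yn by (simp add: field_simps power2_eq_square)
    ultimately show ?thesis unfolding F_def[abs_def] divide_inverse q by simp
  qed
  define \<kappa> where "\<kappa> = F (T / 2)"
  have const: "F t = \<kappa>" if t: "0 < t" "t < T" for t
  proof -
    have c: "continuous_on {x..x'} F" if "0 < x" "x' < T" for x x'
      unfolding F_def by (intro continuous_intros continuous_on_subset[OF contz(1)] continuous_on_subset[OF contz(2)])
        (use that ynz in auto)
    show ?thesis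
    proof (cases "t \<le> T / 2")
      case True
      have "F (T / 2) = F t"
        by (rule constant_if_deriv_0[OF S(1) True c]) (use t F0 in auto)
      then show ?thesis by (simp add: \<kappa>_def)
    next
      case False
      then have "T / 2 \<le> t" by simp
      then show ?thesis unfolding \<kappa>_def
        by (rule constant_if_deriv_0[OF S(1) _ c]) (use t T F0 in auto)
    qed
  qed
  have "z t - \<kappa> * y t = 0" if t: "t \<in> {0..T}" for t
  proof (rule continuous_constant_on_closure[of "{0<..<T}" "\<lambda>t. z t - \<kappa> * y t"])
    have cl: "closure {0<..<T} = {0..T}" using T by simp
    show "continuous_on (closure {0<..<T}) (\<lambda>t. z t - \<kappa> * y t)"
      unfolding cl by (intro continuous_intros contz)
    show "t \<in> closure {0<..<T}" unfolding cl by (rule t)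
    fix x assume "x \<in> {0<..<T}"
    then show "z x - \<kappa> * y x = 0" using const[of x] ynz[of x] by (auto simp: F_def)
  qed
  then show ?thesis using that[of \<kappa>] by (simp add: z_def y_def)
qed

text \<open>Some admissible geodesic reaches the same end, and its length must also be
  \<open>T\<close>. The given arc thus attains the isoperimetric bound, which determines its radius
  and holonomy at all times; only a rotation of the plane remains free.\<close>

theorem shortest_arc_is_geo:
  assumes sh: "shortest_arc T \<gamma>" and g0: "\<gamma> 0 = mat 1"
  obtains b e \<phi> where "admissible b T" "e\<^sup>2 = 1" "\<And>t. t \<in> {0..T} \<Longrightarrow> \<gamma> t = geo (e * b) \<phi> t"
proof -
  have T: "0 < T" and H: "horizontal_path T \<gamma>" and L: "sr_length T \<gamma> = sr_dist (\<gamma> 0) (\<gamma> T)"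
    using sh by (auto simp: shortest_arc_def)
  obtain S1 where S1: "finite S1" "\<And>t. t \<in> {0..T} - S1 \<Longrightarrow> speed \<gamma> t = 1"
    using sh by (auto simp: shortest_arc_def)
  have LT: "sr_length T \<gamma> = T"
  proof -
    have "integral {0..T} (speed \<gamma>) = integral {0..T} (\<lambda>_. 1)"
      by (rule integral_spike[of S1]) (use S1 in auto)
    then show ?thesis using T by (simp add: sr_length_def)
  qed
  have so: "\<gamma> t \<in> SO21" if "t \<in> {0..T}" for t using H that by (auto simp: horizontal_path_def)
  have ne: "\<gamma> T \<noteq> mat 1" using L LT T sr_dist_self[OF one_in_SO21] g0 by auto
  have "\<gamma> T \<in> SO21" using T by (intro so) simp
  then obtain b t e \<phi> where A: "admissible b t" and e: "e\<^sup>2 = 1" and gT: "\<gamma> T = geo (e * b) \<phi> t"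
    by (rule admissible_reach[OF _ ne])
  have tT: "t = T" using sr_dist_geo[OF A e, of \<phi>] L LT g0 gT by simp
  note A = A[unfolded tT] and gT = gT[unfolded tT]
  have bt: "0 \<le> b" "(b\<^sup>2 - 1) * T\<^sup>2 \<le> 4 * pi\<^sup>2" "Theta b T \<le> pi" using A by (auto simp: admissible_def)
  define m where "m t = (\<gamma> t$1$1 - 1) / 2" for t
  obtain S \<theta> where P: "profile S 0 T m \<theta> (speed \<gamma>)" and \<theta>0: "\<theta> 0 = 0"
    and w: "\<forall>t\<in>{0..T}. wc (\<gamma> t) = (1 + \<gamma> t$1$1) * cis (\<theta> t)"
    unfolding m_def[abs_def] by (rule horizontal_path_profile[OF H less_imp_le[OF T] g0])
  have m1: "1 + \<gamma> t$1$1 = 2 * (1 + m t)" for t by (simp add: m_def field_simps)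
  have wT: "wc (\<gamma> T) = 2 * (1 + (sn (b\<^sup>2 - 1) T)\<^sup>2) * cis (e * Theta b T)"
    unfolding gT by (rule wc_geo_polar[OF bt(1) e]) (use admissible_sn_nonneg[OF A] T in auto)
  have mT: "m T = (sn (b\<^sup>2 - 1) T)\<^sup>2"
    unfolding m_def by (rule entry_of_wc[OF _ wT]) (use so T in simp)
  have "of_real (2 * (1 + m T)) * cis (\<theta> T) = of_real (2 * (1 + m T)) * cis (e * Theta b T)"
    using bspec[OF w, of T] wT T unfolding m1 mT by auto
  then have "cis (\<theta> T) = cis (e * Theta b T)"
    unfolding mT by (rule cis_cancel[OF _ double_one_plus_square])
  then have th: "Theta b T \<le> \<bar>\<theta> T\<bar>"
    by (rule abs_angle_ge) (use Theta_nonneg bt e T in auto)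
  have "profile (S \<union> S1) 0 T m \<theta> (speed \<gamma>)"
    using P S1(1) unfolding profile_def by blast
  then have P1: "profile (S \<union> S1) 0 T m \<theta> (\<lambda>_. 1)"
    by (rule profile_cong) (use S1(2) in auto)
  \<comment> \<open>The orientation is read off from the path itself: at holonomy pi both
    orientations produce the same \<open>wc\<close>, so \<open>e\<close> may be the wrong
    one.\<close>
  obtain e' where e': "e'\<^sup>2 = 1" "profile (S \<union> S1) 0 T m (\<lambda>t. e' * \<theta> t) (\<lambda>_. 1)"
    "e' * \<theta> T = \<bar>\<theta> T\<bar>" by (rule signed_profile[OF P1])
  have m0: "m 0 = 0" by (simp add: m_def g0 one_entry)
  have eq: "m t = (sn (b\<^sup>2 - 1) t)\<^sup>2" "e' * \<theta> t = Theta b t" if "t \<in> {0..T}" for t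
    using profile_equality[OF e'(2) m0 _ A mT _ that] th e'(3) by (auto simp: \<theta>0)
  have wg: "wc (\<gamma> t) = wc (geo (e' * b) \<phi>' t)" if t: "t \<in> {0..T}" for t \<phi>'
  proof -
    have "\<theta> t = e' * Theta b t" using eq(2)[OF t] e'(1) by (auto simp: power2_eq_1_iff)
    then have "wc (\<gamma> t) = 2 * (1 + (sn (b\<^sup>2 - 1) t)\<^sup>2) * cis (e' * Theta b t)"
      using bspec[OF w t] unfolding m1 eq(1)[OF t] by simp
    also have "\<dots> = wc (geo (e' * b) \<phi>' t)"
      by (rule wc_geo_polar[OF bt(1) e'(1), symmetric]) (use admissible_sn_nonneg[OF A] t in auto)
    finally show ?thesis .
  qed
  have "(e' * b)\<^sup>2 = b\<^sup>2" using e'(1) by (simp add: power_mult_distrib)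
  from proportional_zc[OF H A refl this wg]
  obtain \<kappa> where \<kappa>: "\<And>t. t \<in> {0..T} \<Longrightarrow> zc (\<gamma> t) = \<kappa> * zc (geo (e' * b) 0 t)"
    by blast
  have "\<exists>\<alpha>. \<kappa> = cis \<alpha>"
  proof -
    define t where "t = T / 2"
    have t: "t \<in> {0..T}" "0 < t" "t < T" using T by (auto simp: t_def)
    have "m t > 0" using eq(1)[OF t(1)] admissible_sn_pos[OF A t(2,3)] by simp
    then have "(\<gamma> t$1$1)\<^sup>2 - 1 > 0" unfolding m_def by (simp add: one_less_power)
    moreover have "\<gamma> t$1$1 = geo (e' * b) 0 t$1$1"
      using cmod_wc[OF so[OF t(1)]] cmod_wc[OF geo_in_SO21, of "e' * b" 0 t] wg[OF t(1)] by simp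
    ultimately have "(cmod (zc (\<gamma> t)))\<^sup>2 = (cmod (zc (geo (e' * b) 0 t)))\<^sup>2" "(cmod (zc (\<gamma> t)))\<^sup>2 > 0"
      unfolding cmod_zc[OF so[OF t(1)]] cmod_zc[OF geo_in_SO21] by simp_all
    then have "cmod (zc (\<gamma> t)) = cmod (zc (geo (e' * b) 0 t))" "cmod (zc (\<gamma> t)) \<noteq> 0"
      by (auto simp: power2_eq_iff_nonneg)
    then have "cmod \<kappa> = 1" unfolding \<kappa>[OF t(1)] norm_mult by simp
    then show ?thesis by (metis cis_Arg norm_zero sgn_div_norm inverse_1 scaleR_one zero_neq_one)
  qed
  then obtain \<alpha> where \<alpha>: "\<kappa> = cis \<alpha>" by blast
  have "\<gamma> t = geo (e' * b) \<alpha> t" if t: "t \<in> {0..T}" for t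
    by (rule SO21_eqI[OF so[OF t] geo_in_SO21 _ wg[OF t]]) (simp add: \<kappa>[OF t] zc_geo[OF refl] \<alpha>)
  then show ?thesis using that A e'(1) by blast
qed

section \<open>The cut locus\<close>

lemma rot_eqI: assumes "C \<in> SO21" "zc C = 0" obtains \<tau> where "C = rot \<tau>"
proof -
  have "(C$1$1)\<^sup>2 = 1" using cmod_zc[OF assms(1)] assms(2) by simp
  then have "C$1$1 = 1" using assms(1) by (auto simp: SO21_iff power2_eq_1_iff)
  then have n: "cmod (wc C) = 2" using cmod_wc[OF assms(1)] by simp
  then have "wc C \<noteq> 0" by auto
  then have "wc C = 2 * cis (Arg (wc C))" using n by (simp add: cis_Arg sgn_div_norm scaleR_conv_of_real)
  moreover have "wc (rot \<tau>) = 2 * cis \<tau>" "zc (rot \<tau>) = 0" for \<tau>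
    by (simp_all add: wc_def zc_def rot_def complex_eq_iff)
  ultimately have "C = rot (Arg (wc C))"
    using assms by (intro SO21_eqI[OF assms(1) rot_in_SO21]) simp_all
  then show ?thesis by (rule that)
qed

lemma SO2_eq_rot: "SO2 = range rot"
proof (intro set_eqI iffI)
  fix C assume "C \<in> SO2"
  then obtain A :: "real^2^2" where C: "C = vector [vector [1, 0, 0], vector [0, A$1$1, A$1$2], vector [0, A$2$1, A$2$2]]"
    and A: "rotation_matrix A" by (auto simp: SO2_def)
  have o: "transpose A ** A = mat 1" and d: "A$1$1 * A$2$2 - A$1$2 * A$2$1 = 1"
    using A by (auto simp: rotation_matrix_def orthogonal_matrix_def det_2)
  have "A$1$1 * A$1$1 + A$2$1 * A$2$1 = 1" "A$1$2 * A$1$2 + A$2$2 * A$2$2 = 1"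
    using o by (auto simp: vec_eq_iff forall_2 matrix_matrix_mult_def sum_2 transpose_def mat_def)
  then have "(A$1$1 - A$2$2)\<^sup>2 + (A$1$2 + A$2$1)\<^sup>2 = 0" and c: "(A$1$1)\<^sup>2 + (A$2$1)\<^sup>2 = 1"
    using d by (simp_all add: power2_eq_square algebra_simps)
  then have "A$2$2 = A$1$1" "A$1$2 = - A$2$1" by (auto simp: sum_power2_eq_zero_iff)
  moreover obtain \<tau> where "A$1$1 = cos \<tau>" "A$2$1 = sin \<tau>" using sincos_total_2pi[OF c] by metis
  ultimately have "C = rot \<tau>" unfolding C rot_def by simp
  then show "C \<in> range rot" by simp
next
  fix C assume "C \<in> range rot"
  then obtain \<tau> where C: "C = rot \<tau>" by auto
  define A :: "real^2^2" where "A = vector [vector [cos \<tau>, - sin \<tau>], vector [sin \<tau>, cos \<tau>]]"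
  have "cos \<tau> * cos \<tau> + sin \<tau> * sin \<tau> = 1" using sin_cos_squared_add[of \<tau>] by (simp add: power2_eq_square)
  then have "rotation_matrix A"
    unfolding rotation_matrix_def orthogonal_matrix_def det_2 A_def
    by (simp add: vec_eq_iff forall_2 matrix_matrix_mult_def sum_2 transpose_def mat_def algebra_simps)
  then show "C \<in> SO2" unfolding SO2_def C rot_def by (auto simp: A_def intro!: exI[of _ A])
qed

lemma zc_rot [simp]: "zc (rot \<tau>) = 0"
  by (simp add: zc_def rot_def complex_eq_iff)

lemma in_SO2_iff: "C \<in> SO2 \<longleftrightarrow> C \<in> SO21 \<and> zc C = 0"
  using rot_eqI rot_in_SO21 unfolding SO2_eq_rot by (metis range_eqI rangeE zc_rot)

definition opposite_set :: "mat3 set" where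
  "opposite_set = {C \<in> SO21. C $ 2 $ 1 = - (C $ 1 $ 2) \<and> C $ 3 $ 1 = - (C $ 1 $ 3) \<and>
                      C $ 2 $ 3 = C $ 3 $ 2 \<and> C $ 2 $ 2 + C $ 3 $ 3 < 0}"

text \<open>A negative real \<open>wc\<close> means holonomy pi. From it, \<open>first_row\<close>
  yields the relations between the first row and the first column.\<close>

lemma in_opposite_set_iff:
  "C \<in> opposite_set \<longleftrightarrow> C \<in> SO21 \<and> wc C = - of_real (1 + C$1$1)"
proof (cases "C \<in> SO21")
  case C: True
  have p: "1 + C$1$1 > 0" using C by (simp add: SO21_iff)
  show ?thesis
  proof
    assume "C \<in> opposite_set"
    then have "Im (wc C) = 0" "Re (wc C) < 0" by (auto simp: opposite_set_def wc_def)
    then have "cmod (wc C) = - Re (wc C)" "wc C = of_real (Re (wc C))"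
      by (auto simp: cmod_def complex_eq_iff)
    then show "C \<in> SO21 \<and> wc C = - of_real (1 + C$1$1)" using C cmod_wc[OF C] by simp
  next
    assume "C \<in> SO21 \<and> wc C = - of_real (1 + C$1$1)"
    then have w: "wc C = - of_real (1 + C$1$1)" by simp
    have "(1 + C$1$1) * Complex (C$1$2) (C$1$3) = of_real (1 + C$1$1) * (- zc C)"
      using first_row[OF C] unfolding w by (simp add: algebra_simps)
    then have "Complex (C$1$2) (C$1$3) = - zc C"
      using p by (subst (asm) mult_cancel_left) (auto simp del: of_real_add)
    then show "C \<in> opposite_set"
      using w p C by (auto simp: opposite_set_def zc_def wc_def complex_eq_iff)
  qed
qed (simp add: opposite_set_def)

text \<open>At (b^2 - 1) t^2 = 4 pi^2 the function \<open>sn\<close> vanishes, so the hypotheses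
  make both bounds in \<open>admissible\<close> strict. Strict bounds persist for slightly larger
  times.\<close>

lemma admissible_extend:
  assumes A: "admissible b t" and s: "sn (b\<^sup>2 - 1) t \<noteq> 0" and Th: "Theta b t < pi"
  obtains t' where "t < t'" "admissible b t'"
proof -
  have bt: "0 \<le> b" "0 < t" "(b\<^sup>2 - 1) * t\<^sup>2 \<le> 4 * pi\<^sup>2" using A by (auto simp: admissible_def)
  have "(b\<^sup>2 - 1) * t\<^sup>2 \<noteq> 4 * pi\<^sup>2" using s by (auto simp: sn_def)
  then have lt: "(b\<^sup>2 - 1) * t\<^sup>2 < 4 * pi\<^sup>2" using bt by simp
  have "isCont (Theta b) t" "isCont (\<lambda>t. (b\<^sup>2 - 1) * t\<^sup>2) t"
    using continuous_on_Theta[of UNIV b] by (auto simp: continuous_on_eq_continuous_at intro!: continuous_intros)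
  then have "\<forall>\<^sub>F u in at t. Theta b u < pi" "\<forall>\<^sub>F u in at t. (b\<^sup>2 - 1) * u\<^sup>2 < 4 * pi\<^sup>2"
    using Th lt by (auto simp: isCont_def intro: order_tendstoD)
  then have "\<forall>\<^sub>F u in at t. Theta b u < pi \<and> (b\<^sup>2 - 1) * u\<^sup>2 < 4 * pi\<^sup>2" by (rule eventually_conj)
  then have "\<forall>\<^sub>F u in at_right t. Theta b u < pi \<and> (b\<^sup>2 - 1) * u\<^sup>2 < 4 * pi\<^sup>2"
    by (simp add: eventually_at_split)
  then have "\<forall>\<^sub>F u in at_right t. (Theta b u < pi \<and> (b\<^sup>2 - 1) * u\<^sup>2 < 4 * pi\<^sup>2) \<and> t < u"
    by (rule eventually_conj) (simp add: eventually_at_right_less)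
  then obtain u where "Theta b u < pi" "(b\<^sup>2 - 1) * u\<^sup>2 < 4 * pi\<^sup>2" "t < u"
    using eventually_happens by (fastforce simp: trivial_limit_at_right_real)
  then show ?thesis using that[of u] bt by (simp add: admissible_def)
qed

text \<open>Differentiating \<open>sn\<close> determines \<open>cs\<close>, and differentiating
  again gives k sn k = l sn l; the positive factor at an interior point cancels.\<close>

lemma sn_inj:
  assumes "0 < T" and eq: "\<And>t. t \<in> {0..T} \<Longrightarrow> (sn k t)\<^sup>2 = (sn l t)\<^sup>2"
    and nn: "\<And>t. t \<in> {0..T} \<Longrightarrow> sn k t \<ge> 0" "\<And>t. t \<in> {0..T} \<Longrightarrow> sn l t \<ge> 0"
    and pos: "\<And>t. 0 < t \<Longrightarrow> t < T \<Longrightarrow> sn k t > 0"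
  shows "k = l"
proof -
  have s: "sn k t = sn l t" if "t \<in> {0..T}" for t
    using eq[OF that] nn[OF that] by (simp add: power2_eq_iff_nonneg)
  have c: "cs k t = cs l t" if t: "t \<in> {0<..<T}" for t
  proof -
    have "(sn l has_real_derivative cs k t / 2) (at t)"
      by (rule has_field_derivative_transform_within_open[OF DERIV_sn, of "{0<..<T}"]) (use t s in auto)
    then show ?thesis using DERIV_unique[OF _ DERIV_sn[of l t]] by fastforce
  qed
  have t: "T / 2 \<in> {0<..<T}" using assms(1) by simp
  have "(cs l has_real_derivative - k * sn k (T / 2) / 2) (at (T / 2))"
    by (rule has_field_derivative_transform_within_open[OF DERIV_cs, of "{0<..<T}"]) (use t c in auto)
  from DERIV_unique[OF this DERIV_cs] have "k * sn k (T / 2) = l * sn l (T / 2)" by simp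
  then show ?thesis using s[of "T/2"] pos[of "T / 2"] t by auto
qed

lemma geo_entry:
  assumes A: "admissible b T" "e\<^sup>2 = 1" "t \<in> {0..T}"
  shows "(geo (e * b) \<phi> t$1$1 - 1) / 2 = (sn (b\<^sup>2 - 1) t)\<^sup>2"
proof (rule entry_of_wc[OF geo_in_SO21])
  have "b \<ge> 0" "sn (b\<^sup>2 - 1) t \<ge> 0" using A admissible_sn_nonneg[of b T t] by (auto simp: admissible_def)
  from wc_geo_polar[OF this(1) A(2) this(2)]
  show "wc (geo (e * b) \<phi> t) = of_real (2 * (1 + (sn (b\<^sup>2 - 1) t)\<^sup>2)) * cis (e * Theta b t)" by simp
qed

text \<open>A continuation of a shortest arc is again a geodesic, but a priori with other
  parameters. The radius along the common piece determines the curvature.\<close>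

lemma geo_curvature_unique:
  assumes A: "admissible b T" "admissible b' T'" "T \<le> T'" and e: "e\<^sup>2 = 1" "e'\<^sup>2 = 1"
    and eq: "\<And>t. t \<in> {0..T} \<Longrightarrow> geo (e * b) \<phi> t = geo (e' * b') \<phi>' t"
  shows "b = b'"
proof -
  have T: "0 < T" and b: "0 \<le> b" "0 \<le> b'" using A by (auto simp: admissible_def)
  have "b\<^sup>2 - 1 = b'\<^sup>2 - 1"
  proof (rule sn_inj[OF T])
    fix t assume t: "t \<in> {0..T}"
    then have t': "t \<in> {0..T'}" using A by auto
    show "(sn (b\<^sup>2 - 1) t)\<^sup>2 = (sn (b'\<^sup>2 - 1) t)\<^sup>2"
      unfolding geo_entry[OF A(1) e(1) t, of \<phi>, symmetric] geo_entry[OF A(2) e(2) t', of \<phi>', symmetric] eq[OF t] ..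
    show "sn (b\<^sup>2 - 1) t \<ge> 0" "sn (b'\<^sup>2 - 1) t \<ge> 0"
      using admissible_sn_nonneg[OF A(1)] admissible_sn_nonneg[OF A(2)] t t' by auto
  qed (rule admissible_sn_pos[OF A(1)])
  then show ?thesis using b by (simp add: power2_eq_iff_nonneg)
qed

lemma zc_geo_eq_0_iff:
  assumes A: "admissible b T" "e\<^sup>2 = 1" "t \<in> {0..T}"
  shows "zc (geo (e * b) \<phi> t) = 0 \<longleftrightarrow> sn (b\<^sup>2 - 1) t = 0"
proof -
  have g: "geo (e * b) \<phi> t$1$1 = 1 + 2 * (sn (b\<^sup>2 - 1) t)\<^sup>2"
    unfolding geo_entry[OF A, of \<phi>, symmetric] by (simp add: field_simps)
  have "zc (geo (e * b) \<phi> t) = 0 \<longleftrightarrow> (cmod (zc (geo (e * b) \<phi> t)))\<^sup>2 = 0" by simp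
  also have "\<dots> \<longleftrightarrow> (geo (e * b) \<phi> t$1$1)\<^sup>2 = 1"
    unfolding cmod_zc[OF geo_in_SO21] by simp
  also have "\<dots> \<longleftrightarrow> geo (e * b) \<phi> t$1$1 = 1"
    using geo_in_SO21[of "e * b" \<phi> t] by (auto simp: SO21_iff power2_eq_1_iff)
  finally show ?thesis unfolding g by simp
qed

lemma geo_opposite_iff:
  assumes A: "admissible b t" "e\<^sup>2 = 1"
  shows "geo (e * b) \<phi> t \<in> opposite_set \<longleftrightarrow> Theta b t = pi"
proof -
  have bt: "0 \<le> b" "0 < t" "(b\<^sup>2 - 1) * t\<^sup>2 \<le> 4 * pi\<^sup>2" "Theta b t \<le> pi" using A by (auto simp: admissible_def)
  have Th: "0 \<le> Theta b t" using Theta_nonneg bt by simp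
  have t: "t \<in> {0..t}" using bt by simp
  define N where "N = 2 * (1 + (sn (b\<^sup>2 - 1) t)\<^sup>2)"
  have N: "N \<noteq> 0" unfolding N_def by (rule double_one_plus_square)
  have g: "1 + geo (e * b) \<phi> t$1$1 = N"
    unfolding N_def geo_entry[OF A t, of \<phi>, symmetric] by (simp add: field_simps)
  have w: "wc (geo (e * b) \<phi> t) = of_real N * cis (e * Theta b t)"
    unfolding N_def using wc_geo_polar[OF bt(1) A(2), of t \<phi>] admissible_sn_nonneg[OF A(1), of t] bt by simp
  have "geo (e * b) \<phi> t \<in> opposite_set \<longleftrightarrow> of_real N * cis (e * Theta b t) = of_real N * (- 1)"
    unfolding in_opposite_set_iff w g using geo_in_SO21 by simp
  also have "\<dots> \<longleftrightarrow> cis (e * Theta b t) = -1" using N by (subst mult_cancel_left) simp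
  also have "\<dots> \<longleftrightarrow> Theta b t = pi"
  proof
    assume "cis (e * Theta b t) = -1"
    then have "cos (e * Theta b t) = -1" by (simp add: complex_eq_iff)
    then have "cos (Theta b t) = cos pi" using A(2) by (auto simp: power2_eq_1_iff)
    then show "Theta b t = pi" using cos_inj_pi[OF Th bt(4)] by simp
  next
    assume "Theta b t = pi"
    then show "cis (e * Theta b t) = -1" using A(2) by (auto simp: power2_eq_1_iff complex_eq_iff)
  qed
  finally show ?thesis .
qed

text \<open>Shortest arcs from the identity are exactly the admissible geodesics, so an arc can be
  continued exactly while admissibility persists. It ends at holonomy pi, which is
  \<open>opposite_set\<close>, or when the projected circle closes, which gives the
  rotations.\<close>

theorem cut_locus_one: "cut_locus (mat 1) = opposite_set \<union> (SO2 - {mat 1})"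
proof (intro set_eqI iffI)
  fix x assume "x \<in> cut_locus (mat 1)"
  then obtain T \<gamma> where x: "x = \<gamma> T" and sh: "shortest_arc T \<gamma>" and g0: "\<gamma> 0 = mat 1"
    and nc: "\<not> (\<exists>T' \<gamma>'. T < T' \<and> shortest_arc T' \<gamma>' \<and> (\<forall>t\<in>{0..T}. \<gamma>' t = \<gamma> t))"
    by (auto simp: cut_locus_def)
  obtain b e \<phi> where A: "admissible b T" and e: "e\<^sup>2 = 1" and g: "\<And>t. t \<in> {0..T} \<Longrightarrow> \<gamma> t = geo (e * b) \<phi> t"
    using shortest_arc_is_geo[OF sh g0] by blast
  have T: "0 < T" "T \<in> {0..T}" "Theta b T \<le> pi" using A by (auto simp: admissible_def)
  have xg: "x = geo (e * b) \<phi> T" using x g T by simp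
  show "x \<in> opposite_set \<union> (SO2 - {mat 1})"
  proof (cases "sn (b\<^sup>2 - 1) T = 0 \<or> Theta b T = pi")
    case True
    have "x \<noteq> mat 1"
      using sr_dist_geo[OF A e, of \<phi>] sr_dist_self[OF one_in_SO21] T unfolding xg by auto
    then show ?thesis
      using True zc_geo_eq_0_iff[OF A e T(2), of \<phi>] geo_opposite_iff[OF A e, of \<phi>] geo_in_SO21
      unfolding xg by (auto simp: in_SO2_iff)
  next
    case False
    then obtain T' where T': "T < T'" "admissible b T'"
      using admissible_extend[OF A] T(3) by (metis order_le_less)
    then have "shortest_arc T' (geo (e * b) \<phi>)" by (intro shortest_geo e)
    then show ?thesis using nc T'(1) g by metis
  qed
next
  fix x assume x: "x \<in> opposite_set \<union> (SO2 - {mat 1})"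
  have x1: "x \<in> SO21" using x by (auto simp: opposite_set_def in_SO2_iff)
  have "mat 1 \<notin> opposite_set" by (simp add: opposite_set_def one_entry)
  then have "x \<noteq> mat 1" using x by auto
  then obtain b t e \<phi> where A: "admissible b t" and e: "e\<^sup>2 = 1" and xg: "x = geo (e * b) \<phi> t"
    by (rule admissible_reach[OF x1])
  have t: "0 < t" "t \<in> {0..t}" using A by (auto simp: admissible_def)
  show "x \<in> cut_locus (mat 1)"
    unfolding cut_locus_def
  proof (intro CollectI exI conjI notI)
    show "x = geo (e * b) \<phi> t" by (rule xg)
    show "shortest_arc t (geo (e * b) \<phi>)" by (rule shortest_geo[OF A e])
    show "geo (e * b) \<phi> 0 = mat 1" by simp
    assume "\<exists>T' \<gamma>'. t < T' \<and> shortest_arc T' \<gamma>' \<and> (\<forall>u\<in>{0..t}. \<gamma>' u = geo (e * b) \<phi> u)"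
    then obtain T' \<gamma>' where T': "t < T'" and sh: "shortest_arc T' \<gamma>'"
      and eq: "\<And>u. u \<in> {0..t} \<Longrightarrow> \<gamma>' u = geo (e * b) \<phi> u" by blast
    have "\<gamma>' 0 = mat 1" using eq[of 0] t by simp
    then obtain b' e' \<phi>' where A': "admissible b' T'" and e': "e'\<^sup>2 = 1"
      and g: "\<And>u. u \<in> {0..T'} \<Longrightarrow> \<gamma>' u = geo (e' * b') \<phi>' u"
      using shortest_arc_is_geo[OF sh] by blast
    have "b = b'"
    proof (rule geo_curvature_unique[OF A A' _ e e'])
      show "geo (e * b) \<phi> u = geo (e' * b') \<phi>' u" if "u \<in> {0..t}" for u
        using eq[OF that] g[of u] that T' by simp
    qed (use T' in simp)
    then have A'': "admissible b T'" using A' by simp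
    show False
    \<comment> \<open>On an admissible extension beyond \<open>t\<close> the holonomy would exceed
      pi in the first case, because \<open>Theta\<close> is strictly increasing; in the second,
      \<open>sn\<close> would be positive at \<open>t\<close>.\<close>
    proof (cases "x \<in> opposite_set")
      case True
      then have Th: "Theta b t = pi" unfolding xg geo_opposite_iff[OF A e] .
      have "b \<noteq> 0" using Th Theta_flat[of t] by auto
      then have "Theta b t < Theta b T'"
        using A'' T' t by (intro Theta_strict_mono) (auto simp: admissible_def)
      then show False using Th A'' by (simp add: admissible_def)
    next
      case False
      then have "sn (b\<^sup>2 - 1) t = 0"
        using x zc_geo_eq_0_iff[OF A e t(2), of \<phi>] unfolding xg by (simp add: in_SO2_iff)
      then show False using admissible_sn_pos[OF A'' t(1) T'] by simp
    qed
  qed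
qed

section \<open>Invariance under left translations\<close>

lemma has_vector_derivative_left:
  fixes g :: mat3 and \<gamma> :: "real \<Rightarrow> mat3"
  assumes "(\<gamma> has_vector_derivative v) (at t)"
  shows "((\<lambda>t. g ** \<gamma> t) has_vector_derivative g ** v) (at t)"
  using has_vector_derivative_matmul[OF has_vector_derivative_const assms, of g] by simp

lemma horizontal_path_left:
  assumes g: "g \<in> SO21" and H: "horizontal_path T \<gamma>"
  shows "horizontal_path T (\<lambda>t. g ** \<gamma> t)" "sr_length T (\<lambda>t. g ** \<gamma> t) = sr_length T \<gamma>"
    and "\<exists>S. finite S \<and> (\<forall>t\<in>{0..T} - S. speed (\<lambda>t. g ** \<gamma> t) t = speed \<gamma> t)"
proof -
  obtain S1 D where S1: "finite S1" "\<And>t. t \<in> {0..T} - S1 \<Longrightarrow> (\<gamma> has_vector_derivative D t) (at t)"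
    "continuous_on ({0..T} - S1) D" and c: "continuous_on {0..T} \<gamma>"
    using H unfolding horizontal_path_def piecewise_C1_differentiable_on_def C1_differentiable_on_def by blast
  obtain S where S: "finite S" and S3: "\<forall>t\<in>{0..T}. \<gamma> t \<in> SO21" and int: "speed \<gamma> integrable_on {0..T}" and
    D: "\<forall>t\<in>{0..T} - S. \<exists>u1 u2. (\<gamma> has_vector_derivative \<gamma> t ** hor u1 u2) (at t) \<and>
        speed \<gamma> t = sqrt (u1\<^sup>2 + u2\<^sup>2)" by (rule horizontal_pathE[OF H])
  have so: "g ** \<gamma> t \<in> SO21" if "t \<in> {0..T}" for t using SO21_mult[OF g] S3 that by blast
  have d: "vector_derivative (\<lambda>t. g ** \<gamma> t) (at t) \<in> distr (g ** \<gamma> t) \<and> speed (\<lambda>t. g ** \<gamma> t) t = speed \<gamma> t"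
    if t: "t \<in> {0..T} - S" for t
  proof -
    obtain u1 u2 where u: "(\<gamma> has_vector_derivative \<gamma> t ** hor u1 u2) (at t)" "speed \<gamma> t = sqrt (u1\<^sup>2 + u2\<^sup>2)"
      using bspec[OF D t] by blast
    have v: "vector_derivative (\<lambda>t. g ** \<gamma> t) (at t) = g ** \<gamma> t ** hor u1 u2"
      using vector_derivative_at[OF has_vector_derivative_left[OF u(1)]] by (simp add: matrix_mul_assoc)
    have "g ** \<gamma> t \<in> SO21" using so t by simp
    then show ?thesis unfolding speed_def[of "\<lambda>t. g ** \<gamma> t"] v distr_eq using sr_norm_hor u(2) by auto
  qed
  show "\<exists>S. finite S \<and> (\<forall>t\<in>{0..T} - S. speed (\<lambda>t. g ** \<gamma> t) t = speed \<gamma> t)"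
    using S d by blast
  have "(\<lambda>t. g ** \<gamma> t) piecewise_C1_differentiable_on {0..T}"
    unfolding piecewise_C1_differentiable_on_def C1_differentiable_on_def
  proof (intro conjI exI ballI)
    show "finite S1" by (rule S1)
    show "((\<lambda>t. g ** \<gamma> t) has_vector_derivative g ** D t) (at t)" if "t \<in> {0..T} - S1" for t
      by (rule has_vector_derivative_left[OF S1(2)[OF that]])
    show "continuous_on {0..T} (\<lambda>t. g ** \<gamma> t)" "continuous_on ({0..T} - S1) (\<lambda>t. g ** D t)"
      by (intro bounded_bilinear.continuous_on[OF bounded_bilinear_matmul] continuous_on_const c S1(3))+
  qed
  moreover have "speed (\<lambda>t. g ** \<gamma> t) integrable_on {0..T}"
    by (rule integrable_spike_finite[OF S _ int]) (use d in auto)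
  moreover have "(\<lambda>t. g ** \<gamma> t) ` {0..T} \<subseteq> SO21" using so by auto
  ultimately show "horizontal_path T (\<lambda>t. g ** \<gamma> t)"
    unfolding horizontal_path_def using S d by blast
  show "sr_length T (\<lambda>t. g ** \<gamma> t) = sr_length T \<gamma>"
    unfolding sr_length_def by (rule integral_spike[of S]) (use S d in auto)
qed

lemma left_cancel:
  assumes "g \<in> SO21" shows "g ** x = g ** y \<longleftrightarrow> x = y"
  using SO21_cancel(1)[OF assms] by metis

lemma sr_dist_left:
  assumes g: "g \<in> SO21" shows "sr_dist (g ** x) (g ** y) = sr_dist x y"
proof -
  have *: "{sr_length T \<gamma> | T \<gamma>. 0 \<le> T \<and> horizontal_path T \<gamma> \<and> \<gamma> 0 = x \<and> \<gamma> T = y}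
     \<subseteq> {sr_length T \<gamma> | T \<gamma>. 0 \<le> T \<and> horizontal_path T \<gamma> \<and> \<gamma> 0 = g ** x \<and> \<gamma> T = g ** y}"
    if g: "g \<in> SO21" for g x y
  proof safe
    fix T \<gamma> assume "0 \<le> T" and H: "horizontal_path T \<gamma>"
    then show "\<exists>T' \<gamma>'. sr_length T \<gamma> = sr_length T' \<gamma>' \<and> 0 \<le> T' \<and> horizontal_path T' \<gamma>' \<and>
      \<gamma>' 0 = g ** \<gamma> 0 \<and> \<gamma>' T' = g ** \<gamma> T"
      using horizontal_path_left[OF g H] by (intro exI[of _ T] exI[of _ "\<lambda>t. g ** \<gamma> t"]) auto
  qed
  have "{sr_length T \<gamma> | T \<gamma>. 0 \<le> T \<and> horizontal_path T \<gamma> \<and> \<gamma> 0 = x \<and> \<gamma> T = y}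
     = {sr_length T \<gamma> | T \<gamma>. 0 \<le> T \<and> horizontal_path T \<gamma> \<and> \<gamma> 0 = g ** x \<and> \<gamma> T = g ** y}"
    using *[OF g, of x y] *[OF SO21_linv_in[OF g], of "g ** x" "g ** y"]
    unfolding SO21_cancel(1)[OF g] by (rule subset_antisym)
  then show ?thesis unfolding sr_dist_def by simp
qed

lemma shortest_arc_left:
  assumes g: "g \<in> SO21" and sh: "shortest_arc T \<gamma>" shows "shortest_arc T (\<lambda>t. g ** \<gamma> t)"
proof -
  have H: "horizontal_path T \<gamma>" "0 < T" "sr_length T \<gamma> = sr_dist (\<gamma> 0) (\<gamma> T)"
    using sh by (auto simp: shortest_arc_def)
  note l = horizontal_path_left[OF g H(1)]
  obtain S1 where S1: "finite S1" "\<And>t. t \<in> {0..T} - S1 \<Longrightarrow> speed \<gamma> t = 1"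
    using sh by (auto simp: shortest_arc_def)
  obtain S2 where S2: "finite S2" "\<And>t. t \<in> {0..T} - S2 \<Longrightarrow> speed (\<lambda>t. g ** \<gamma> t) t = speed \<gamma> t"
    using l(3) by blast
  have "\<exists>S. finite S \<and> (\<forall>t\<in>{0..T} - S. speed (\<lambda>t. g ** \<gamma> t) t = 1)"
    using S1 S2 by (intro exI[of _ "S1 \<union> S2"]) auto
  then show ?thesis unfolding shortest_arc_def using H l(1,2) sr_dist_left[OF g] by simp
qed

text \<open>A continuation of the translated arc, translated back by \<open>linv g\<close>, would
  continue the original one.\<close>

lemma cut_locus_left_subset:
  assumes g: "g \<in> SO21" shows "(\<lambda>h. g ** h) ` cut_locus x \<subseteq> cut_locus (g ** x)"
proof
  fix y assume "y \<in> (\<lambda>h. g ** h) ` cut_locus x"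
  then obtain T \<gamma> where y: "y = g ** \<gamma> T" and sh: "shortest_arc T \<gamma>" and g0: "\<gamma> 0 = x"
    and nc: "\<not> (\<exists>T' \<gamma>'. T < T' \<and> shortest_arc T' \<gamma>' \<and> (\<forall>t\<in>{0..T}. \<gamma>' t = \<gamma> t))"
    by (auto simp: cut_locus_def)
  have "\<not> (\<exists>T' \<gamma>'. T < T' \<and> shortest_arc T' \<gamma>' \<and> (\<forall>t\<in>{0..T}. \<gamma>' t = g ** \<gamma> t))"
  proof
    assume "\<exists>T' \<gamma>'. T < T' \<and> shortest_arc T' \<gamma>' \<and> (\<forall>t\<in>{0..T}. \<gamma>' t = g ** \<gamma> t)"
    then obtain T' \<gamma>' where "T < T'" "shortest_arc T' \<gamma>'" and eq: "\<forall>t\<in>{0..T}. \<gamma>' t = g ** \<gamma> t" by blast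
    moreover from this have "shortest_arc T' (\<lambda>t. linv g ** \<gamma>' t)"
      by (intro shortest_arc_left SO21_linv_in g)
    moreover have "\<forall>t\<in>{0..T}. linv g ** \<gamma>' t = \<gamma> t" using eq g by simp
    ultimately show False using nc by blast
  qed
  then show "y \<in> cut_locus (g ** x)"
    unfolding cut_locus_def using y g0 shortest_arc_left[OF g sh]
    by (intro CollectI exI[of _ T] exI[of _ "\<lambda>t. g ** \<gamma> t"]) auto
qed

theorem cut_locus_left:
  assumes g: "g \<in> SO21" shows "cut_locus g = (\<lambda>h. g ** h) ` cut_locus (mat 1)"
proof
  show "(\<lambda>h. g ** h) ` cut_locus (mat 1) \<subseteq> cut_locus g"
    using cut_locus_left_subset[OF g, of "mat 1"] by simp
  have "(\<lambda>h. linv g ** h) ` cut_locus g \<subseteq> cut_locus (linv g ** g)"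
    by (rule cut_locus_left_subset[OF SO21_linv_in[OF g]])
  then have *: "(\<lambda>h. linv g ** h) ` cut_locus g \<subseteq> cut_locus (mat 1)"
    by (simp only: SO21_linv(2)[OF g])
  show "cut_locus g \<subseteq> (\<lambda>h. g ** h) ` cut_locus (mat 1)"
  proof
    fix y assume "y \<in> cut_locus g"
    then have "linv g ** y \<in> cut_locus (mat 1)" using * by blast
    then have "g ** (linv g ** y) \<in> (\<lambda>h. g ** h) ` cut_locus (mat 1)" by blast
    then show "y \<in> (\<lambda>h. g ** h) ` cut_locus (mat 1)" using g by simp
  qed
qed

section \<open>The exponential map\<close>

lemma inner_mult_right: "((P :: mat3) ** N) \<bullet> Y = P \<bullet> (Y ** transpose N)"
  and inner_mult_left: "((N :: mat3) ** P) \<bullet> Y = P \<bullet> (transpose N ** Y)"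
  by (simp_all add: inner_mat3 mult_entry transpose_entry algebra_simps)

lemma inner_conjugate:
  fixes Z E N L :: mat3
  shows "transpose Z \<bullet> (E ** N ** L) = transpose (L ** Z ** E) \<bullet> N"
proof -
  have "transpose Z \<bullet> (E ** N ** L) = (transpose Z ** transpose L) \<bullet> (E ** N)"
    by (simp add: inner_mult_right transpose_transpose)
  also have "\<dots> = (transpose E ** (transpose Z ** transpose L)) \<bullet> N"
    by (simp add: inner_mult_left transpose_transpose)
  finally show ?thesis by (simp add: matrix_transpose_mul matrix_mul_assoc)
qed

lemma hor_transpose [simp]: "transpose (hor u1 u2) = hor u1 u2"
  by (simp add: hor_entry mat3_eq_iff transpose_entry)

lemma mat_ab_transpose [simp]: "transpose mat_a = mat_a" "transpose mat_b = mat_b"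
  by (simp_all add: mat3_simps)

lemma bounded_linear_linv: "bounded_linear linv"
  by (simp add: linear_conv_bounded_linear[symmetric] linear_iff linv_def mat3_eq_iff mult_entry transpose_entry algebra_simps)

lemma bounded_linear_transpose3: "bounded_linear (transpose :: mat3 \<Rightarrow> mat3)"
  by (simp add: linear_conv_bounded_linear[symmetric] linear_iff mat3_eq_iff transpose_entry)

lemma linv_hor: "linv (hor u1 u2) = - hor u1 u2"
  by (simp add: linv_def hor_entry mat3_simps)

lemma GDERIV_sum_squares:
  fixes A B :: "'a::real_inner"
  shows "GDERIV (\<lambda>y. ((y \<bullet> A)\<^sup>2 + (y \<bullet> B)\<^sup>2) / 2) y :> (y \<bullet> A) *\<^sub>R A + (y \<bullet> B) *\<^sub>R B"
proof -
  have "GDERIV (\<lambda>y. (y \<bullet> C)\<^sup>2 / 2) y :> (y \<bullet> C) *\<^sub>R C" for C :: 'a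
  proof (rule GDERIV_DERIV_compose[where g = "\<lambda>s. s\<^sup>2 / 2"])
    show "GDERIV (\<lambda>y. y \<bullet> C) y :> C"
      unfolding gderiv_def by (rule bounded_linear_imp_has_derivative[OF bounded_linear_inner_left])
    show "DERIV (\<lambda>s. s\<^sup>2 / 2) (y \<bullet> C) :> y \<bullet> C"
      by (rule DERIV_cong[OF DERIV_cdivide[OF DERIV_power[OF DERIV_ident, where n = 2]]]) simp
  qed
  from GDERIV_add[OF this this, of A B] show ?thesis by (simp add: add_divide_distrib)
qed

lemma GDERIV_unique:
  assumes "GDERIV f x :> D" "GDERIV f x :> E" shows "D = E"
proof -
  have "(\<lambda>h. h \<bullet> D) = (\<lambda>h. h \<bullet> E)"
    using assms unfolding gderiv_def by (rule has_derivative_unique)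
  then have "(D - E) \<bullet> D = (D - E) \<bullet> E" by (rule fun_cong)
  then have "(D - E) \<bullet> (D - E) = 0" by (simp only: inner_diff_right)
  then show ?thesis by simp
qed

lemma GDERIV_hamiltonian:
  "GDERIV (\<lambda>p. hamiltonian x p) p :> x ** hor (p \<bullet> (x ** mat_a)) (p \<bullet> (x ** mat_b))"
  "GDERIV (\<lambda>x. hamiltonian x p) x :> p ** hor (p \<bullet> (x ** mat_a)) (p \<bullet> (x ** mat_b))"
proof -
  show "GDERIV (\<lambda>p. hamiltonian x p) p :> x ** hor (p \<bullet> (x ** mat_a)) (p \<bullet> (x ** mat_b))"
    using GDERIV_sum_squares[of "x ** mat_a" "x ** mat_b" p]
    unfolding hamiltonian_def hor_def matmul_linear .
  have "p \<bullet> (x ** mat_a) = x \<bullet> (p ** mat_a)" "p \<bullet> (x ** mat_b) = x \<bullet> (p ** mat_b)" for x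
    using inner_mult_right[of p mat_a x] inner_mult_right[of p mat_b x] by (simp_all add: inner_commute)
  then show "GDERIV (\<lambda>x. hamiltonian x p) x :> p ** hor (p \<bullet> (x ** mat_a)) (p \<bullet> (x ** mat_b))"
    using GDERIV_sum_squares[of "p ** mat_a" "p ** mat_b" x]
    unfolding hamiltonian_def hor_def matmul_linear by simp
qed

lemma normal_extremal_iff:
  "normal_extremal X P \<longleftrightarrow> (\<forall>t.
     (X has_vector_derivative X t ** hor (P t \<bullet> (X t ** mat_a)) (P t \<bullet> (X t ** mat_b))) (at t) \<and>
     (P has_vector_derivative - (P t ** hor (P t \<bullet> (X t ** mat_a)) (P t \<bullet> (X t ** mat_b)))) (at t))"
  unfolding normal_extremal_def
proof (intro iff_allI iffI)
  fix t
  assume "\<exists>X' P'. (X has_vector_derivative X') (at t) \<and> (P has_vector_derivative P') (at t) \<and>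
        (GDERIV (\<lambda>p. hamiltonian (X t) p) (P t) :> X') \<and> (GDERIV (\<lambda>x. hamiltonian x (P t)) (X t) :> - P')"
  then obtain X' P' where d: "(X has_vector_derivative X') (at t)" "(P has_vector_derivative P') (at t)"
    and G: "GDERIV (\<lambda>p. hamiltonian (X t) p) (P t) :> X'" "GDERIV (\<lambda>x. hamiltonian x (P t)) (X t) :> - P'" by blast
  have "X' = X t ** hor (P t \<bullet> (X t ** mat_a)) (P t \<bullet> (X t ** mat_b))"
    by (rule GDERIV_unique[OF G(1) GDERIV_hamiltonian(1)])
  moreover have "- P' = P t ** hor (P t \<bullet> (X t ** mat_a)) (P t \<bullet> (X t ** mat_b))"
    by (rule GDERIV_unique[OF G(2) GDERIV_hamiltonian(2)])
  then have "P' = - (P t ** hor (P t \<bullet> (X t ** mat_a)) (P t \<bullet> (X t ** mat_b)))" by (metis minus_minus)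
  ultimately show "(X has_vector_derivative X t ** hor (P t \<bullet> (X t ** mat_a)) (P t \<bullet> (X t ** mat_b))) (at t) \<and>
     (P has_vector_derivative - (P t ** hor (P t \<bullet> (X t ** mat_a)) (P t \<bullet> (X t ** mat_b)))) (at t)"
    using d by simp
next
  fix t
  assume "(X has_vector_derivative X t ** hor (P t \<bullet> (X t ** mat_a)) (P t \<bullet> (X t ** mat_b))) (at t) \<and>
     (P has_vector_derivative - (P t ** hor (P t \<bullet> (X t ** mat_a)) (P t \<bullet> (X t ** mat_b)))) (at t)"
  then show "\<exists>X' P'. (X has_vector_derivative X') (at t) \<and> (P has_vector_derivative P') (at t) \<and>
        (GDERIV (\<lambda>p. hamiltonian (X t) p) (P t) :> X') \<and> (GDERIV (\<lambda>x. hamiltonian x (P t)) (X t) :> - P')"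
    using GDERIV_hamiltonian by (metis minus_minus)
qed

text \<open>The structure constants of so(2,1). They turn the momenta along \<open>mat_a\<close>,
  \<open>mat_b\<close> and \<open>mat_c\<close> into a closed system of differential
  equations.\<close>

lemma commutators:
  "hor p q ** mat_a - mat_a ** hor p q = q *\<^sub>R mat_c"
  "hor p q ** mat_b - mat_b ** hor p q = - p *\<^sub>R mat_c"
  "hor p q ** mat_c - mat_c ** hor p q = q *\<^sub>R mat_a - p *\<^sub>R mat_b"
  by (simp_all add: hor_entry mat3_simps)

lemma gexp_0 [simp]: "gexp 0 0 0 = mat 1"
  using geo_0[of 0 0] by (simp add: geo_def)

text \<open>The momentum along \<open>mat_c\<close> is conserved, and it makes the other two rotate
  uniformly. The control is thereby known, and \<open>X\<close> solves the same linear equation as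
  \<open>gexp\<close> along the ray, so the quotient \<open>Y\<close> is constant.\<close>

lemma normal_extremal_unique:
  assumes ne: "normal_extremal X P" and x: "X 0 \<in> SO21"
    and i: "P 0 \<bullet> (X 0 ** mat_a) = u1" "P 0 \<bullet> (X 0 ** mat_b) = u2" "P 0 \<bullet> (X 0 ** mat_c) = B"
  shows "X t = X 0 ** gexp (t * u1) (t * u2) (t * B)"
proof -
  define ha where "ha t = P t \<bullet> (X t ** mat_a)" for t
  define hb where "hb t = P t \<bullet> (X t ** mat_b)" for t
  define hc where "hc t = P t \<bullet> (X t ** mat_c)" for t
  have d: "(X has_vector_derivative X t ** hor (ha t) (hb t)) (at t)"
    "(P has_vector_derivative - (P t ** hor (ha t) (hb t))) (at t)" for t
    using ne unfolding normal_extremal_iff ha_def hb_def by blast+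
  have hm: "((\<lambda>t. P t \<bullet> (X t ** m)) has_real_derivative P t \<bullet> (X t ** (hor (ha t) (hb t) ** m - m ** hor (ha t) (hb t)))) (at t)" for t m
  proof -
    have "((\<lambda>t. X t ** m) has_vector_derivative X t ** hor (ha t) (hb t) ** m) (at t)"
      using has_vector_derivative_matmul[OF d(1) has_vector_derivative_const[of m]] by simp
    from bounded_bilinear.has_vector_derivative[OF bounded_bilinear_inner d(2) this]
    have "((\<lambda>t. P t \<bullet> (X t ** m)) has_vector_derivative
        P t \<bullet> (X t ** hor (ha t) (hb t) ** m) + - (P t ** hor (ha t) (hb t)) \<bullet> (X t ** m)) (at t)" .
    moreover have "P t \<bullet> (X t ** hor (ha t) (hb t) ** m) + - (P t ** hor (ha t) (hb t)) \<bullet> (X t ** m)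
       = P t \<bullet> (X t ** (hor (ha t) (hb t) ** m - m ** hor (ha t) (hb t)))"
      by (simp add: inner_mult_right matmul_linear inner_diff_right matrix_mul_assoc)
    ultimately show ?thesis by (simp add: has_real_derivative_iff_has_vector_derivative)
  qed
  have dh: "(ha has_real_derivative hb t * hc t) (at t)" "(hb has_real_derivative - ha t * hc t) (at t)"
    "(hc has_real_derivative 0) (at t)" for t
    using hm[of mat_a t] hm[of mat_b t] hm[of mat_c t]
    unfolding commutators matmul_linear inner_scaleR_right inner_diff_right
      ha_def[symmetric] hb_def[symmetric] hc_def[symmetric]
    by simp_all
  have "hc t = hc 0" for t using DERIV_isconst_all[of hc] dh(3) by blast
  then have hc: "hc t = B" for t using i by (simp add: hc_def)
  have r: "((\<lambda>t. t * B) has_real_derivative B) (at t)" for t by (auto intro!: derivative_eq_intros)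
  have dc: "((\<lambda>t. cos (t * B)) has_real_derivative - sin (t * B) * B) (at t)"
    "((\<lambda>t. sin (t * B)) has_real_derivative cos (t * B) * B) (at t)" for t
    using DERIV_chain2[OF DERIV_cos r] DERIV_chain2[OF DERIV_sin r] by auto
  have f: "ha t * cos (t * B) - hb t * sin (t * B) = u1" for t
  proof -
    have "((\<lambda>t. ha t * cos (t * B) - hb t * sin (t * B)) has_real_derivative 0) (at t)" for t
      by (rule DERIV_cong[OF DERIV_diff[OF DERIV_mult[OF dh(1) dc(1)] DERIV_mult[OF dh(2) dc(2)]]])
        (simp add: hc algebra_simps)
    then have "ha t * cos (t * B) - hb t * sin (t * B) = ha 0 * cos (0 * B) - hb 0 * sin (0 * B)"
      using DERIV_isconst_all by blast
    then show ?thesis using i by (simp add: ha_def)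
  qed
  have g: "ha t * sin (t * B) + hb t * cos (t * B) = u2" for t
  proof -
    have "((\<lambda>t. ha t * sin (t * B) + hb t * cos (t * B)) has_real_derivative 0) (at t)" for t
      by (rule DERIV_cong[OF DERIV_add[OF DERIV_mult[OF dh(1) dc(2)] DERIV_mult[OF dh(2) dc(1)]]])
        (simp add: hc algebra_simps)
    then have "ha t * sin (t * B) + hb t * cos (t * B) = ha 0 * sin (0 * B) + hb 0 * cos (0 * B)"
      using DERIV_isconst_all by blast
    then show ?thesis using i by (simp add: hb_def)
  qed
  have hab: "ha t = u1 * cos (t * B) + u2 * sin (t * B)" "hb t = u2 * cos (t * B) - u1 * sin (t * B)" for t
  proof -
    define c s where "c = cos (t * B)" and "s = sin (t * B)"
    have cs: "c\<^sup>2 + s\<^sup>2 = 1" by (simp add: c_def s_def)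
    have f: "u1 = ha t * c - hb t * s" and g: "u2 = ha t * s + hb t * c"
      using f[of t] g[of t] by (simp_all add: c_def s_def)
    have "u1 * c + u2 * s = ha t * (c\<^sup>2 + s\<^sup>2)" "u2 * c - u1 * s = hb t * (c\<^sup>2 + s\<^sup>2)"
      unfolding f g by (simp_all add: algebra_simps power2_eq_square)
    then show "ha t = u1 * cos (t * B) + u2 * sin (t * B)" "hb t = u2 * cos (t * B) - u1 * sin (t * B)"
      unfolding cs by (simp_all add: c_def s_def)
  qed
  define g where "g t = gexp (t * u1) (t * u2) (t * B)" for t
  have dg: "(g has_vector_derivative g t ** hor (ha t) (hb t)) (at t)" for t
    unfolding g_def hab by (rule gexp_deriv)
  define Y where "Y t = X t ** linv (g t)" for t
  have "(Y has_vector_derivative 0) (at t)" for t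
  proof -
    have "((\<lambda>t. linv (g t)) has_vector_derivative linv (g t ** hor (ha t) (hb t))) (at t)"
      by (rule bounded_linear.has_vector_derivative[OF bounded_linear_linv dg])
    from has_vector_derivative_matmul[OF d(1) this]
    have "(Y has_vector_derivative X t ** (linv (hor (ha t) (hb t)) ** linv (g t)) + X t ** hor (ha t) (hb t) ** linv (g t)) (at t)"
      by (simp add: Y_def[abs_def] linv_mult)
    moreover have "X t ** (linv (hor (ha t) (hb t)) ** linv (g t)) + X t ** hor (ha t) (hb t) ** linv (g t) = 0"
      unfolding linv_hor using matmul_linear(5)[of "X t" "-1" "hor (ha t) (hb t) ** linv (g t)"]
        matmul_linear(6)[of "-1" "hor (ha t) (hb t)" "linv (g t)"]
      by (simp add: matrix_mul_assoc)
    ultimately show ?thesis by simp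
  qed
  then have "Y t = Y 0"
    using has_vector_derivative_zero_constant[of UNIV Y] by (metis UNIV_I convex_UNIV)
  moreover have "Y 0 = X 0" unfolding Y_def g_def by (simp add: linv_def one_entry transpose_mat)
  ultimately have "X t ** linv (g t) = X 0" by (simp add: Y_def)
  then have "X t ** (linv (g t) ** g t) = X 0 ** g t" by (simp add: matrix_mul_assoc)
  then show ?thesis using SO21_linv(2)[OF gexp_in_SO21] by (simp add: g_def)
qed

text \<open>The covector is the coadjoint transport of a fixed momentum \<open>Z\<close>. The factor
  \<open>E\<close> of \<open>g t\<close> commutes with \<open>Z\<close>, so only the rotation acts
  on the momenta and yields the control of \<open>gexp_deriv\<close>. The 1/2 in \<open>Z\<close>
  offsets the squared norm 2 of the basis matrices.\<close>

lemma normal_extremal_exists: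
  assumes x: "x \<in> SO21"
  obtains X P where "normal_extremal X P" "X 0 = x" "\<And>w. P 0 \<bullet> (x ** w) = transpose (gen u1 u2 B) \<bullet> w / 2"
proof -
  define g where "g t = gexp (t * u1) (t * u2) (t * B)" for t
  have gS: "g t \<in> SO21" for t by (simp add: g_def gexp_in_SO21)
  define Z where "Z = (1 / 2) *\<^sub>R gen u1 u2 B"
  define X where "X t = x ** g t" for t
  define P where "P t = transpose (linv (g t) ** (Z ** linv x))" for t
  define ha hb where "ha t = u1 * cos (t * B) + u2 * sin (t * B)" and "hb t = u2 * cos (t * B) - u1 * sin (t * B)" for t
  have dg: "(g has_vector_derivative g t ** hor (ha t) (hb t)) (at t)" for t
    unfolding g_def ha_def hb_def by (rule gexp_deriv)
  have PX: "P t \<bullet> (X t ** m) = transpose Z \<bullet> (rot (t * B) ** m ** linv (rot (t * B)))" for t m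
  proof -
    define k where "k = B\<^sup>2 - u1\<^sup>2 - u2\<^sup>2"
    define p r where "p = 2 * sn k t * cs k t" and "r = 2 * (sn k t)\<^sup>2"
    define E where "E = pexp p r (gen u1 u2 B)"
    have gE: "g t = E ** rot (t * B)" unfolding g_def E_def p_def r_def by (rule gexp_ray[OF k_def])
    have comm: "Z ** E = E ** Z"
      unfolding Z_def E_def pexp_def by (simp add: matmul_linear matrix_mul_assoc algebra_simps)
    have "linv (rot (t * B)) ** linv E ** (E ** rot (t * B)) = mat 1"
      using SO21_linv(2)[OF gS[of t]] unfolding gE linv_mult .
    then have "rot (t * B) ** (linv (rot (t * B)) ** linv E ** (E ** rot (t * B))) ** linv (rot (t * B)) = mat 1"
      using SO21_linv(1)[OF rot_in_SO21] by simp
    then have E1: "linv E ** E = mat 1"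
      using SO21_linv(1)[OF rot_in_SO21, of "t * B"] by (metis matrix_mul_assoc matrix_mul_lid matrix_mul_rid)
    have "P t \<bullet> (X t ** m) = transpose (Z ** linv x) \<bullet> (X t ** m ** linv (g t))"
      unfolding P_def matrix_transpose_mul[of "linv (g t)"] inner_mult_right by (simp add: transpose_transpose)
    also have "\<dots> = transpose Z \<bullet> (linv x ** (X t ** m ** linv (g t)))"
      unfolding matrix_transpose_mul inner_mult_left by (simp add: transpose_transpose)
    also have "linv x ** (X t ** m ** linv (g t)) = g t ** m ** linv (g t)"
      using SO21_cancel(1)[OF x, of "g t ** (m ** linv (g t))"] by (simp add: X_def matrix_mul_assoc)
    also have "\<dots> = E ** (rot (t * B) ** m ** linv (rot (t * B))) ** linv E"
      unfolding gE linv_mult by (simp add: matrix_mul_assoc)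
    also have "transpose Z \<bullet> \<dots> = transpose (linv E ** Z ** E) \<bullet> (rot (t * B) ** m ** linv (rot (t * B)))"
      by (rule inner_conjugate)
    also have "linv E ** Z ** E = Z"
      using E1 comm by (metis matrix_mul_assoc matrix_mul_lid)
    finally show ?thesis .
  qed
  have h: "P t \<bullet> (X t ** mat_a) = ha t" "P t \<bullet> (X t ** mat_b) = hb t" for t
    unfolding PX ha_def hb_def Z_def gen_entry rot_def linv_def
    by (simp_all add: mat3_simps algebra_simps)
  have "normal_extremal X P"
    unfolding normal_extremal_iff h
  proof (intro allI conjI)
    fix t
    show "(X has_vector_derivative X t ** hor (ha t) (hb t)) (at t)"
      unfolding X_def using has_vector_derivative_left[OF dg] by (simp add: matrix_mul_assoc)
    have "((\<lambda>t. linv (g t)) has_vector_derivative linv (g t ** hor (ha t) (hb t))) (at t)"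
      by (rule bounded_linear.has_vector_derivative[OF bounded_linear_linv dg])
    from has_vector_derivative_matmul[OF this has_vector_derivative_const[of "Z ** linv x"]]
    have "((\<lambda>t. linv (g t) ** (Z ** linv x)) has_vector_derivative - hor (ha t) (hb t) ** linv (g t) ** (Z ** linv x)) (at t)"
      by (simp add: linv_mult linv_hor)
    from bounded_linear.has_vector_derivative[OF bounded_linear_transpose3 this]
    have "(P has_vector_derivative transpose (- hor (ha t) (hb t) ** linv (g t) ** (Z ** linv x))) (at t)"
      by (simp add: P_def[abs_def])
    moreover have "transpose (- hor (ha t) (hb t) ** linv (g t) ** (Z ** linv x)) = - (P t ** hor (ha t) (hb t))"
    proof -
      have "- hor (ha t) (hb t) ** linv (g t) ** (Z ** linv x) = (-1) *\<^sub>R (hor (ha t) (hb t) ** (linv (g t) ** (Z ** linv x)))"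
        using matmul_linear(6)[of "-1" "hor (ha t) (hb t)" "linv (g t) ** (Z ** linv x)"] by (simp add: matrix_mul_assoc)
      then show ?thesis
        by (simp add: P_def matrix_transpose_mul[of "hor (ha t) (hb t)"] bounded_linear.linear[OF bounded_linear_transpose3, THEN linear_neg])
    qed
    ultimately show "(P has_vector_derivative - (P t ** hor (ha t) (hb t))) (at t)" by simp
  qed
  moreover have "X 0 = x" by (simp add: X_def g_def)
  moreover have "P 0 \<bullet> (x ** w) = transpose (gen u1 u2 B) \<bullet> w / 2" for w
  proof -
    have "rot 0 = mat 1" by (simp add: rot_def mat3_eq_iff one_entry)
    moreover have "linv (mat 1) = mat 1" by (simp add: linv_def transpose_mat)
    ultimately have "P 0 \<bullet> (X 0 ** w) = transpose Z \<bullet> w" unfolding PX by simp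
    also have "\<dots> = transpose (gen u1 u2 B) \<bullet> w / 2"
      by (simp add: Z_def inner_mat3 transpose_entry algebra_simps add_divide_distrib)
    finally show ?thesis by (simp add: X_def g_def)
  qed
  ultimately show ?thesis using that by blast
qed

section \<open>Closed form of the exponential map\<close>

lemma tangentE:
  assumes "v \<in> tangent x" obtains p q r where "v = x ** (p *\<^sub>R mat_a + q *\<^sub>R mat_b + r *\<^sub>R mat_c)"
proof -
  obtain A where A: "v = x ** A" "A \<in> span {mat_a, mat_b, mat_c}" using assms by (auto simp: tangent_def)
  then obtain p where "A - p *\<^sub>R mat_a \<in> span {mat_b, mat_c}" by (auto simp: span_insert)
  then obtain q where "A - p *\<^sub>R mat_a - q *\<^sub>R mat_b \<in> span {mat_c}" by (auto simp: span_insert)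
  then obtain r where "A - p *\<^sub>R mat_a - q *\<^sub>R mat_b = r *\<^sub>R mat_c" by (auto simp: span_singleton)
  then have "A = p *\<^sub>R mat_a + q *\<^sub>R mat_b + r *\<^sub>R mat_c" by (simp add: algebra_simps)
  then show ?thesis using that A by blast
qed

lemma tangentI: "x ** (p *\<^sub>R mat_a + q *\<^sub>R mat_b + r *\<^sub>R mat_c) \<in> tangent x"
  unfolding tangent_def by (intro imageI span_add span_scale span_base) auto

text \<open>The condition on \<open>tangent x\<close> amounts to prescribing the three momenta u1,
  u2 and B, the last being the linear coordinate of \<psi> on the annihilator. Existence and
  uniqueness of the extremal then evaluate the definite description.\<close>

lemma sr_exp_eq:
  assumes x: "x \<in> SO21" and \<psi>: "\<psi> \<in> Ann x"
  shows "sr_exp x (x ** hor u1 u2, \<psi>) = x ** gexp u1 u2 (\<psi> \<bullet> (x ** mat_c))"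
proof -
  define B where "B = \<psi> \<bullet> (x ** mat_c)"
  have ann: "\<psi> \<bullet> (x ** mat_a) = 0" "\<psi> \<bullet> (x ** mat_b) = 0"
  proof -
    have "x ** mat_a \<in> distr x" "x ** mat_b \<in> distr x"
      unfolding distr_def by (auto intro: span_base)
    then show "\<psi> \<bullet> (x ** mat_a) = 0" "\<psi> \<bullet> (x ** mat_b) = 0" using \<psi> by (auto simp: Ann_def)
  qed
  have rhs: "sr_inner x (x ** hor u1 u2) (x ** (p *\<^sub>R mat_a + q *\<^sub>R mat_b + r *\<^sub>R mat_c)) +
      \<psi> \<bullet> (x ** (p *\<^sub>R mat_a + q *\<^sub>R mat_b + r *\<^sub>R mat_c)) = u1 * p + u2 * q + B * r" for p q r
  proof -
    have "hor u1 u2 \<bullet> (p *\<^sub>R mat_a + q *\<^sub>R mat_b + r *\<^sub>R mat_c) = 2 * (u1 * p + u2 * q)"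
      by (simp add: hor_entry mat3_simps)
    then show ?thesis
      unfolding sr_inner_def SO21_linv(3)[OF x] SO21_cancel(1)[OF x]
      by (simp add: matmul_linear inner_add_right ann B_def)
  qed
  show ?thesis
    unfolding sr_exp_def prod.case B_def[symmetric]
  proof (rule the_equality)
    obtain X P where ne: "normal_extremal X P" "X 0 = x"
      and P0: "\<And>w. P 0 \<bullet> (x ** w) = transpose (gen u1 u2 B) \<bullet> w / 2"
      using normal_extremal_exists[OF x] by blast
    have i: "P 0 \<bullet> (x ** (p *\<^sub>R mat_a + q *\<^sub>R mat_b + r *\<^sub>R mat_c)) = u1 * p + u2 * q + B * r" for p q r
      unfolding P0 by (simp add: gen_entry mat3_simps field_simps)
    have "X 1 = X 0 ** gexp (1 * u1) (1 * u2) (1 * B)"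
      by (rule normal_extremal_unique[OF ne(1)]) (use x ne i[of 1 0 0] i[of 0 1 0] i[of 0 0 1] in simp_all)
    then show "\<exists>X P. normal_extremal X P \<and> X 0 = x \<and>
      (\<forall>v\<in>tangent x. P 0 \<bullet> v = sr_inner x (x ** hor u1 u2) v + \<psi> \<bullet> v) \<and> X 1 = x ** gexp u1 u2 B"
      using ne i rhs by (intro exI[of _ X] exI[of _ P]) (auto elim!: tangentE)
  next
    fix y assume "\<exists>X P. normal_extremal X P \<and> X 0 = x \<and>
      (\<forall>v\<in>tangent x. P 0 \<bullet> v = sr_inner x (x ** hor u1 u2) v + \<psi> \<bullet> v) \<and> X 1 = y"
    then obtain X P where ne: "normal_extremal X P" "X 0 = x" "X 1 = y"
      and P0: "\<And>v. v \<in> tangent x \<Longrightarrow> P 0 \<bullet> v = sr_inner x (x ** hor u1 u2) v + \<psi> \<bullet> v" by blast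
    have i: "P 0 \<bullet> (x ** (p *\<^sub>R mat_a + q *\<^sub>R mat_b + r *\<^sub>R mat_c)) = u1 * p + u2 * q + B * r" for p q r
      unfolding P0[OF tangentI] by (rule rhs)
    have "X 1 = X 0 ** gexp (1 * u1) (1 * u2) (1 * B)"
      by (rule normal_extremal_unique[OF ne(1)]) (use x ne i[of 1 0 0] i[of 0 1 0] i[of 0 0 1] in simp_all)
    then show "y = x ** gexp u1 u2 B" using ne by simp
  qed
qed

section \<open>Critical points\<close>

text \<open>For the entrywise inner product \<open>x ** mat_c\<close> is in general not orthogonal
  to \<open>distr x\<close>. Its orthogonal component \<open>z\<close> spans the annihilator: an
  element that also annihilates \<open>x ** mat_c\<close> is orthogonal to itself.\<close>

lemma ann_generator:
  assumes x: "x \<in> SO21"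
  obtains n where "n \<in> Ann x" "n \<bullet> (x ** mat_c) = 1" "\<forall>\<psi>\<in>Ann x. \<psi> = (\<psi> \<bullet> (x ** mat_c)) *\<^sub>R n"
    "\<forall>r. r *\<^sub>R n \<in> Ann x"
proof -
  have sub: "subspace (Ann x)"
    unfolding subspace_def Ann_def
  proof (intro conjI ballI allI)
    have t: "tangent x = (\<lambda>A. x ** A) ` span {mat_a, mat_b, mat_c}" by (simp add: tangent_def)
    have "subspace (tangent x)" unfolding t
      by (rule linear_subspace_image) (simp_all add: linear_iff matmul_linear)
    then show "0 \<in> {\<psi> \<in> tangent x. \<forall>v\<in>distr x. \<psi> \<bullet> v = 0}"
      and "\<And>\<psi> \<phi>. \<psi> \<in> {\<psi> \<in> tangent x. \<forall>v\<in>distr x. \<psi> \<bullet> v = 0} \<Longrightarrow> \<phi> \<in> {\<psi> \<in> tangent x. \<forall>v\<in>distr x. \<psi> \<bullet> v = 0} \<Longrightarrow>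
        \<psi> + \<phi> \<in> {\<psi> \<in> tangent x. \<forall>v\<in>distr x. \<psi> \<bullet> v = 0}"
      and "\<And>c \<psi>. \<psi> \<in> {\<psi> \<in> tangent x. \<forall>v\<in>distr x. \<psi> \<bullet> v = 0} \<Longrightarrow> c *\<^sub>R \<psi> \<in> {\<psi> \<in> tangent x. \<forall>v\<in>distr x. \<psi> \<bullet> v = 0}"
      by (auto simp: subspace_def inner_add_left)
  qed
  have perp: "\<psi> \<bullet> (x ** mat_a) = 0" "\<psi> \<bullet> (x ** mat_b) = 0" if "\<psi> \<in> Ann x" for \<psi>
  proof -
    have "x ** mat_a \<in> distr x" "x ** mat_b \<in> distr x" unfolding distr_def by (auto intro: span_base)
    then show "\<psi> \<bullet> (x ** mat_a) = 0" "\<psi> \<bullet> (x ** mat_b) = 0" using that by (auto simp: Ann_def)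
  qed
  have zero: "\<psi> = 0" if \<psi>: "\<psi> \<in> Ann x" and c: "\<psi> \<bullet> (x ** mat_c) = 0" for \<psi>
  proof -
    have "\<psi> \<in> tangent x" using \<psi> by (simp add: Ann_def)
    then obtain p q r where "\<psi> = x ** (p *\<^sub>R mat_a + q *\<^sub>R mat_b + r *\<^sub>R mat_c)" by (rule tangentE)
    then have "\<psi> \<bullet> \<psi> = \<psi> \<bullet> (x ** (p *\<^sub>R mat_a + q *\<^sub>R mat_b + r *\<^sub>R mat_c))" by simp
    also have "\<dots> = 0" using perp[OF \<psi>] c by (simp add: matmul_linear inner_add_right)
    finally show ?thesis by simp
  qed
  obtain y z where yz: "y \<in> span {x ** mat_a, x ** mat_b}" "\<And>w. w \<in> span {x ** mat_a, x ** mat_b} \<Longrightarrow> orthogonal z w"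
    "x ** mat_c = y + z" using orthogonal_subspace_decomp_exists[of "{x ** mat_a, x ** mat_b}" "x ** mat_c"] by blast
  have sp: "x ** hor p q \<in> span {x ** mat_a, x ** mat_b}" for p q
    unfolding hor_def matmul_linear by (intro span_add span_scale span_base) auto
  obtain p q where y: "y = x ** hor p q"
  proof -
    obtain k where "y - k *\<^sub>R (x ** mat_a) \<in> span {x ** mat_b}" using yz(1) by (auto simp: span_insert)
    then obtain l where "y - k *\<^sub>R (x ** mat_a) = l *\<^sub>R (x ** mat_b)" by (auto simp: span_singleton)
    then have "y = x ** hor k l" by (simp add: hor_def matmul_linear algebra_simps)
    then show ?thesis by (rule that)
  qed
  have z: "z = x ** (mat_c - hor p q)" using yz(3) unfolding y by (simp add: matmul_linear algebra_simps)
  have zA: "z \<in> Ann x"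
  proof -
    have "mat_c - hor p q = (- p) *\<^sub>R mat_a + (- q) *\<^sub>R mat_b + 1 *\<^sub>R mat_c" by (simp add: hor_def)
    then have "z \<in> tangent x" unfolding z by (simp only: tangentI)
    moreover have "z \<bullet> v = 0" if "v \<in> distr x" for v
      using that yz(2) sp unfolding distr_eq orthogonal_def by auto
    ultimately show ?thesis by (simp add: Ann_def)
  qed
  have "mat_c \<noteq> hor p q" by (simp add: hor_entry mat3_simps)
  then have "z \<noteq> 0" unfolding z using left_cancel[OF x, of "mat_c - hor p q" 0] by simp
  then have z0: "z \<bullet> (x ** mat_c) \<noteq> 0" using zero[OF zA] by blast
  define n where "n = (1 / (z \<bullet> (x ** mat_c))) *\<^sub>R z"
  have nA: "r *\<^sub>R n \<in> Ann x" for r unfolding n_def using zA sub by (simp add: subspace_scale)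
  have n1: "n \<bullet> (x ** mat_c) = 1" using z0 by (simp add: n_def)
  have "\<psi> = (\<psi> \<bullet> (x ** mat_c)) *\<^sub>R n" if "\<psi> \<in> Ann x" for \<psi>
  proof -
    have "\<psi> - (\<psi> \<bullet> (x ** mat_c)) *\<^sub>R n \<in> Ann x" using sub that nA by (intro subspace_diff) auto
    moreover have "(\<psi> - (\<psi> \<bullet> (x ** mat_c)) *\<^sub>R n) \<bullet> (x ** mat_c) = 0" by (simp add: inner_diff_left n1)
    ultimately show ?thesis using zero by fastforce
  qed
  then show ?thesis using that nA[of 1] nA n1 by simp
qed

section \<open>Rank of the exponential map in three real coordinates\<close>

definition gexpv :: "real \<times> real \<times> real \<Rightarrow> mat3" where
  "gexpv v = gexp (fst v) (fst (snd v)) (snd (snd v))"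

lemma differentiable_matmul:
  assumes "f differentiable (at x)" "g differentiable (at x)"
  shows "(\<lambda>x. (f x :: mat3) ** (g x :: mat3)) differentiable (at x)"
  using assms bounded_bilinear.FDERIV[OF bounded_bilinear_matmul] unfolding differentiable_def by blast

lemma differentiable_real_compose:
  fixes g :: "'a::real_normed_vector \<Rightarrow> real"
  assumes "(f has_real_derivative D) (at (g x))" "g differentiable (at x)"
  shows "(\<lambda>x. f (g x)) differentiable (at x)"
  by (rule differentiable_compose[OF _ assms(2)]) (use assms(1) in \<open>auto simp: has_field_derivative_def differentiable_def\<close>)

lemma gexpv_differentiable: "gexpv differentiable (at v)"
proof -
  have c: "(\<lambda>v :: real \<times> real \<times> real. fst v) differentiable (at v)"
    "(\<lambda>v :: real \<times> real \<times> real. fst (snd v)) differentiable (at v)"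
    "(\<lambda>v :: real \<times> real \<times> real. snd (snd v)) differentiable (at v)"
    by (intro bounded_linear_imp_differentiable bounded_linear_intros)+
  define q :: "real \<times> real \<times> real \<Rightarrow> real" where
    "q v = ((snd (snd v))\<^sup>2 - (fst v)\<^sup>2 - (fst (snd v))\<^sup>2) / 4" for v
  have q: "q differentiable (at v)" unfolding q_def by (intro derivative_intros c) simp
  have gen: "(\<lambda>v. gen (fst v) (fst (snd v)) (snd (snd v))) differentiable (at v)"
    unfolding gen_def hor_def by (intro differentiable_add differentiable_diff differentiable_scaleR differentiable_const c)
  \<comment> \<open>Rodrigues' formula displays \<open>rot\<close> as a combination of fixed
    matrices with smooth coefficients.\<close>
  have "rot B = mat 1 + (cos B - 1) *\<^sub>R (- (mat_c ** mat_c)) + sin B *\<^sub>R mat_c" for B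
    by (simp add: rot_def mat3_simps)
  then have rot: "(\<lambda>v :: real \<times> real \<times> real. rot (snd (snd v))) differentiable (at v)"
    by (simp only:) (intro differentiable_add differentiable_diff differentiable_scaleR differentiable_const c
        differentiable_real_compose[OF DERIV_cos] differentiable_real_compose[OF DERIV_sin])
  show ?thesis
    unfolding gexpv_def gexp_def Let_def pexp_def q_def[symmetric]
    by (intro differentiable_matmul differentiable_add differentiable_scaleR differentiable_const gen rot
        differentiable_mult differentiable_divide differentiable_power q
        differentiable_real_compose[OF DERIV_cosq] differentiable_real_compose[OF DERIV_sinq]) simp_all
qed

text \<open>Criticality expressed by a kernel vector: coordinates and tangent space both have
  dimension 3, so not being onto amounts to not being injective.\<close>

definition degenerate :: "real \<times> real \<times> real \<Rightarrow> bool" where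
  "degenerate v \<longleftrightarrow> (\<exists>D w. (gexpv has_derivative D) (at v) \<and> w \<noteq> 0 \<and> D w = 0)"

lemma gexpv_in_SO21: "gexpv v \<in> SO21"
  by (simp add: gexpv_def gexp_in_SO21)

lemma line_deriv:
  fixes f :: "'a::real_normed_vector \<Rightarrow> 'b::real_normed_vector"
  assumes F: "(f has_derivative F) (at p within S)" and l: "\<And>t. p + t *\<^sub>R h \<in> S"
  shows "((\<lambda>t. f (p + t *\<^sub>R h)) has_vector_derivative F h) (at 0)"
proof -
  have 1: "((\<lambda>t. p + t *\<^sub>R h) has_derivative (\<lambda>t. t *\<^sub>R h)) (at 0)"
    by (auto intro!: derivative_eq_intros)
  have "(f has_derivative F) (at (p + 0 *\<^sub>R h) within range (\<lambda>t. p + t *\<^sub>R h))"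
    using has_derivative_subset[OF F, of "range (\<lambda>t. p + t *\<^sub>R h)"] l by auto
  from has_derivative_in_compose[OF 1 this]
  have "((\<lambda>t. f (p + t *\<^sub>R h)) has_derivative (\<lambda>t. F (t *\<^sub>R h))) (at 0)" by simp
  moreover have "F (t *\<^sub>R h) = t *\<^sub>R F h" for t
    using has_derivative_bounded_linear[OF F] by (simp add: linear_cmul bounded_linear.linear)
  ultimately show ?thesis by (simp add: has_vector_derivative_def)
qed

text \<open>Differentiating linv Y ** Y = mat 1 gives A + linv A = 0 for A = linv Y ** Y', and these
  linear equations cut out the span of the three basis matrices.\<close>

lemma SO21_curve_tangent:
  assumes Y: "(Y has_vector_derivative Y') (at t)" and S: "\<And>t. Y t \<in> SO21"
  shows "Y' \<in> tangent (Y t)"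
proof -
  define A where "A = linv (Y t) ** Y'"
  have "((\<lambda>t. linv (Y t) ** Y t) has_vector_derivative linv (Y t) ** Y' + linv Y' ** Y t) (at t)"
    by (rule has_vector_derivative_matmul[OF bounded_linear.has_vector_derivative[OF bounded_linear_linv Y] Y])
  moreover have "(\<lambda>t. linv (Y t) ** Y t) = (\<lambda>_. mat 1)" using SO21_linv(2)[OF S] by auto
  ultimately have "linv (Y t) ** Y' + linv Y' ** Y t = 0"
    using vector_derivative_unique_at[of "\<lambda>_. mat 1" _ t 0] by simp
  moreover have "linv (linv C) = C" for C :: mat3 unfolding linv_def by (simp add: mat3_simps)
  ultimately have "A + linv A = 0" unfolding A_def linv_mult by simp
  then have e: "(A + linv A)$i$j = 0" for i j by simp
  have "A$1$1 = 0" "A$2$2 = 0" "A$3$3 = 0" "A$2$1 = A$1$2" "A$3$1 = A$1$3" "A$2$3 = - A$3$2"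
    using e[of 1 1] e[of 2 2] e[of 3 3] e[of 1 2] e[of 1 3] e[of 2 3]
    by (simp_all add: linv_def mult_entry transpose_entry I21_def)
  then have "A = A$1$2 *\<^sub>R mat_a + A$1$3 *\<^sub>R mat_b + A$3$2 *\<^sub>R mat_c"
    by (simp add: mat3_eq_iff mat_a_def mat_b_def mat_c_def)
  moreover have "Y' = Y t ** A" unfolding A_def using S by simp
  ultimately show ?thesis using tangentI[of "Y t" "A$1$2" "A$1$3" "A$3$2"] by metis
qed

text \<open>\<open>L\<close> reads off the three coordinates on \<open>tangent x\<close> and turns
  \<open>D\<close> into an endomorphism of a three-dimensional space.\<close>

lemma range_tangent_iff:
  fixes D :: "real \<times> real \<times> real \<Rightarrow> mat3"
  assumes x: "x \<in> SO21" and D: "linear D" and sub: "range D \<subseteq> tangent x"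
  shows "range D = tangent x \<longleftrightarrow> (\<forall>w. D w = 0 \<longrightarrow> w = 0)"
proof -
  define L :: "mat3 \<Rightarrow> real \<times> real \<times> real" where
    "L A = ((linv x ** A)$1$2, (linv x ** A)$1$3, (linv x ** A)$3$2)" for A
  have L: "linear L" unfolding L_def by (simp add: linear_iff matmul_linear)
  have Lx: "L (x ** (p *\<^sub>R mat_a + q *\<^sub>R mat_b + r *\<^sub>R mat_c)) = (p, q, r)" for p q r
    unfolding L_def SO21_cancel(1)[OF x] by (simp add: mat_a_def mat_b_def mat_c_def)
  have inj: "A = A'" if "A \<in> tangent x" "A' \<in> tangent x" "L A = L A'" for A A'
    using that by (auto elim!: tangentE simp: Lx)
  have surj: "L ` tangent x = UNIV"
  proof (intro equalityI subset_UNIV subsetI)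
    fix y :: "real \<times> real \<times> real"
    obtain p q r where "y = (p, q, r)" by (cases y)
    then show "y \<in> L ` tangent x" using Lx[of p q r] tangentI[of x p q r] by (metis imageI)
  qed
  have LD: "linear (L \<circ> D)" by (rule linear_compose[OF D L])
  have D0: "D 0 = 0" using linear_0[OF D] .
  have T0: "D w \<in> tangent x" for w using sub by auto
  show ?thesis
  proof
    assume "range D = tangent x"
    then have "L ` range D = UNIV" using surj by simp
    then have "surj (L \<circ> D)" by (simp only: image_comp)
    then have "inj (L \<circ> D)" by (rule linear_surjective_imp_injective[OF LD _ refl])
    show "\<forall>w. D w = 0 \<longrightarrow> w = 0"
    proof (intro allI impI)
      fix w assume "D w = 0"
      then have "(L \<circ> D) w = (L \<circ> D) 0" using D0 by simp
      then show "w = 0" by (rule injD[OF \<open>inj (L \<circ> D)\<close>])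
    qed
  next
    assume "\<forall>w. D w = 0 \<longrightarrow> w = 0"
    then have iD: "inj D" using linear_injective_0[OF D] by blast
    have "inj (L \<circ> D)"
    proof (rule injI)
      fix w w' assume "(L \<circ> D) w = (L \<circ> D) w'"
      then have "D w = D w'" by (intro inj T0) simp
      then show "w = w'" by (rule injD[OF iD])
    qed
    then have s: "surj (L \<circ> D)" by (rule linear_injective_imp_surjective[OF LD _ refl])
    show "range D = tangent x"
    proof
      show "tangent x \<subseteq> range D"
      proof
        fix A assume A: "A \<in> tangent x"
        obtain w where "L A = L (D w)" using surjD[OF s, of "L A"] by auto
        then have "A = D w" by (rule inj[OF A T0])
        then show "A \<in> range D" by simp
      qed
    qed (rule sub)
  qed
qed

lemma tangent_left: "tangent (x ** y) = (\<lambda>A. x ** A) ` tangent y"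
  unfolding tangent_def by (auto simp: image_image matrix_mul_assoc)

lemma degenerate_iff:
  assumes D: "(gexpv has_derivative D) (at v)"
  shows "degenerate v \<longleftrightarrow> range D \<noteq> tangent (gexpv v)"
proof -
  have lin: "linear D" using has_derivative_bounded_linear[OF D] by (rule bounded_linear.linear)
  have sub: "range D \<subseteq> tangent (gexpv v)"
  proof
    fix A assume "A \<in> range D"
    then obtain w where A: "A = D w" by auto
    have "((\<lambda>t. gexpv (v + t *\<^sub>R w)) has_vector_derivative D w) (at 0)" by (rule line_deriv[OF D]) simp
    from SO21_curve_tangent[OF this gexpv_in_SO21] show "A \<in> tangent (gexpv v)" by (simp add: A)
  qed
  have "degenerate v \<longleftrightarrow> (\<exists>w. w \<noteq> 0 \<and> D w = 0)"
  proof
    assume "degenerate v"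
    then obtain D' w where D': "(gexpv has_derivative D') (at v)" "w \<noteq> 0" "D' w = 0"
      unfolding degenerate_def by (elim exE conjE)
    have "D' = D" by (rule has_derivative_unique[OF D'(1) D])
    then show "\<exists>w. w \<noteq> 0 \<and> D w = 0" using D' by blast
  next
    assume "\<exists>w. w \<noteq> 0 \<and> D w = 0"
    then show "degenerate v" unfolding degenerate_def using D by blast
  qed
  then show ?thesis using range_tangent_iff[OF gexpv_in_SO21 lin sub] by auto
qed

text \<open>The domain is a three-dimensional subspace of a space of pairs of matrices, with
  coordinates \<open>c\<close>. A derivative within it is determined on the directions it contains,
  as restriction to lines shows, and criticality speaks of exactly these values.\<close>

lemma critical_point_iff:
  assumes x: "x \<in> SO21" and \<psi>: "\<psi> \<in> Ann x"
  shows "critical_point x (x ** hor u1 u2, \<psi>) \<longleftrightarrow> degenerate (u1, u2, \<psi> \<bullet> (x ** mat_c))"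
proof -
  define S where "S = distr x \<times> Ann x"
  define v where "v = (u1, u2, \<psi> \<bullet> (x ** mat_c))"
  define p where "p = (x ** hor u1 u2, \<psi>)"
  define c :: "mat3 \<times> mat3 \<Rightarrow> real \<times> real \<times> real" where
    "c p = ((linv x ** fst p)$1$2, (linv x ** fst p)$1$3, snd p \<bullet> (x ** mat_c))" for p
  have c_eq: "c (x ** hor a b, \<phi>) = (a, b, \<phi> \<bullet> (x ** mat_c))" for a b \<phi>
    using x by (simp add: c_def hor_entry)
  have c_lin: "bounded_linear c"
    unfolding linear_conv_bounded_linear[symmetric] c_def by (simp add: linear_iff matmul_linear inner_add_left)
  have pS: "p \<in> S" using \<psi> by (auto simp: S_def p_def distr_eq)
  obtain n where n1: "n \<in> Ann x" "n \<bullet> (x ** mat_c) = 1" and n2: "\<forall>\<psi>\<in>Ann x. \<psi> = (\<psi> \<bullet> (x ** mat_c)) *\<^sub>R n"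
    and n3: "\<forall>r. r *\<^sub>R n \<in> Ann x" by (rule ann_generator[OF x])
  note n = n1(2) spec[OF n3] bspec[OF n2]
  have S_eq: "S = range (\<lambda>w. (x ** hor (fst w) (fst (snd w)), snd (snd w) *\<^sub>R n))"
  proof (intro equalityI subsetI)
    fix s assume "s \<in> S"
    then obtain a b \<phi> where s: "s = (x ** hor a b, \<phi>)" "\<phi> \<in> Ann x" by (auto simp: S_def distr_eq)
    then have "s = (\<lambda>w. (x ** hor (fst w) (fst (snd w)), snd (snd w) *\<^sub>R n)) (a, b, \<phi> \<bullet> (x ** mat_c))"
      using n(3)[of \<phi>] by simp
    then show "s \<in> range (\<lambda>w. (x ** hor (fst w) (fst (snd w)), snd (snd w) *\<^sub>R n))" by (rule range_eqI)
  qed (auto simp: S_def distr_eq n(2))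
  have cS: "c ` S = UNIV"
    unfolding S_eq image_image c_eq by (auto simp: n(1) image_iff)
  have exp_eq: "sr_exp x s = x ** gexpv (c s)" if "s \<in> S" for s
    using that sr_exp_eq[OF x] by (auto simp: S_def distr_eq c_eq gexpv_def)
  obtain D where D: "(gexpv has_derivative D) (at v)" using gexpv_differentiable[of v] unfolding differentiable_def by blast
  have cp: "c p = v" by (simp add: p_def c_eq v_def)
  have F0: "(sr_exp x has_derivative (\<lambda>h. x ** D (c h))) (at p within S)"
  proof -
    have "(c has_derivative c) (at p within S)" by (rule bounded_linear_imp_has_derivative[OF c_lin])
    moreover have "(gexpv has_derivative D) (at (c p))" using D by (simp add: cp)
    ultimately have "((\<lambda>s. gexpv (c s)) has_derivative (\<lambda>h. D (c h))) (at p within S)"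
      by (rule has_derivative_compose)
    then have "((\<lambda>s. x ** gexpv (c s)) has_derivative (\<lambda>h. x ** D (c h))) (at p within S)"
      by (rule bounded_linear.has_derivative[OF bounded_bilinear.bounded_linear_right[OF bounded_bilinear_matmul]])
    then show ?thesis by (rule has_derivative_transform[OF pS, rotated]) (simp add: exp_eq)
  qed
  have line: "p + t *\<^sub>R h \<in> S" if hS: "h \<in> S" for h t
  proof -
    obtain w w' where "p = (x ** hor (fst w) (fst (snd w)), snd (snd w) *\<^sub>R n)"
      "h = (x ** hor (fst w') (fst (snd w')), snd (snd w') *\<^sub>R n)" using pS hS unfolding S_eq by blast
    then have "p + t *\<^sub>R h = (\<lambda>w. (x ** hor (fst w) (fst (snd w)), snd (snd w) *\<^sub>R n)) (w + t *\<^sub>R w')"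
      by (simp add: hor_def matmul_linear algebra_simps)
    then show ?thesis unfolding S_eq by (rule range_eqI)
  qed
  have FS: "F ` S = (\<lambda>A. x ** A) ` range D" if "(sr_exp x has_derivative F) (at p within S)" for F
  proof -
    have "F h = x ** D (c h)" if "h \<in> S" for h
      by (rule vector_derivative_unique_at[OF line_deriv[OF \<open>(sr_exp x has_derivative F) _\<close> line[OF that]]
            line_deriv[OF F0 line[OF that]]])
    then have "F ` S = (\<lambda>h. x ** D (c h)) ` S" by (rule image_cong[OF refl])
    also have "\<dots> = (\<lambda>A. x ** A) ` D ` c ` S" by (simp add: image_image)
    finally show ?thesis unfolding cS .
  qed
  have "critical_point x p \<longleftrightarrow> (\<lambda>A. x ** A) ` range D \<noteq> tangent (sr_exp x p)"
    unfolding critical_point_def S_def[symmetric] using pS F0 FS by blast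
  also have "\<dots> \<longleftrightarrow> (\<lambda>A. x ** A) ` range D \<noteq> (\<lambda>A. x ** A) ` tangent (gexpv v)"
    unfolding exp_eq[OF pS] cp tangent_left ..
  also have "\<dots> \<longleftrightarrow> range D \<noteq> tangent (gexpv v)"
    using inj_image_eq_iff[of "\<lambda>A. x ** A"] left_cancel[OF x] by (metis injI)
  also have "\<dots> \<longleftrightarrow> degenerate v" using degenerate_iff[OF D] by simp
  finally show ?thesis by (simp add: p_def v_def)
qed

section \<open>The conjugate sets in coordinates\<close>

lemma conjugate_set_eq:
  assumes x: "x \<in> SO21"
  shows "conjugate_set x = {x ** gexp u1 u2 B | u1 u2 B. (u1, u2) \<noteq> (0, 0) \<and> degenerate (u1, u2, B)}"
proof -
  obtain n where n1: "n \<in> Ann x" "n \<bullet> (x ** mat_c) = 1" and n2: "\<forall>\<psi>\<in>Ann x. \<psi> = (\<psi> \<bullet> (x ** mat_c)) *\<^sub>R n"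
    and n3: "\<forall>r. r *\<^sub>R n \<in> Ann x" by (rule ann_generator[OF x])
  note n = n1(2) spec[OF n3]
  have h0: "x ** hor u1 u2 = 0 \<longleftrightarrow> (u1, u2) = (0, 0)" for u1 u2
    using left_cancel[OF x, of "hor u1 u2" 0] by (auto simp: hor_entry mat3_eq_iff)
  show ?thesis
  proof (intro set_eqI iffI)
    fix y assume "y \<in> conjugate_set x"
    then obtain u \<psi> where y: "y = sr_exp x (u, \<psi>)" "u \<noteq> 0" "critical_point x (u, \<psi>)" by (auto simp: conjugate_set_def)
    then obtain u1 u2 where u: "u = x ** hor u1 u2" and \<psi>: "\<psi> \<in> Ann x" by (auto simp: critical_point_def distr_eq)
    show "y \<in> {x ** gexp u1 u2 B | u1 u2 B. (u1, u2) \<noteq> (0, 0) \<and> degenerate (u1, u2, B)}"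
      using y h0 critical_point_iff[OF x \<psi>, of u1 u2] sr_exp_eq[OF x \<psi>, of u1 u2] unfolding u by blast
  next
    fix y assume "y \<in> {x ** gexp u1 u2 B | u1 u2 B. (u1, u2) \<noteq> (0, 0) \<and> degenerate (u1, u2, B)}"
    then obtain u1 u2 B where y: "y = x ** gexp u1 u2 B" "(u1, u2) \<noteq> (0, 0)" "degenerate (u1, u2, B)" by blast
    have B: "(B *\<^sub>R n) \<bullet> (x ** mat_c) = B" using n by simp
    show "y \<in> conjugate_set x"
      unfolding conjugate_set_def
      using y h0[of u1 u2] critical_point_iff[OF x n(2)[of B], of u1 u2] sr_exp_eq[OF x n(2)[of B], of u1 u2] unfolding B
      by (intro CollectI exI[of _ "x ** hor u1 u2"] exI[of _ "B *\<^sub>R n"]) auto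
  qed
qed

theorem conjugate_set_left:
  assumes g: "g \<in> SO21" shows "conjugate_set g = (\<lambda>h. g ** h) ` conjugate_set (mat 1)"
  unfolding conjugate_set_eq[OF g] conjugate_set_eq[OF one_in_SO21] by auto

lemma first_conjugate_set_one_eq:
  "first_conjugate_set (mat 1) = {gexp u1 u2 B | u1 u2 B. (u1, u2) \<noteq> (0, 0) \<and> degenerate (u1, u2, B) \<and>
     (\<forall>s. 0 < s \<and> s < 1 \<longrightarrow> \<not> degenerate (s * u1, s * u2, s * B))} - {mat 1}"
proof -
  let ?x = "mat 1 :: mat3"
  obtain n where n1: "n \<in> Ann ?x" "n \<bullet> (?x ** mat_c) = 1" and n2: "\<forall>\<psi>\<in>Ann ?x. \<psi> = (\<psi> \<bullet> (?x ** mat_c)) *\<^sub>R n"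
    and n3: "\<forall>r. r *\<^sub>R n \<in> Ann ?x" by (rule ann_generator[OF one_in_SO21])
  note n = n1(2) spec[OF n3]
  have h0: "hor u1 u2 = 0 \<longleftrightarrow> (u1, u2) = (0, 0)" for u1 u2
    by (auto simp: hor_entry mat3_eq_iff)
  have crit: "critical_point ?x (hor u1 u2, \<psi>) \<longleftrightarrow> degenerate (u1, u2, \<psi> \<bullet> mat_c)"
    and ex: "sr_exp ?x (hor u1 u2, \<psi>) = gexp u1 u2 (\<psi> \<bullet> mat_c)" if "\<psi> \<in> Ann ?x" for u1 u2 \<psi>
    using critical_point_iff[OF one_in_SO21 that, of u1 u2] sr_exp_eq[OF one_in_SO21 that, of u1 u2] by simp_all
  have sc: "s *\<^sub>R hor u1 u2 = hor (s * u1) (s * u2)" for s u1 u2 by (simp add: hor_def algebra_simps)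
  have An: "s *\<^sub>R \<psi> \<in> Ann ?x" if "\<psi> \<in> Ann ?x" for s \<psi>
  proof -
    have "s *\<^sub>R \<psi> = (s * (\<psi> \<bullet> (?x ** mat_c))) *\<^sub>R n"
      by (subst bspec[OF n2 that]) simp
    then show ?thesis using n(2) by simp
  qed
  have ray: "critical_point ?x (s *\<^sub>R hor u1 u2, s *\<^sub>R \<psi>) \<longleftrightarrow> degenerate (s * u1, s * u2, s * (\<psi> \<bullet> mat_c))"
    if "\<psi> \<in> Ann ?x" for s u1 u2 \<psi>
    unfolding sc crit[OF An[OF that]] by simp
  have "{sr_exp ?x (u, \<psi>) | u \<psi>. u \<noteq> 0 \<and> critical_point ?x (u, \<psi>) \<and>
     (\<forall>s. 0 < s \<and> s < 1 \<longrightarrow> \<not> critical_point ?x (s *\<^sub>R u, s *\<^sub>R \<psi>))} =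
    {gexp u1 u2 B | u1 u2 B. (u1, u2) \<noteq> (0, 0) \<and> degenerate (u1, u2, B) \<and>
     (\<forall>s. 0 < s \<and> s < 1 \<longrightarrow> \<not> degenerate (s * u1, s * u2, s * B))}" (is "?L = ?R")
  proof (intro set_eqI iffI)
    fix y assume "y \<in> ?L"
    then obtain u \<psi> where y: "y = sr_exp ?x (u, \<psi>)" "u \<noteq> 0" "critical_point ?x (u, \<psi>)"
      "\<And>s. 0 < s \<Longrightarrow> s < 1 \<Longrightarrow> \<not> critical_point ?x (s *\<^sub>R u, s *\<^sub>R \<psi>)" by blast
    then obtain u1 u2 where u: "u = hor u1 u2" and \<psi>: "\<psi> \<in> Ann ?x" by (auto simp: critical_point_def distr_eq)
    show "y \<in> ?R"
      using y unfolding u h0 ex[OF \<psi>] crit[OF \<psi>] ray[OF \<psi>] by blast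
  next
    fix y assume "y \<in> ?R"
    then obtain u1 u2 B where y: "y = gexp u1 u2 B" "(u1, u2) \<noteq> (0, 0)" "degenerate (u1, u2, B)"
      "\<And>s. 0 < s \<Longrightarrow> s < 1 \<Longrightarrow> \<not> degenerate (s * u1, s * u2, s * B)" by blast
    define \<psi> where "\<psi> = B *\<^sub>R n"
    have \<psi>: "\<psi> \<in> Ann ?x" unfolding \<psi>_def by (rule n(2))
    have B: "\<psi> \<bullet> mat_c = B" using n(1) by (simp add: \<psi>_def)
    show "y \<in> ?L"
      using y unfolding h0[symmetric] B[symmetric] ex[OF \<psi>, symmetric] crit[OF \<psi>, symmetric] ray[OF \<psi>, symmetric] by blast
  qed
  then show ?thesis unfolding first_conjugate_set_def by simp
qed

section \<open>The first conjugate set\<close>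

lemma has_vector_derivative_Complex:
  assumes "(f has_real_derivative f') (at t)" "(g has_real_derivative g') (at t)"
  shows "((\<lambda>t. Complex (f t) (g t)) has_vector_derivative Complex f' g') (at t)"
  using assms by (simp add: has_vector_derivative_complex_iff)

text \<open>For a kernel direction (d1, d2, e), the derivative of \<open>wc\<close> gives two real
  equations for \<open>e\<close> and the variation \<open>dq\<close>. The real one says dq = B e /
  2; the imaginary one then reduces by \<open>sinq'_eq\<close> to sinq' q (u1^2 + u2^2) e = 0. Hence
  e = 0, and \<open>zc\<close> with sinq q > 0 gives d1 = d2 = 0. So the obstructions are the zeros
  of \<open>sinq\<close> and \<open>sinq'\<close>, and pi^2 is the first of them.\<close>

lemma nondegenerate:
  assumes u: "(u1, u2) \<noteq> (0, 0)" and q: "(B\<^sup>2 - u1\<^sup>2 - u2\<^sup>2) / 4 < pi\<^sup>2"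
  shows "\<not> degenerate (u1, u2, B)"
proof
  assume "degenerate (u1, u2, B)"
  then obtain D w where D: "(gexpv has_derivative D) (at (u1, u2, B))" "w \<noteq> 0" "D w = 0"
    unfolding degenerate_def by (elim exE conjE)
  obtain d1 d2 e where w: "w = (d1, d2, e)" by (cases w)
  define g where "g t = gexp (u1 + t * d1) (u2 + t * d2) (B + t * e)" for t
  have "((\<lambda>t. gexpv ((u1, u2, B) + t *\<^sub>R w)) has_vector_derivative D w) (at 0)"
    by (rule line_deriv[OF D(1)]) simp
  then have dg: "(g has_vector_derivative 0) (at 0)"
    by (simp add: g_def[abs_def] gexpv_def w D(3)[unfolded w])
  define Q where "Q t = ((B + t * e)\<^sup>2 - (u1 + t * d1)\<^sup>2 - (u2 + t * d2)\<^sup>2) / 4" for t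
  define q0 where "q0 = Q 0"
  define S C where "S = sinq q0" and "C = cosq q0"
  define dq where "dq = (B * e - u1 * d1 - u2 * d2) / 2"
  have q0: "q0 < pi\<^sup>2" using q by (simp add: q0_def Q_def)
  have S: "S > 0" using sinq_pos[OF q0] by (simp add: S_def)
  have S': "sinq' q0 < 0" using q0 by (intro sinq'_neg) simp
  have r: "((\<lambda>t. a + t * d) has_real_derivative d) (at 0)" for a d :: real
    by (auto intro!: derivative_eq_intros)
  have r2: "((\<lambda>t. (a + t * d)\<^sup>2) has_real_derivative 2 * a * d) (at 0)" for a d :: real
    by (rule DERIV_cong[OF DERIV_power[OF r, where n = 2]]) simp
  have dQ: "(Q has_real_derivative dq) (at 0)"
    unfolding Q_def
    by (rule DERIV_cong[OF DERIV_cdivide[OF DERIV_diff[OF DERIV_diff[OF r2 r2] r2]]]) (simp add: dq_def field_simps)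
  have dS: "((\<lambda>t. sinq (Q t)) has_real_derivative sinq' q0 * dq) (at 0)"
    and dC: "((\<lambda>t. cosq (Q t)) has_real_derivative - S / 2 * dq) (at 0)"
    using DERIV_chain2[OF DERIV_sinq dQ] DERIV_chain2[OF DERIV_cosq dQ] by (simp_all add: q0_def S_def)
  define X where "X t = Complex (cosq (Q t)) (- (B + t * e) * sinq (Q t) / 2)" for t
  define Xr Xi where "Xr = - S / 2 * dq" and "Xi = - (e * S + B * (sinq' q0 * dq)) / 2"
  have "((\<lambda>t. - (B + t * e) * sinq (Q t) / 2) has_real_derivative Xi) (at 0)"
    by (rule DERIV_cong[OF DERIV_cdivide[OF DERIV_mult[OF DERIV_minus[OF r] dS]]])
      (simp add: Xi_def S_def q0_def algebra_simps)
  then have dX: "(X has_vector_derivative Complex Xr Xi) (at 0)"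
    unfolding X_def using dC
    by (intro has_vector_derivative_Complex) (simp_all add: Xr_def)
  have X0: "X 0 \<noteq> 0"
  proof
    assume "X 0 = 0"
    then have "C = 0" "B * S = 0" by (auto simp: X_def C_def S_def q0_def complex_eq_iff)
    then have "B = 0" "C\<^sup>2 + q0 * S\<^sup>2 = q0 * S\<^sup>2" using S by auto
    moreover have "q0 * S\<^sup>2 \<le> 0" using \<open>B = 0\<close> by (simp add: q0_def Q_def mult_nonpos_nonneg)
    moreover have "C\<^sup>2 + q0 * S\<^sup>2 = 1" by (simp add: C_def S_def cosq_sinq)
    ultimately show False by simp
  qed
  have wg: "wc (g t) = 2 * (X t * X t) * cis (B + t * e)" for t
    unfolding g_def X_def by (subst wc_gexp[OF Q_def]) (simp add: power2_eq_square)
  have zg: "zc (g t) = Complex (u1 + t * d1) (u2 + t * d2) * (of_real (sinq (Q t)) * X t)" for t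
    unfolding g_def X_def by (subst zc_gexp[OF Q_def]) (simp add: complex_eq_iff power2_eq_square)
  have dcis: "((\<lambda>t. cis (B + t * e)) has_vector_derivative of_real e * (\<i> * cis (B + 0 * e))) (at 0)"
  proof -
    have "((\<lambda>t. Complex (cos (B + t * e)) (sin (B + t * e))) has_vector_derivative
        Complex (- sin (B + 0 * e) * e) (cos (B + 0 * e) * e)) (at 0)"
      by (intro has_vector_derivative_Complex)
        (use DERIV_chain2[OF DERIV_cos r] DERIV_chain2[OF DERIV_sin r] in auto)
    moreover have "Complex (- sin (B + 0 * e) * e) (cos (B + 0 * e) * e) = of_real e * (\<i> * cis (B + 0 * e))"
      by (simp add: complex_eq_iff)
    ultimately show ?thesis by (simp add: cis.code)
  qed
  have "((\<lambda>t. wc (g t)) has_vector_derivative 0) (at 0)"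
    using bounded_linear.has_vector_derivative[OF linear_wc dg]
    unfolding linear_0[OF bounded_linear.linear[OF linear_wc]] .
  moreover have "((\<lambda>t. wc (g t)) has_vector_derivative
      2 * (X 0 * X 0) * (of_real e * (\<i> * cis (B + 0 * e))) + 2 * (X 0 * Complex Xr Xi + Complex Xr Xi * X 0) * cis (B + 0 * e)) (at 0)"
    unfolding wg by (intro has_vector_derivative_mult has_vector_derivative_mult_right dX dcis)
  ultimately have "2 * (X 0 * X 0) * (of_real e * (\<i> * cis (B + 0 * e))) + 2 * (X 0 * Complex Xr Xi + Complex Xr Xi * X 0) * cis (B + 0 * e) = 0"
    by (rule vector_derivative_unique_at[symmetric])
  then have "2 * X 0 * cis B * (X 0 * of_real e * \<i> + 2 * Complex Xr Xi) = 0"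
    by (simp add: algebra_simps)
  then have "X 0 * of_real e * \<i> + 2 * Complex Xr Xi = 0" using X0 by simp
  then have re: "B * S / 2 * e + 2 * Xr = 0" and im: "C * e + 2 * Xi = 0"
    by (auto simp: complex_eq_iff X_def S_def C_def q0_def)
  have "S * (B * e / 2 - dq) = 0" using re by (simp add: Xr_def algebra_simps)
  then have dqe: "dq = B * e / 2" using S by simp
  have "2 * Xi = - (e * S + B * (sinq' q0 * dq))" by (simp add: Xi_def)
  then have "(C - S) * e = B * (sinq' q0 * dq)" using im unfolding left_diff_distrib mult.commute[of e S] by linarith
  moreover have "C - S = 2 * q0 * sinq' q0" unfolding C_def S_def by (rule sinq'_eq[symmetric])
  ultimately have "sinq' q0 * (e * (2 * q0 - B\<^sup>2 / 2)) = 0"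
    by (simp add: dqe power2_eq_square algebra_simps)
  moreover have "2 * q0 - B\<^sup>2 / 2 = - (u1\<^sup>2 + u2\<^sup>2) / 2" by (simp add: q0_def Q_def field_simps)
  moreover have "u1\<^sup>2 + u2\<^sup>2 \<noteq> 0" using u by (simp add: sum_power2_eq_zero_iff)
  ultimately have e: "e = 0" using S' by auto
  then have dq0: "dq = 0" by (simp add: dqe)
  have "((\<lambda>t. of_real (sinq (Q t)) * X t) has_vector_derivative of_real (sinq (Q 0)) * Complex Xr Xi + of_real (sinq' q0 * dq) * X 0) (at 0)"
    by (intro has_vector_derivative_mult dX has_vector_derivative_of_real)
      (use dS in \<open>simp add: has_real_derivative_iff_has_vector_derivative\<close>)
  moreover have "Complex Xr Xi = 0" by (simp add: complex_eq_iff Xr_def Xi_def dq0 e)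
  ultimately have dY: "((\<lambda>t. of_real (sinq (Q t)) * X t) has_vector_derivative 0) (at 0)"
    by (simp add: dq0)
  have dU: "((\<lambda>t. Complex (u1 + t * d1) (u2 + t * d2)) has_vector_derivative Complex d1 d2) (at 0)"
    by (intro has_vector_derivative_Complex) (rule r)+
  have "((\<lambda>t. zc (g t)) has_vector_derivative 0) (at 0)"
    using bounded_linear.has_vector_derivative[OF linear_zc dg]
    unfolding linear_0[OF bounded_linear.linear[OF linear_zc]] .
  moreover have "((\<lambda>t. zc (g t)) has_vector_derivative
     Complex (u1 + 0 * d1) (u2 + 0 * d2) * 0 + Complex d1 d2 * (of_real (sinq (Q 0)) * X 0)) (at 0)"
    unfolding zg by (rule has_vector_derivative_mult[OF dU dY])
  ultimately have "Complex (u1 + 0 * d1) (u2 + 0 * d2) * 0 + Complex d1 d2 * (of_real (sinq (Q 0)) * X 0) = 0"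
    by (rule vector_derivative_unique_at[symmetric])
  then have "Complex d1 d2 = 0" using X0 S by (simp add: S_def q0_def)
  then show False using D(2) e by (simp add: w complex_eq_iff zero_prod_def)
qed

text \<open>At pi^2 \<open>sinq\<close> vanishes, and with it both coefficients of the nonconstant
  terms of the exponential.\<close>

lemma gexp_conjugate:
  assumes "(B\<^sup>2 - u1\<^sup>2 - u2\<^sup>2) / 4 = pi\<^sup>2" shows "gexp u1 u2 B = rot B"
  unfolding gexp_def Let_def assms by (simp add: pexp_def)

text \<open>Rotating the initial velocity does not move these end points.\<close>

lemma degenerate_at_pi:
  assumes u: "(u1, u2) \<noteq> (0, 0)" and q: "(B\<^sup>2 - u1\<^sup>2 - u2\<^sup>2) / 4 = pi\<^sup>2"
  shows "degenerate (u1, u2, B)"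
proof -
  obtain D where D: "(gexpv has_derivative D) (at (u1, u2, B))"
    using gexpv_differentiable[of "(u1, u2, B)"] unfolding differentiable_def by blast
  define c where "c t = (u1 * cos t - u2 * sin t, u2 * cos t + u1 * sin t, B)" for t :: real
  have "((\<lambda>t. u1 * cos t - u2 * sin t) has_vector_derivative - u2) (at 0)"
    "((\<lambda>t. u2 * cos t + u1 * sin t) has_vector_derivative u1) (at 0)"
    unfolding has_real_derivative_iff_has_vector_derivative[symmetric]
    by (auto intro!: derivative_eq_intros)
  then have "(c has_vector_derivative (- u2, u1, 0)) (at 0)"
    unfolding c_def by (intro has_vector_derivative_Pair has_vector_derivative_const)
  moreover have "(gexpv has_derivative D) (at (c 0))" using D by (simp add: c_def)
  ultimately have "((gexpv \<circ> c) has_vector_derivative D (- u2, u1, 0)) (at 0)"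
    unfolding has_vector_derivative_def
    using diff_chain_at[of c "\<lambda>t. t *\<^sub>R (- u2, u1, 0)" 0 gexpv D] has_derivative_bounded_linear[OF D]
    by (simp add: o_def linear_cmul[OF bounded_linear.linear] del: scaleR_Pair)
  moreover have "gexpv \<circ> c = (\<lambda>_. rot B)"
  proof
    fix t
    have "(u1 * cos t - u2 * sin t)\<^sup>2 + (u2 * cos t + u1 * sin t)\<^sup>2 = (u1\<^sup>2 + u2\<^sup>2) * ((cos t)\<^sup>2 + (sin t)\<^sup>2)"
    proof -
      have "(u1 * x - u2 * y)\<^sup>2 + (u2 * x + u1 * y)\<^sup>2 = (u1\<^sup>2 + u2\<^sup>2) * (x\<^sup>2 + y\<^sup>2)" for x y
        by (simp add: power2_eq_square algebra_simps)
      then show ?thesis .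
    qed
    then have "(B\<^sup>2 - (u1 * cos t - u2 * sin t)\<^sup>2 - (u2 * cos t + u1 * sin t)\<^sup>2) / 4 = pi\<^sup>2"
      using q by simp
    then show "(gexpv \<circ> c) t = rot B" by (simp add: gexpv_def c_def gexp_conjugate)
  qed
  ultimately have "D (- u2, u1, 0) = 0"
    using vector_derivative_unique_at[of "\<lambda>_. rot B" _ 0 0] by simp
  moreover have "(- u2, u1, 0 :: real) \<noteq> 0" using u by (auto simp: zero_prod_def)
  ultimately show ?thesis unfolding degenerate_def using D by blast
qed

text \<open>Along a ray q is scaled by s^2, so the first critical point is where q = pi^2, with end
  \<open>rot B\<close>. Every rotation occurs: shifting \<open>B\<close> by multiples of 2 pi until
  B > 2 pi leaves room for a nonzero \<open>u1\<close> with u1^2 = B^2 - (2 pi)^2.\<close>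

theorem first_conjugate_set_one_eq_SO2: "first_conjugate_set (mat 1) = SO2 - {mat 1}"
proof -
  have scale: "((s * B)\<^sup>2 - (s * u1)\<^sup>2 - (s * u2)\<^sup>2) / 4 = s\<^sup>2 * ((B\<^sup>2 - u1\<^sup>2 - u2\<^sup>2) / 4)" for s B u1 u2 :: real
    by (simp add: power_mult_distrib algebra_simps)
  have "{gexp u1 u2 B | u1 u2 B. (u1, u2) \<noteq> (0, 0) \<and> degenerate (u1, u2, B) \<and>
     (\<forall>s. 0 < s \<and> s < 1 \<longrightarrow> \<not> degenerate (s * u1, s * u2, s * B))} = SO2" (is "?L = _")
  proof (intro set_eqI iffI)
    fix y assume "y \<in> ?L"
    then obtain u1 u2 B where y: "y = gexp u1 u2 B" and u: "(u1, u2) \<noteq> (0, 0)" and d: "degenerate (u1, u2, B)"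
      and first: "\<And>s. 0 < s \<Longrightarrow> s < 1 \<Longrightarrow> \<not> degenerate (s * u1, s * u2, s * B)" by blast
    define q where "q = (B\<^sup>2 - u1\<^sup>2 - u2\<^sup>2) / 4"
    have "\<not> q < pi\<^sup>2" using nondegenerate[OF u] d unfolding q_def by blast
    moreover have "\<not> pi\<^sup>2 < q"
    proof
      assume lt: "pi\<^sup>2 < q"
      have q0: "q > 0" using lt by (meson less_trans zero_less_power pi_gt_zero)
      \<comment> \<open>The earlier parameter at which the ray crosses q = pi^2.\<close>
      define s where "s = pi / sqrt q"
      have s: "s > 0" "s\<^sup>2 * q = pi\<^sup>2" using q0 by (auto simp: s_def power_divide)
      have "pi < sqrt q" using real_sqrt_less_mono[OF lt] by simp
      then have "s < 1" using q0 by (simp add: s_def)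
      have "((s * B)\<^sup>2 - (s * u1)\<^sup>2 - (s * u2)\<^sup>2) / 4 = pi\<^sup>2" unfolding scale q_def[symmetric] by (rule s)
      moreover have "(s * u1, s * u2) \<noteq> (0, 0)" using u s by simp
      ultimately have "degenerate (s * u1, s * u2, s * B)" by (intro degenerate_at_pi)
      then show False using first[OF s(1) \<open>s < 1\<close>] by blast
    qed
    ultimately have "q = pi\<^sup>2" by simp
    then have "y = rot B" unfolding y q_def by (rule gexp_conjugate)
    then show "y \<in> SO2" by (simp add: SO2_eq_rot)
  next
    fix y assume "y \<in> SO2"
    then obtain \<tau> where y: "y = rot \<tau>" by (auto simp: SO2_eq_rot)
    obtain n :: nat where n: "1 - \<tau> / (2 * pi) < n" using reals_Archimedean2 by blast
    define B where "B = \<tau> + 2 * pi * n"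
    have "2 * pi * (1 - \<tau> / (2 * pi)) < 2 * pi * n" using n by (intro mult_strict_left_mono) auto
    then have B: "B > 2 * pi" by (simp add: B_def algebra_simps)
    have "cis (2 * pi * real n) = 1" by (rule cis_multiple_2pi) simp
    then have "cis B = cis \<tau>" unfolding B_def cis_mult[symmetric] by simp
    then have yB: "y = rot B"
      unfolding y rot_def by (simp add: complex_eq_iff)
    have B2: "B\<^sup>2 > (2 * pi)\<^sup>2" using B by (intro power_strict_mono) auto
    define u1 where "u1 = sqrt (B\<^sup>2 - (2 * pi)\<^sup>2)"
    have u1: "u1 > 0" "u1\<^sup>2 = B\<^sup>2 - (2 * pi)\<^sup>2" using B2 by (auto simp: u1_def)
    have q: "(B\<^sup>2 - u1\<^sup>2 - 0\<^sup>2) / 4 = pi\<^sup>2" unfolding u1 by simp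
    have u: "(u1, 0) \<noteq> (0, 0 :: real)" using u1 by simp
    have "\<not> degenerate (s * u1, s * 0, s * B)" if s: "0 < s" "s < 1" for s
    proof (rule nondegenerate)
      have "s\<^sup>2 < 1\<^sup>2" using s by (intro power_strict_mono) auto
      then have "s\<^sup>2 * pi\<^sup>2 < 1 * pi\<^sup>2" by (intro mult_strict_right_mono) auto
      then show "((s * B)\<^sup>2 - (s * u1)\<^sup>2 - (s * 0)\<^sup>2) / 4 < pi\<^sup>2" unfolding scale q by simp
    qed (use s u1 in simp)
    then show "y \<in> ?L"
      using degenerate_at_pi[OF u q] u gexp_conjugate[OF q] yB
      by (intro CollectI exI[of _ u1] exI[of _ 0] exI[of _ B]) auto
  qed
  then show ?thesis unfolding first_conjugate_set_one_eq by simp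
qed

theorem theorem3:
  shows "(\<forall>g\<in>SO21. cut_locus g = (\<lambda>h. g ** h) ` cut_locus (mat 1) \<and>
                    conjugate_set g = (\<lambda>h. g ** h) ` conjugate_set (mat 1)) \<and>
         cut_locus (mat 1) =
           {C \<in> SO21. C $ 2 $ 1 = - (C $ 1 $ 2) \<and> C $ 3 $ 1 = - (C $ 1 $ 3) \<and>
                      C $ 2 $ 3 = C $ 3 $ 2 \<and> C $ 2 $ 2 + C $ 3 $ 3 < 0}
             \<union> first_conjugate_set (mat 1) \<and>
         first_conjugate_set (mat 1) = SO2 - {mat 1}"
proof (intro conjI ballI)
  fix g assume "g \<in> SO21"
  then show "cut_locus g = (\<lambda>h. g ** h) ` cut_locus (mat 1)"
    "conjugate_set g = (\<lambda>h. g ** h) ` conjugate_set (mat 1)"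
    by (rule cut_locus_left, rule conjugate_set_left)
next
  show "cut_locus (mat 1) =
           {C \<in> SO21. C $ 2 $ 1 = - (C $ 1 $ 2) \<and> C $ 3 $ 1 = - (C $ 1 $ 3) \<and>
                      C $ 2 $ 3 = C $ 3 $ 2 \<and> C $ 2 $ 2 + C $ 3 $ 3 < 0}
             \<union> first_conjugate_set (mat 1)"
    unfolding first_conjugate_set_one_eq_SO2 by (rule cut_locus_one[unfolded opposite_set_def])
  show "first_conjugate_set (mat 1) = SO2 - {mat 1}"
    by (rule first_conjugate_set_one_eq_SO2)
qed

end
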